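(* Let $\mathcal{H}$ be a fixed infinite-dimensional separable Hilbert space and let $a>0$. Let $X_a$ be the family of all self-adjoint operators $A$ on $\mathcal{H}$ with $\|A\|\le a$, with the (metrizable) topology of strong convergence. Then there is a dense $G_\delta$ subset $\mathcal{G}\subset X_a$ such that every $A\in\mathcal{G}$ has $\operatorname{spec}(A)=[-a,a]$ and the spectrum of $A$ is purely singular continuous.
   Context: The topology of strong convergence is the strong operator topology: $A_n\to A$ iff $A_n\psi\to A\psi$ in norm for every $\psi\in\mathcal{H}$. For a self-adjoint operator $A$, $d\mu^\psi_A$ is the spectral measure given by $(\psi,e^{isA}\psi)=\int e^{isE}\,d\mu_A^\psi(E)$. The spectrum of $A$ is purely singular continuous if for every vector $\psi$ the measure $d\mu_A^\psi$ has no pure point part and no absolutely continuous part. *)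

theory Defs
  imports "HOL-Probability.Probability"
begin

section \<open>Complex Hilbert spaces\<close>

class complex_vector = real_vector +
  fixes scaleC :: "complex \<Rightarrow> 'a \<Rightarrow> 'a" (infixr "*\<^sub>C" 75)
  assumes scaleR_scaleC: "r *\<^sub>R x = complex_of_real r *\<^sub>C x"
    and scaleC_add_right: "c *\<^sub>C (x + y) = c *\<^sub>C x + c *\<^sub>C y"
    and scaleC_add_left: "(c + d) *\<^sub>C x = c *\<^sub>C x + d *\<^sub>C x"
    and scaleC_scaleC: "c *\<^sub>C d *\<^sub>C x = (c * d) *\<^sub>C x"
    and scaleC_one: "1 *\<^sub>C x = x"

global_interpretation complex_vector:
  vector_space "scaleC :: complex \<Rightarrow> 'a \<Rightarrow> 'a::complex_vector"
  by unfold_locales (simp_all add: scaleC_add_right scaleC_add_left scaleC_scaleC scaleC_one)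

text \<open>The inner product is linear in the second argument and conjugate-linear in the first.\<close>

class complex_inner = real_normed_vector + complex_vector +
  fixes cinner :: "'a \<Rightarrow> 'a \<Rightarrow> complex"
  assumes cinner_commute: "cinner x y = cnj (cinner y x)"
    and cinner_add_right: "cinner x (y + z) = cinner x y + cinner x z"
    and cinner_scaleC_right: "cinner x (c *\<^sub>C y) = c * cinner x y"
    and cinner_ge_zero: "0 \<le> Re (cinner x x)"
    and cinner_eq_zero_iff: "cinner x x = 0 \<longleftrightarrow> x = 0"
    and norm_eq_sqrt_cinner: "norm x = sqrt (Re (cinner x x))"

class chilbert_space = complex_inner + complete_space

subclass (in chilbert_space) banach ..

definition infinite_dimensional :: "'a::complex_vector itself \<Rightarrow> bool" where
  "infinite_dimensional _ \<longleftrightarrow> (\<nexists>B :: 'a set. finite B \<and> complex_vector.span B = UNIV)"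


section \<open>Bounded operators\<close>

text \<open>Elements of \<open>'a \<Rightarrow>\<^sub>L 'a\<close> are bounded and only real-linear, so complex linearity is
  required explicitly.  The norm on \<open>'a \<Rightarrow>\<^sub>L 'a\<close> is the operator norm.\<close>

definition complex_linear :: "('a::chilbert_space \<Rightarrow>\<^sub>L 'a) \<Rightarrow> bool" where
  "complex_linear A \<longleftrightarrow> (\<forall>c x. A (c *\<^sub>C x) = c *\<^sub>C A x)"

definition selfadjoint :: "('a::chilbert_space \<Rightarrow>\<^sub>L 'a) \<Rightarrow> bool" where
  "selfadjoint A \<longleftrightarrow> complex_linear A \<and> (\<forall>x y. cinner x (A y) = cinner (A x) y)"

definition selfadjoint_ball :: "real \<Rightarrow> ('a::chilbert_space \<Rightarrow>\<^sub>L 'a) set" where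
  "selfadjoint_ball a = {A. selfadjoint A \<and> norm A \<le> a}"

text \<open>On a norm-bounded set of operators on a separable space the strong topology is metrizable.\<close>

lemma metrizable_selfadjoint_ball:
  assumes "separable_space (euclidean :: 'h::chilbert_space topology)"
  shows "metrizable_space
    (subtopology strong_operator_topology (selfadjoint_ball a :: ('h \<Rightarrow>\<^sub>L 'h) set))"
proof -
  let ?X = "selfadjoint_ball a :: ('h \<Rightarrow>\<^sub>L 'h) set"
  let ?S = "subtopology strong_operator_topology ?X"
  obtain D :: "'h set" where D: "countable D" "closure D = UNIV"
    using assms by (auto simp: separable_space_def)
  define P where "P = product_topology (\<lambda>_. euclidean :: 'h topology) D"
  define r where "r A = restrict (blinfun_apply A) D" for A :: "'h \<Rightarrow>\<^sub>L 'h"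
  have P: "metrizable_space P"
    unfolding P_def metrizable_space_product_topology
    by (intro disjI2 conjI ballI metrizable_space_euclidean countable_subset[OF _ D(1)]) blast
  have apart: "dist (A x) (B x) < e"
    if "A \<in> ?X" "B \<in> ?X" "d \<in> D" "dist x d < e / (3 * (\<bar>a\<bar> + 1))" "dist (A d) (B d) < e / 3" "e > 0"
    for A B x d e
  proof -
    have 1: "dist (T x) (T d) < e / 3" if "T \<in> ?X" for T
    proof -
      have "dist (T x) (T d) = norm (T (x - d))" by (simp add: dist_norm blinfun.diff_right)
      also have "\<dots> \<le> norm T * norm (x - d)" by (rule norm_blinfun)
      also have "\<dots> \<le> (\<bar>a\<bar> + 1) * norm (x - d)"
        using that by (intro mult_right_mono) (auto simp: selfadjoint_ball_def)
      also have "\<dots> < e / 3"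
        using \<open>dist x d < e / (3 * (\<bar>a\<bar> + 1))\<close> by (simp add: dist_norm field_simps)
      finally show ?thesis .
    qed
    have "dist (A x) (B x) \<le> dist (A x) (A d) + dist (A d) (B d) + dist (B x) (B d)"
      using dist_triangle[of "A x" "B x" "A d"] dist_triangle[of "A d" "B x" "B d"]
      by (simp add: dist_commute)
    then show ?thesis using 1[OF \<open>A \<in> ?X\<close>] 1[OF \<open>B \<in> ?X\<close>] that(5) by linarith
  qed
  have near: "\<exists>d\<in>D. dist x d < e" if "e > 0" for x e
  proof -
    have "x \<in> closure D" using D(2) by simp
    then show ?thesis using that unfolding closure_approachable by (auto simp: dist_commute)
  qed
  have inj: "inj_on r ?X"
  proof (rule inj_onI)
    fix A B assume AB: "A \<in> ?X" "B \<in> ?X" "r A = r B"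
    have eqD: "A d = B d" if "d \<in> D" for d
      using fun_cong[OF AB(3), of d] that by (simp add: r_def)
    show "A = B"
    proof (rule blinfun_eqI, rule ccontr)
      fix x assume ne: "A x \<noteq> B x"
      define e where "e = dist (A x) (B x)"
      have e: "e > 0" using ne by (simp add: e_def)
      then obtain d where "d \<in> D" "dist x d < e / (3 * (\<bar>a\<bar> + 1))"
        using near[of "e / (3 * (\<bar>a\<bar> + 1))" x] by auto
      then have "dist (A x) (B x) < e"
        using apart[of A B d x e] AB e eqD by simp
      then show False by (simp add: e_def)
    qed
  qed
  define g where "g = inv_into ?X r"
  have g: "g (r A) = A" if "A \<in> ?X" for A
    using that inj by (simp add: g_def)
  have tS: "topspace ?S = ?X" by (simp add: strong_operator_topology_topspace)
  have tP: "r ` ?X \<subseteq> topspace P" by (auto simp: P_def r_def)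
  have ev: "continuous_map ?S euclidean (\<lambda>A. blinfun_apply A x)" for x
    by (intro continuous_map_from_subtopology strong_operator_topology_continuous_evaluation)
  have c1: "continuous_map ?S (subtopology P (r ` ?X)) r"
    unfolding P_def continuous_map_in_subtopology continuous_map_componentwise
    using ev by (auto simp: strong_operator_topology_topspace r_def)
  have c2: "continuous_map (subtopology P (r ` ?X)) euclidean (\<lambda>y. blinfun_apply (g y) x)" for x
  proof -
    have "\<exists>U. openin (subtopology P (r ` ?X)) U \<and> y \<in> U \<and> (\<forall>z\<in>U. dist (g y x) (g z x) < e)"
      if y: "y \<in> topspace (subtopology P (r ` ?X))" and e: "e > 0" for y e
    proof -
      obtain A where A: "A \<in> ?X" "y = r A" using y by auto
      obtain d where d: "d \<in> D" "dist x d < e / (3 * (\<bar>a\<bar> + 1))"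
        using near[of "e / (3 * (\<bar>a\<bar> + 1))" x] e by auto
      let ?V = "{z \<in> topspace P. z d \<in> ball (A d) (e / 3)}"
      have "continuous_map P euclidean (\<lambda>z. z d)"
        unfolding P_def using d(1) by (rule continuous_map_product_projection)
      then have "openin P ?V"
        by (rule openin_continuous_map_preimage) simp
      then have "openin (subtopology P (r ` ?X)) (?V \<inter> r ` ?X)"
        by (auto simp: openin_subtopology)
      moreover have "y \<in> ?V \<inter> r ` ?X"
        using A tP e d(1) by (auto simp: r_def)
      moreover have "dist (g y x) (g z x) < e" if z: "z \<in> ?V \<inter> r ` ?X" for z
      proof -
        obtain B where B: "B \<in> ?X" "z = r B" using z by auto
        have "dist (A d) (B d) < e / 3" using z B d(1) by (auto simp: r_def)
        then show ?thesis using apart[OF A(1) B(1) d _ e] A B g by simp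
      qed
      ultimately show ?thesis by blast
    qed
    then show ?thesis
      unfolding Met_TC.continuous_map_to_metric[where 'a='h, simplified] by simp
  qed
  have "homeomorphic_maps ?S (subtopology P (r ` ?X)) r g"
    unfolding homeomorphic_maps_def
  proof (intro conjI c1)
    show "continuous_map (subtopology P (r ` ?X)) ?S g"
      unfolding continuous_map_in_subtopology continuous_on_strong_operator_topo_iff_coordinatewise
      using c2 g by auto
  qed (use g tS in auto)
  then have "?S homeomorphic_space subtopology P (r ` ?X)"
    by (auto simp: homeomorphic_space_def)
  then show ?thesis
    using P metrizable_space_subtopology homeomorphic_metrizable_space by blast
qed

definition spectrum :: "('a::chilbert_space \<Rightarrow>\<^sub>L 'a) \<Rightarrow> complex set" where
  "spectrum A = {z. \<nexists>B :: 'a \<Rightarrow>\<^sub>L 'a. complex_linear B \<and>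
     (\<forall>x. B (A x - z *\<^sub>C x) = x) \<and> (\<forall>x. A (B x) - z *\<^sub>C B x = x)}"

definition exp_op :: "complex \<Rightarrow> ('a::chilbert_space \<Rightarrow>\<^sub>L 'a) \<Rightarrow> 'a \<Rightarrow> 'a" where
  "exp_op z A \<psi> = (\<Sum>n. (z ^ n / fact n) *\<^sub>C ((blinfun_apply A ^^ n) \<psi>))"


section \<open>Spectral measures\<close>

text \<open>\<open>char \<mu> s\<close> is the integral of \<open>exp (\<i> * s * E)\<close> with respect to \<open>\<mu>\<close>.\<close>

definition spectral_measure :: "('a::chilbert_space \<Rightarrow>\<^sub>L 'a) \<Rightarrow> 'a \<Rightarrow> real measure" where
  "spectral_measure A \<psi> = (THE \<mu>. finite_measure \<mu> \<and> sets \<mu> = sets borel \<and>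
     (\<forall>s::real. cinner \<psi> (exp_op (\<i> * complex_of_real s) A \<psi>) = char \<mu> s))"

text \<open>Splitting of a Borel measure on the line into its pure point, absolutely continuous
  and singular continuous parts.\<close>

definition lebesgue_decomposition ::
    "real measure \<Rightarrow> real measure \<Rightarrow> real measure \<Rightarrow> real measure \<Rightarrow> bool" where
  "lebesgue_decomposition \<mu> pp ac sc \<longleftrightarrow>
     sets \<mu> = sets borel \<and> sets pp = sets borel \<and> sets ac = sets borel \<and> sets sc = sets borel \<and>
     (\<exists>C. countable C \<and> emeasure pp (- C) = 0) \<and>
     absolutely_continuous lborel ac \<and>
     (\<forall>x. emeasure sc {x} = 0) \<and> (\<exists>N \<in> null_sets lborel. emeasure sc (- N) = 0) \<and>
     (\<forall>B \<in> sets borel. emeasure \<mu> B = emeasure pp B + emeasure ac B + emeasure sc B)"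

definition purely_singular_continuous_measure :: "real measure \<Rightarrow> bool" where
  "purely_singular_continuous_measure \<mu> \<longleftrightarrow>
     lebesgue_decomposition \<mu> (null_measure borel) (null_measure borel) \<mu>"

lemma purely_singular_continuous_measure_iff:
  "purely_singular_continuous_measure \<mu> \<longleftrightarrow>
     sets \<mu> = sets borel \<and> (\<forall>x. emeasure \<mu> {x} = 0) \<and> (\<exists>N \<in> null_sets lborel. emeasure \<mu> (- N) = 0)"
  unfolding purely_singular_continuous_measure_def lebesgue_decomposition_def
    absolutely_continuous_def
  by (auto simp: null_sets_def)

text \<open>The definition does not depend on the decomposition: if the pure point and the absolutely
  continuous part vanish in one decomposition, they vanish in each.\<close>

lemma purely_singular_continuous_measure_parts:
  assumes "purely_singular_continuous_measure \<mu>" "lebesgue_decomposition \<mu> pp ac sc"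
  shows "pp = null_measure borel" "ac = null_measure borel"
proof -
  have s[simp]: "sets pp = sets borel" "sets ac = sets borel" "sets sc = sets borel"
    and dec: "\<And>B. B \<in> sets borel \<Longrightarrow> emeasure \<mu> B = emeasure pp B + emeasure ac B + emeasure sc B"
    and abs: "absolutely_continuous lborel ac"
    using assms(2) by (auto simp: lebesgue_decomposition_def)
  obtain C where C: "countable C" "emeasure pp (- C) = 0"
    using assms(2) by (auto simp: lebesgue_decomposition_def)
  obtain N where N: "N \<in> null_sets lborel" "emeasure \<mu> (- N) = 0" and at: "\<And>x. emeasure \<mu> {x} = 0"
    using assms(1) by (auto simp: purely_singular_continuous_measure_iff)
  have [measurable]: "C \<in> sets borel" "N \<in> sets borel"
    using C(1) N(1) by (auto simp: null_sets_def intro: sets.countable)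
  have "{x} \<in> null_sets pp" for x
    using at[of x] dec[of "{x}"] by (simp add: null_sets_def)
  then have "(\<Union>x\<in>C. {x}) \<in> null_sets pp"
    using C(1) by (intro null_sets_UN') auto
  then have "C \<union> - C \<in> null_sets pp"
    using C(2) by (intro null_sets.Un) (auto simp: null_sets_def)
  then have pp0: "UNIV \<in> null_sets pp" by simp
  show "pp = null_measure borel"
    using emeasure_eq_0[of UNIV pp] pp0 by (intro measure_eqI) (auto simp: null_sets_def)
  have "N \<in> null_sets ac"
    using abs N(1) by (auto simp: absolutely_continuous_def)
  moreover have "- N \<in> null_sets ac"
    using N(2) dec[of "- N"] by (auto simp: null_sets_def)
  ultimately have "N \<union> - N \<in> null_sets ac" by blast
  then have ac0: "UNIV \<in> null_sets ac" by simp
  show "ac = null_measure borel"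
    using emeasure_eq_0[of UNIV ac] ac0 by (intro measure_eqI) (auto simp: null_sets_def)
qed

definition purely_singular_continuous_spectrum :: "('a::chilbert_space \<Rightarrow>\<^sub>L 'a) \<Rightarrow> bool" where
  "purely_singular_continuous_spectrum A \<longleftrightarrow>
     (\<forall>\<psi>. purely_singular_continuous_measure (spectral_measure A \<psi>))"

end

theory Submission
  imports Defs "HOL-Computational_Algebra.Polynomial"
begin

text \<open>
  This is a Baire category argument: the required properties are written as a countable intersection
  of strongly open dense conditions.  For a polynomial \<open>p\<close> the quadratic form \<open>(\<psi>, p(A) \<psi>)\<close> is strongly
  continuous on norm-bounded sets, and it equals \<open>\<integral> p d\<mu>\<close> for the spectral measure \<open>\<mu>\<close>.  The measure
  has no atom iff polynomials \<open>p\<close> with small integral and values in \<open>[0, 1]\<close> on \<open>[-a, a]\<close> can be found such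
  that at each point of \<open>[-a, a]\<close> one of them is at least \<open>1/2\<close>.  It is singular iff some such \<open>p\<close> with
  small integral is at least \<open>1/2\<close> off a set of small Lebesgue measure.  Both conditions, and the
  existence of approximate eigenvectors for a given \<open>E\<close>, are open in \<open>A\<close>.

  Compressing \<open>A\<close> to a large finite-dimensional subspace gives a strong approximation of finite rank, for
  which singularity is clear; an eigenvalue \<open>E\<close> can be added on the orthogonal complement.  To
  remove atoms, \<open>A\<close> is repeatedly doubled to the block operator with diagonal \<open>(A, A)\<close> and off-diagonal
  \<open>(t, t)\<close>, which replaces the spectral measure by the mean of its translates by \<open>t\<close> and \<open>-t\<close>.

  The spectral measure is obtained by solving the Hausdorff moment problem for \<open>p \<mapsto> (\<psi>, p(A) \<psi>)\<close>.
\<close>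

section \<open>Inner products\<close>

text \<open>Atoms and singular parts would be read off most directly from spectral projections, but
  these are not strongly continuous in \<open>A\<close>. Polynomials in \<open>A\<close> are, on
  norm-bounded sets, where multiplication is jointly strongly continuous; this dictates the form of
  all the conditions.

  The obstacle is that the accessible approximants, the operators of finite rank, have spectral
  measures made of finitely many atoms, the opposite of what is wanted. Each open condition fixes
  only a tolerance \<open>e\<close>, however, so it is enough that every mass is small compared with
  \<open>e\<close>: after \<open>m\<close> doublings a unit mass is cut into 2^m equally spaced
  pieces. Infinite dimension supplies the orthogonal room for the copies. Since translating spectral
  measures could leave {-a..a}, the operator is first contracted slightly.

  Countability enters three times, through a dense sequence of vectors, rational energies and
  tolerances 1/(n+1). Baire's theorem needs more than metrizability of the ball, hence the separate
  proof that it is completely metrizable.\<close>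

lemma cinner_add_left: "cinner (x + y) z = cinner x z + cinner y z"
  by (metis cinner_add_right cinner_commute complex_cnj_add)

lemma cinner_scaleC_left: "cinner (c *\<^sub>C x) y = cnj c * cinner x y"
  by (metis cinner_commute cinner_scaleC_right complex_cnj_mult complex_cnj_cnj)

lemma cinner_scaleR_right: "cinner x (r *\<^sub>R y) = r *\<^sub>R cinner x y"
  by (simp add: scaleR_scaleC cinner_scaleC_right scaleR_conv_of_real)

lemma cinner_scaleR_left: "cinner (r *\<^sub>R x) y = r *\<^sub>R cinner x y"
  by (simp add: scaleR_scaleC cinner_scaleC_left scaleR_conv_of_real)

lemma cinner_minus_right: "cinner x (- y) = - cinner x y"
  using cinner_scaleR_right[of x "-1" y] by simp

lemma cinner_diff_right: "cinner x (y - z) = cinner x y - cinner x z"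
  using cinner_add_right[of x y "- z"] by (simp add: cinner_minus_right)

lemma cinner_diff_left: "cinner (x - y) z = cinner x z - cinner y z"
  by (metis cinner_diff_right cinner_commute complex_cnj_diff)

lemma cinner_self: "cinner x x = complex_of_real ((norm x)\<^sup>2)"
proof -
  have "Im (cinner x x) = 0"
    using arg_cong[OF cinner_commute[of x x], of Im] by simp
  then show ?thesis
    using cinner_ge_zero[of x] by (simp add: complex_eq_iff norm_eq_sqrt_cinner)
qed

lemma cinner_zero [simp]: "cinner x 0 = 0" "cinner 0 x = 0"
  using cinner_scaleR_right[of x 0 0] cinner_scaleR_left[of 0 0 x] by simp_all

lemma norm_scaleC: "norm (c *\<^sub>C x) = cmod c * norm (x::'a::complex_inner)"
proof -
  have "cinner (c *\<^sub>C x) (c *\<^sub>C x) = (c * cnj c) * cinner x x"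
    by (simp add: cinner_scaleC_left cinner_scaleC_right)
  then have "complex_of_real ((norm (c *\<^sub>C x))\<^sup>2) = complex_of_real ((cmod c * norm x)\<^sup>2)"
    by (simp only: cinner_self complex_norm_square[symmetric] of_real_mult[symmetric] power_mult_distrib)
  then have "(norm (c *\<^sub>C x))\<^sup>2 = (cmod c * norm x)\<^sup>2"
    using of_real_eq_iff by blast
  then show ?thesis
    by (simp add: power2_eq_iff_nonneg)
qed

lemma norm_add_square: "(norm (x + y))\<^sup>2 = (norm x)\<^sup>2 + 2 * Re (cinner x y) + (norm y)\<^sup>2"
proof -
  have "complex_of_real ((norm (x + y))\<^sup>2) = cinner x x + cinner x y + cnj (cinner x y) + cinner y y"
    unfolding cinner_self[symmetric] cinner_commute[of y x, symmetric]
    by (simp add: cinner_add_left cinner_add_right)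
  then have "Re (complex_of_real ((norm (x + y))\<^sup>2)) = (norm x)\<^sup>2 + 2 * Re (cinner x y) + (norm y)\<^sup>2"
    by (simp add: cinner_self)
  then show ?thesis by simp
qed

lemma Re_cinner_le: "Re (cinner x y) \<le> norm x * norm y"
proof (cases "x = 0 \<or> y = 0")
  case True
  then show ?thesis by auto
next
  case False
  have "(norm ((norm y) *\<^sub>R x + (- norm x) *\<^sub>R y))\<^sup>2 =
      2 * (norm x * norm y) * (norm x * norm y - Re (cinner x y))"
    unfolding norm_add_square by (simp add: cinner_scaleR_left cinner_scaleR_right cinner_minus_right
        power2_eq_square algebra_simps)
  then have "0 \<le> 2 * (norm x * norm y) * (norm x * norm y - Re (cinner x y))"
    by (metis zero_le_power2)
  moreover have "0 < norm x * norm y" using False by simp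
  ultimately show ?thesis
    using mult_pos_neg[of "2 * (norm x * norm y)" "norm x * norm y - Re (cinner x y)"] by linarith
qed

text \<open>A phase \<open>c\<close> rotates the inner product onto the positive reals, which
  reduces the modulus to the real part.\<close>

lemma norm_cinner_le: "cmod (cinner x y) \<le> norm x * norm y"
proof (cases "cinner x y = 0")
  case False
  define c where "c = cnj (cinner x y) / cmod (cinner x y)"
  have c: "cmod c = 1" using False by (simp add: c_def norm_divide)
  have "c * cinner x y = cmod (cinner x y)"
    using False complex_norm_square[of "cinner x y"]
    by (simp add: c_def power2_eq_square field_simps)
  then have "cmod (cinner x y) = Re (cinner x (c *\<^sub>C y))"
    by (simp add: cinner_scaleC_right)
  also have "\<dots> \<le> norm x * norm y"
    using Re_cinner_le[of x "c *\<^sub>C y"] c by (simp add: norm_scaleC)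
  finally show ?thesis .
qed auto

lemma bounded_bilinear_cinner: "bounded_bilinear (cinner :: 'a::complex_inner \<Rightarrow> 'a \<Rightarrow> complex)"
proof
  show "\<exists>K. \<forall>a b::'a. norm (cinner a b) \<le> norm a * norm b * K"
    using norm_cinner_le by (intro exI[of _ 1]) auto
qed (auto simp: cinner_add_left cinner_add_right cinner_scaleR_left cinner_scaleR_right)

global_interpretation cinner: bounded_bilinear "cinner :: 'a::complex_inner \<Rightarrow> 'a \<Rightarrow> complex"
  by (rule bounded_bilinear_cinner)

lemma bounded_bilinear_scaleC: "bounded_bilinear (scaleC :: complex \<Rightarrow> 'a::complex_inner \<Rightarrow> 'a)"
proof
  show "\<exists>K. \<forall>a. \<forall>b::'a. norm (a *\<^sub>C b) \<le> norm a * norm b * K"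
    by (intro exI[of _ 1]) (auto simp: norm_scaleC)
  show "(r *\<^sub>R a) *\<^sub>C b = r *\<^sub>R a *\<^sub>C b" for r a and b :: 'a
    by (simp add: scaleR_scaleC scaleC_scaleC scaleR_conv_of_real)
  show "a *\<^sub>C r *\<^sub>R b = r *\<^sub>R a *\<^sub>C b" for r a and b :: 'a
    by (simp add: scaleR_scaleC scaleC_scaleC mult.commute)
qed (auto simp: scaleC_add_left scaleC_add_right)

lemma selfadjointD:
  fixes A :: "'a::chilbert_space \<Rightarrow>\<^sub>L 'a"
  assumes "selfadjoint A"
  shows "A (c *\<^sub>C x) = c *\<^sub>C A x" "cinner x (A y) = cinner (A x) y"
  using assms by (auto simp: selfadjoint_def complex_linear_def)

lemma cinner_eqI:
  assumes "\<And>z. cinner z x = cinner z y"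
  shows "x = y"
  using assms[of "x - y"] cinner_eq_zero_iff[of "x - y"] by (simp add: cinner_diff_right)

text \<open>The inner product separates vectors, so symmetry alone forces complex linearity; the
  operators constructed below need no separate linearity proof.\<close>

lemma selfadjointI:
  fixes A :: "'a::chilbert_space \<Rightarrow>\<^sub>L 'a"
  assumes "\<And>x y. cinner x (A y) = cinner (A x) y"
  shows "selfadjoint A"
  unfolding selfadjoint_def complex_linear_def
proof (intro conjI allI assms)
  show "A (c *\<^sub>C x) = c *\<^sub>C A x" for c x
  proof (rule cinner_eqI)
    fix z
    show "cinner z (A (c *\<^sub>C x)) = cinner z (c *\<^sub>C A x)"
      unfolding assms cinner_scaleC_right by (simp add: assms)
  qed
qed

section \<open>Polynomials of operators\<close>

text \<open>Horner's scheme applied to a vector. The coefficients are real so that a polynomial in a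
  symmetric operator is symmetric again.\<close>

definition poly_op :: "real poly \<Rightarrow> ('a::real_normed_vector \<Rightarrow>\<^sub>L 'a) \<Rightarrow> 'a \<Rightarrow> 'a" where
  "poly_op p A x = fold_coeffs (\<lambda>c f. c *\<^sub>R x + A f) p 0"

lemma poly_op_0 [simp]: "poly_op 0 A x = 0"
  by (simp add: poly_op_def)

lemma poly_op_pCons [simp]: "poly_op (pCons c p) A x = c *\<^sub>R x + A (poly_op p A x)"
  by (cases "p = 0 \<and> c = 0") (auto simp: poly_op_def blinfun.zero_right)

lemma poly_op_1 [simp]: "poly_op 1 A x = x"
  by (simp add: one_pCons blinfun.zero_right)

lemma poly_op_add: "poly_op (p + q) A x = poly_op p A x + poly_op q A x"
  by (induction p q rule: poly_induct2) (auto simp: algebra_simps blinfun.bilinear_simps)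

lemma poly_op_smult: "poly_op (smult c p) A x = c *\<^sub>R poly_op p A x"
  by (induction p) (auto simp: algebra_simps blinfun.bilinear_simps)

lemma poly_op_diff: "poly_op (p - q) A x = poly_op p A x - poly_op q A x"
  using poly_op_add[of p "- q" A x] poly_op_smult[of "-1" q A x] by simp

lemma poly_op_sum: "poly_op (\<Sum>i\<in>I. f i) A x = (\<Sum>i\<in>I. poly_op (f i) A x)"
  by (induction I rule: infinite_finite_induct) (auto simp: poly_op_add)

lemma poly_op_mult: "poly_op (p * q) A x = poly_op p A (poly_op q A x)"
  by (induction p) (auto simp: poly_op_add poly_op_smult)

lemma poly_op_monom: "poly_op (monom c n) A x = c *\<^sub>R (blinfun_apply A ^^ n) x"
  by (induction n) (auto simp: monom_0 monom_Suc blinfun.bilinear_simps)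

lemma poly_op_add_right: "poly_op p A (x + y) = poly_op p A x + poly_op p A y"
  by (induction p) (auto simp: algebra_simps blinfun.bilinear_simps)

lemma poly_op_diff_right: "poly_op p A (x - y) = poly_op p A x - poly_op p A y"
  using poly_op_add_right[of p A "x - y" y] by simp

lemma cinner_poly_op_swap:
  assumes "selfadjoint A"
  shows "cinner x (poly_op p A y) = cinner (poly_op p A x) y"
proof (induction p arbitrary: x y)
  case (pCons c p)
  have comm: "A (poly_op p A x) = poly_op p A (A x)" for x
    using poly_op_mult[of "[:0,1:]" p A x] poly_op_mult[of p "[:0,1:]" A x]
    by (simp add: mult.commute blinfun.bilinear_simps)
  show ?case
    by (simp add: cinner_add_right cinner_add_left cinner_scaleR_left cinner_scaleR_right
        selfadjointD(2)[OF assms] pCons comm)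
qed simp_all

definition poly_form :: "('a::chilbert_space \<Rightarrow>\<^sub>L 'a) \<Rightarrow> 'a \<Rightarrow> real poly \<Rightarrow> real" where
  "poly_form A \<psi> p = Re (cinner \<psi> (poly_op p A \<psi>))"

lemma poly_form_simps:
  "poly_form A \<psi> 0 = 0"
  "poly_form A \<psi> (p + q) = poly_form A \<psi> p + poly_form A \<psi> q"
  "poly_form A \<psi> (p - q) = poly_form A \<psi> p - poly_form A \<psi> q"
  "poly_form A \<psi> (smult c p) = c * poly_form A \<psi> p"
  "poly_form A \<psi> (sum f I) = (\<Sum>i\<in>I. poly_form A \<psi> (f i))"
  "poly_form A \<psi> 1 = (norm \<psi>)\<^sup>2"
  unfolding poly_form_def
  by (simp_all add: poly_op_add poly_op_diff poly_op_smult poly_op_sum cinner_add_right cinner_diff_right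
      cinner_scaleR_right cinner.sum_right cinner_self flip: Re_sum)

text \<open>Symmetry moves one factor \<open>q\<close> to the other side of the inner product.
  Positivity of the form of \<open>p\<close> at all vectors thus passes to
  \<open>q * p * q\<close>.\<close>

lemma poly_form_square:
  assumes "selfadjoint A"
  shows "poly_form A \<psi> (q * p * q) = poly_form A (poly_op q A \<psi>) p"
  unfolding poly_form_def by (simp add: poly_op_mult cinner_poly_op_swap[OF assms] mult.assoc)

lemma poly_form_eq_cinner:
  assumes "selfadjoint A"
  shows "cinner \<psi> (poly_op p A \<psi>) = complex_of_real (poly_form A \<psi> p)"
proof -
  have "Im (cinner \<psi> (poly_op p A \<psi>)) = - Im (cinner \<psi> (poly_op p A \<psi>))"
    by (metis cinner_commute cinner_poly_op_swap[OF assms] cnj.sel(2))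
  then show ?thesis by (simp add: poly_form_def complex_eq_iff)
qed

section \<open>The Hausdorff moment problem\<close>

text \<open>The ratio is the coefficient of the monomial of degree \<open>j\<close> in the Bernstein
  basis of degree \<open>n\<close>; the power is the value of that monomial at the node k/n. The
  ratio is a product of factors (k - i)/(n - i), each close to k/n, and the errors accumulate along
  the induction.\<close>

lemma binomial_ratio_approx:
  assumes "k \<le> n" "j < n"
  shows "\<bar>real (k choose j) / real (n choose j) - (real k / real n) ^ j\<bar> \<le> real (j * j) / real (n - j)"
  using assms(2)
proof (induction j)
  case (Suc j)
  define r where "r j = real (k choose j) / real (n choose j)" for j
  \<comment> \<open>Subtraction in the reals makes the absorption identity hold also for
    \<open>m < j\<close>, where both sides vanish.\<close>
  have abs: "real (Suc j) * real (m choose Suc j) = (real m - real j) * real (m choose j)" for m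
    using gbinomial_mult_1[of "real m" j] by (simp add: binomial_gbinomial algebra_simps)
  have r01: "0 \<le> r j" "r j \<le> 1"
    using assms(1) Suc.prems by (auto simp: r_def binomial_right_mono divide_le_eq)
  have pos: "real (n choose j) > 0" "real (n choose Suc j) > 0" "real n - real j > 0"
    using Suc.prems by (auto simp: zero_less_binomial_iff)
  have rec: "r (Suc j) = r j * ((real k - real j) / (real n - real j))"
  proof -
    have "r (Suc j) = (real (Suc j) * real (k choose Suc j)) / (real (Suc j) * real (n choose Suc j))"
      unfolding r_def by (rule mult_divide_mult_cancel_left[symmetric]) simp
    then show ?thesis unfolding abs r_def by (simp add: mult.commute)
  qed
  have "\<bar>r (Suc j) - (real k / real n) ^ Suc j\<bar> \<le>
      \<bar>r j * ((real k - real j) / (real n - real j) - real k / real n)\<bar> +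
      \<bar>real k / real n * (r j - (real k / real n) ^ j)\<bar>"
    unfolding rec by (rule order_trans[OF _ abs_triangle_ineq]) (simp add: algebra_simps)
  also have "\<bar>r j * ((real k - real j) / (real n - real j) - real k / real n)\<bar> \<le> real j / real (n - j)"
  proof -
    have "(real k - real j) / (real n - real j) - real k / real n = - (real j / (real n - real j)) * ((real n - real k) / real n)"
      using pos Suc.prems by (simp add: field_simps)
    then have "\<bar>(real k - real j) / (real n - real j) - real k / real n\<bar> = (real j / (real n - real j)) * ((real n - real k) / real n)"
      using pos assms(1) by (simp add: abs_mult)
    also have "\<dots> \<le> (real j / (real n - real j)) * 1"
      using pos assms(1) Suc.prems by (intro mult_left_mono) (auto simp: divide_le_eq)
    finally have "\<bar>r j\<bar> * \<bar>(real k - real j) / (real n - real j) - real k / real n\<bar> \<le> 1 * (real j / (real n - real j))"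
      using r01 pos by (intro mult_mono) auto
    then show ?thesis using Suc.prems by (simp add: abs_mult of_nat_diff)
  qed
  also have "\<bar>real k / real n * (r j - (real k / real n) ^ j)\<bar> \<le> real (j * j) / real (n - j)"
  proof -
    have "\<bar>real k / real n\<bar> * \<bar>r j - (real k / real n) ^ j\<bar> \<le> 1 * (real (j * j) / real (n - j))"
      using Suc assms(1) by (intro mult_mono) (auto simp: r_def divide_le_eq)
    then show ?thesis by (simp add: abs_mult)
  qed
  also have "real j / real (n - j) + real (j * j) / real (n - j) = real (j * Suc j) / real (n - j)"
    by (simp add: add_divide_distrib)
  also have "\<dots> \<le> real (Suc j * Suc j) / real (n - Suc j)"
    using Suc.prems by (intro frac_le) (auto intro!: of_nat_mono simp del: of_nat_mult of_nat_Suc)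
  finally show ?case by (simp add: r_def)
qed simp

definition bernstein_poly :: "nat \<Rightarrow> nat \<Rightarrow> real poly" where
  "bernstein_poly n k = smult (real (n choose k)) ([:0, 1:] ^ k * (1 - [:0, 1:]) ^ (n - k))"

lemma smult_sum_right: "smult c (sum f I) = (\<Sum>i\<in>I. smult c (f i))"
  by (induction I rule: infinite_finite_induct) (auto simp: smult_add_right)

text \<open>Since C(k,j) C(n,k) = C(n,j) C(n-j,k-j), the power \<open>[:0, 1:] ^ j\<close> factors
  out and what remains is the binomial expansion of a power of X + (1 - X) = 1.\<close>

lemma sum_choose_bernstein:
  assumes "j \<le> n"
  shows "(\<Sum>k\<le>n. smult (real (k choose j)) (bernstein_poly n k)) = smult (real (n choose j)) ([:0, 1:] ^ j)"
proof -
  define X where "X = ([:0, 1:] :: real poly)"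
  have "(\<Sum>k\<le>n. smult (real (k choose j)) (bernstein_poly n k)) =
      (\<Sum>k\<in>{j..n}. smult (real (k choose j)) (bernstein_poly n k))"
    by (intro sum.mono_neutral_right) auto
  also have "\<dots> = (\<Sum>k\<in>{j..n}. smult (real (n choose j)) (X ^ j * (smult (real ((n - j) choose (k - j))) (X ^ (k - j) * (1 - X) ^ (n - k)))))"
  proof (intro sum.cong refl)
    fix k assume k: "k \<in> {j..n}"
    have "real (k choose j) * real (n choose k) = real (n choose j) * real ((n - j) choose (k - j))"
      using choose_mult[of j k n] k by (simp flip: of_nat_mult add: mult.commute)
    moreover have "X ^ k = X ^ j * X ^ (k - j)"
      using k by (simp flip: power_add)
    ultimately show "smult (real (k choose j)) (bernstein_poly n k) =
        smult (real (n choose j)) (X ^ j * (smult (real ((n - j) choose (k - j))) (X ^ (k - j) * (1 - X) ^ (n - k))))"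
      by (simp add: bernstein_poly_def mult.assoc flip: X_def)
  qed
  also have "\<dots> = smult (real (n choose j)) (X ^ j * (\<Sum>k\<in>{j..n}. smult (real ((n - j) choose (k - j))) (X ^ (k - j) * (1 - X) ^ (n - k))))"
    by (simp add: sum_distrib_left smult_sum_right)
  also have "(\<Sum>k\<in>{j..n}. smult (real ((n - j) choose (k - j))) (X ^ (k - j) * (1 - X) ^ (n - k))) =
      (\<Sum>i\<le>n - j. of_nat ((n - j) choose i) * X ^ i * (1 - X) ^ (n - j - i))"
    using assms
    by (intro sum.reindex_bij_witness[of _ "\<lambda>i. i + j" "\<lambda>k. k - j"]) (auto simp: of_nat_poly ac_simps)
  also have "\<dots> = (X + (1 - X)) ^ (n - j)"
    by (rule binomial_ring[symmetric])
  finally show ?thesis by (simp add: X_def)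
qed

text \<open>The values of \<open>L\<close> on the Bernstein polynomials of degree \<open>n\<close>
  are nonnegative with sum 1, so they form a probability measure on the nodes k/n. Its polynomial
  integrals tend to \<open>L\<close>, and tightness yields a weakly convergent subsequence whose
  limit is \<open>M\<close>.\<close>

theorem hausdorff_moment:
  fixes L :: "real poly \<Rightarrow> real"
  assumes add: "\<And>p q. L (p + q) = L p + L q" and smult: "\<And>c p. L (smult c p) = c * L p"
    and one: "L 1 = 1" and pos: "\<And>k l. 0 \<le> L ([:0, 1:] ^ k * (1 - [:0, 1:]) ^ l)"
  obtains M where "real_distribution M" "AE x in M. x \<in> {0..1}" "\<And>p. (\<integral>x. poly p x \<partial>M) = L p"
proof -
  have L0: "L 0 = 0" using smult[of 0 0] by simp
  have Lsum: "L (sum f I) = (\<Sum>i\<in>I. L (f i))" for f and I :: "nat set"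
    by (induction I rule: infinite_finite_induct) (auto simp: add L0)
  define w where "w n k = L (bernstein_poly n k)" for n k
  have w0: "0 \<le> w n k" for n k
    by (simp add: w_def bernstein_poly_def smult pos)
  have wsum: "(\<Sum>k\<le>n. real (k choose j) * w n k) = real (n choose j) * L ([:0, 1:] ^ j)" if "j \<le> n" for n j
    using arg_cong[OF sum_choose_bernstein[OF that], of L] by (simp add: Lsum smult w_def)
  have w1: "(\<Sum>k\<le>n. w n k) = 1" for n
    using wsum[of 0 n] one by simp
  have lim_power: "(\<lambda>n. \<Sum>k\<le>n. w n k * (real k / real n) ^ j) \<longlonglongrightarrow> L ([:0, 1:] ^ j)" for j
  proof -
    have "\<forall>\<^sub>F n in sequentially. norm ((\<Sum>k\<le>n. w n k * (real k / real n) ^ j) - L ([:0, 1:] ^ j)) \<le> real (j * j) / real (n - j)"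
      using eventually_gt_at_top[of j]
    proof eventually_elim
      case (elim n)
      have "L ([:0, 1:] ^ j) = (\<Sum>k\<le>n. w n k * (real (k choose j) / real (n choose j)))"
        using wsum[of j n] elim by (simp add: field_simps flip: sum_divide_distrib)
      then have "norm ((\<Sum>k\<le>n. w n k * (real k / real n) ^ j) - L ([:0, 1:] ^ j)) =
          norm (\<Sum>k\<le>n. w n k * ((real k / real n) ^ j - real (k choose j) / real (n choose j)))"
        by (simp add: right_diff_distrib sum_subtractf)
      also have "\<dots> \<le> (\<Sum>k\<le>n. w n k * (real (j * j) / real (n - j)))"
        using binomial_ratio_approx[OF _ elim] w0
        by (intro sum_norm_le)
            (simp add: abs_mult abs_minus_commute mult_left_mono del: of_nat_mult times_divide_eq_right)
      also have "\<dots> = real (j * j) / real (n - j)"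
        unfolding sum_distrib_right[symmetric] w1 by simp
      finally show ?case .
    qed
    moreover have "(\<lambda>n. real (j * j) / real (n - j)) \<longlonglongrightarrow> 0"
    proof (rule LIMSEQ_offset[where k = j])
      show "(\<lambda>n. real (j * j) / real (n + j - j)) \<longlonglongrightarrow> 0"
        by (simp add: lim_const_over_n del: of_nat_mult)
    qed
    ultimately have "(\<lambda>n. (\<Sum>k\<le>n. w n k * (real k / real n) ^ j) - L ([:0, 1:] ^ j)) \<longlonglongrightarrow> 0"
      by (rule Lim_null_comparison)
    then show ?thesis by (rule LIM_zero_cancel)
  qed
  have lim_poly: "(\<lambda>n. \<Sum>k\<le>n. w n k * poly p (real k / real n)) \<longlonglongrightarrow> L p" for p
  proof -
    have "p = (\<Sum>i\<le>degree p. smult (coeff p i) ([:0, 1:] ^ i))"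
      using poly_as_sum_of_monoms[of p] by (simp add: monom_altdef)
    then have "L p = (\<Sum>i\<le>degree p. coeff p i * L ([:0, 1:] ^ i))"
      by (metis (no_types, lifting) Lsum smult sum.cong)
    moreover have "(\<Sum>k\<le>n. w n k * poly p (real k / real n)) =
        (\<Sum>i\<le>degree p. coeff p i * (\<Sum>k\<le>n. w n k * (real k / real n) ^ i))" for n
      unfolding poly_altdef sum_distrib_left
      by (subst sum.swap) (simp add: ac_simps)
    ultimately show ?thesis
      by (simp only:) (intro tendsto_sum tendsto_mult_left lim_power)
  qed
  define P where "P n = point_measure {..n} (\<lambda>k. ennreal (w n k))" for n
  \<comment> \<open>For \<open>n = 0\<close> the quotient is 0 by convention, so the mass sits at 0,
    still inside {0..1}.\<close>
  define \<nu> where "\<nu> n = distr (P n) borel (\<lambda>k. real k / real n)" for n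
  have emP: "emeasure (P n) (space (P n)) = 1" for n
    unfolding P_def using w0 w1[of n]
    by (simp add: space_point_measure emeasure_point_measure_finite sum_ennreal)
  have psP: "prob_space (P n)" for n
    by (rule prob_spaceI) (rule emP)
  have meas: "(\<lambda>k. real k / real n) \<in> measurable (P n) borel" for n
    by (simp add: P_def measurable_point_measure_eq1)
  have rd: "real_distribution (\<nu> n)" for n
    unfolding \<nu>_def by (rule prob_space.real_distribution_distr[OF psP meas])
  have int\<nu>: "(\<integral>x. f x \<partial>\<nu> n) = (\<Sum>k\<le>n. w n k * f (real k / real n))"
    if "f \<in> borel_measurable borel" for f :: "real \<Rightarrow> real" and n
  proof -
    have "(\<integral>x. f x \<partial>\<nu> n) = (\<integral>k. f (real k / real n) \<partial>P n)"
      unfolding \<nu>_def using meas that by (rule integral_distr)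
    then show ?thesis
      unfolding P_def by (simp add: lebesgue_integral_point_measure_finite w0)
  qed
  have "tight \<nu>"
    unfolding tight_def
  proof (intro conjI allI rd impI)
    fix \<epsilon> :: real assume "\<epsilon> > 0"
    \<comment> \<open>Tightness is stated with intervals open on the left, so the left end has to
      lie strictly below a possible atom at 0.\<close>
    have "measure (\<nu> n) {-1<..1} = 1" for n
    proof -
      have "- 1 < real k / real n" for k
        by (rule less_le_trans[of _ 0]) auto
      then have "(\<lambda>k. real k / real n) -` {-1<..1} \<inter> space (P n) = space (P n)"
        by (auto simp: P_def space_point_measure divide_le_eq)
      then show ?thesis
        using prob_space.prob_space[OF psP[of n]] by (simp add: \<nu>_def measure_distr[OF meas])
    qed
    then show "\<exists>a b. a < b \<and> (\<forall>n. 1 - \<epsilon> < measure (\<nu> n) {a<..b})"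
      using \<open>\<epsilon> > 0\<close> by (intro exI[of _ "-1"] exI[of _ 1]) auto
  qed
  then obtain r M where r: "strict_mono r" and M: "real_distribution M" and "weak_conv_m (\<nu> \<circ> id \<circ> r) M"
    using tight_imp_convergent_subsubsequence[of \<nu> id] strict_mono_id by blast
  then have weak: "weak_conv_m (\<lambda>n. \<nu> (r n)) M" by (simp add: comp_def)
  interpret M: real_distribution M by (rule M)
  have conv: "(\<lambda>n. \<integral>x. f x \<partial>\<nu> (r n)) \<longlonglongrightarrow> (\<integral>x. f x \<partial>M)"
    if "\<And>x. isCont f x" "\<And>x. \<bar>f x\<bar> \<le> B" for f :: "real \<Rightarrow> real" and B
    using weak_conv_imp_integral_bdd_continuous_conv[OF rd M weak that(1), of B] that(2) by simp
  have M01: "AE x in M. x \<in> {0..1}"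
  proof -
    \<comment> \<open>A bounded continuous function whose zero set is exactly {0..1}: its integral
      is 0 for every \<open>\<nu> n\<close>, hence also for the limit.\<close>
    define f :: "real \<Rightarrow> real" where "f x = min 1 (max 0 (max (- x) (x - 1)))" for x
    have f_nonneg: "0 \<le> f x" for x by (simp add: f_def)
    have f: "continuous_on UNIV f"
      unfolding f_def by (intro continuous_intros)
    then have fm: "f \<in> borel_measurable borel" by (rule borel_measurable_continuous_onI)
    have "(\<integral>x. f x \<partial>\<nu> n) = 0" for n
      unfolding int\<nu>[OF fm] by (intro sum.neutral) (auto simp: f_def divide_le_eq)
    moreover have "(\<lambda>n. \<integral>x. f x \<partial>\<nu> (r n)) \<longlonglongrightarrow> (\<integral>x. f x \<partial>M)"
      using f by (intro conv[of _ 1]) (auto simp: continuous_on_eq_continuous_at f_def)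
    ultimately have "(\<integral>x. f x \<partial>M) = 0"
      using LIMSEQ_unique[of "\<lambda>n. 0::real"] by simp
    moreover have "integrable M f"
      using fm by (intro M.integrable_const_bound[of _ 1]) (auto simp: f_def)
    ultimately have "AE x in M. f x = 0"
      by (subst integral_nonneg_eq_0_iff_AE[symmetric]) (simp_all add: f_nonneg)
    then show ?thesis by eventually_elim (auto simp: f_def min_def max_def split: if_splits)
  qed
  have "(\<integral>x. poly p x \<partial>M) = L p" for p
  proof -
    \<comment> \<open>Weak convergence tests bounded functions only, so the polynomial is frozen
      outside {0..1}, where none of the measures has mass.\<close>
    define g where "g x = poly p (max 0 (min 1 x))" for x
    have g: "continuous_on UNIV g"
      unfolding g_def by (intro continuous_intros)
    then have gm: "g \<in> borel_measurable borel" by (rule borel_measurable_continuous_onI)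
    have "compact (poly p ` {0..1})"
      by (intro compact_continuous_image continuous_intros) auto
    then obtain B where B: "\<And>x. x \<in> {0..1} \<Longrightarrow> \<bar>poly p x\<bar> \<le> B"
      using compact_imp_bounded bounded_iff by (metis (no_types, lifting) imageI real_norm_def)
    have "(\<integral>x. g x \<partial>\<nu> n) = (\<Sum>k\<le>n. w n k * poly p (real k / real n))" for n
    proof -
      have "max 0 (min 1 (real k / real n)) = real k / real n" if "k \<le> n" for k
        using that by (simp add: divide_le_eq min_absorb2)
      then show ?thesis
        unfolding int\<nu>[OF gm] by (intro sum.cong) (auto simp: g_def)
    qed
    moreover have "(\<lambda>n. \<integral>x. g x \<partial>\<nu> (r n)) \<longlonglongrightarrow> (\<integral>x. g x \<partial>M)"
      using g by (intro conv[of _ B]) (auto simp: continuous_on_eq_continuous_at g_def intro!: B)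
    ultimately have "(\<integral>x. g x \<partial>M) = L p"
      using LIMSEQ_subseq_LIMSEQ[OF lim_poly[of p] r] by (simp add: comp_def LIMSEQ_unique)
    moreover have "(\<integral>x. g x \<partial>M) = (\<integral>x. poly p x \<partial>M)"
    proof (rule integral_cong_AE)
      show "AE x in M. g x = poly p x"
        using M01 by eventually_elim (simp add: g_def)
      have "poly p \<in> borel_measurable borel"
        by (intro borel_measurable_continuous_onI continuous_intros)
      then show "poly p \<in> borel_measurable M" by simp
    qed (use gm in simp)
    ultimately show ?thesis by simp
  qed
  then show thesis using that M M01 by blast
qed

section \<open>Spectral measures\<close>

lemma norm_blinfun_le: "norm A \<le> a \<Longrightarrow> norm (blinfun_apply A x) \<le> a * norm x"
  by (meson mult_right_mono norm_blinfun norm_ge_zero order_trans)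

lemma norm_blinfun_funpow:
  fixes A :: "'a::real_normed_vector \<Rightarrow>\<^sub>L 'a"
  assumes "norm A \<le> a"
  shows "norm ((blinfun_apply A ^^ n) x) \<le> a ^ n * norm x"
proof (induction n)
  case (Suc n)
  have "0 \<le> a" using assms norm_ge_zero order_trans by blast
  then have "norm (A ((blinfun_apply A ^^ n) x)) \<le> a * (a ^ n * norm x)"
    using Suc norm_blinfun_le[OF assms] by (meson mult_left_mono order_trans)
  then show ?case by (simp add: mult.assoc)
qed simp

text \<open>Even powers are absorbed into the vector, and
  \<open>u (1 - u) = u (1 - u) u + (1 - u) u (1 - u)\<close> settles the remaining mixed case.\<close>

lemma poly_form_bernstein_nonneg:
  fixes A :: "'a::chilbert_space \<Rightarrow>\<^sub>L 'a"
  assumes A: "selfadjoint A" "norm A \<le> a" and a: "a > 0"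
  defines "u \<equiv> [:1/2, 1/(2*a):]"
  shows "0 \<le> poly_form A \<psi> (u ^ k * (1 - u) ^ l)"
proof (induction "k + l" arbitrary: k l \<psi> rule: less_induct)
  case less
  have sq: "poly_form A \<psi> (q * p * q) = poly_form A (poly_op q A \<psi>) p" for p q \<psi>
    by (rule poly_form_square[OF A(1)])
  have "\<bar>Re (cinner \<psi> (A \<psi>))\<bar> \<le> norm \<psi> * (a * norm \<psi>)" for \<psi>
    using abs_Re_le_cmod[of "cinner \<psi> (A \<psi>)"] norm_cinner_le[of \<psi> "A \<psi>"]
      mult_left_mono[OF norm_blinfun_le[OF A(2), of \<psi>] norm_ge_zero[of \<psi>]] by linarith
  then have "\<bar>Re (cinner \<psi> (A \<psi>)) / a\<bar> \<le> (norm \<psi>)\<^sup>2" for \<psi>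
    using a by (simp add: abs_divide power2_eq_square pos_divide_le_eq ac_simps)
  then obtain e where bd: "\<And>\<psi>. \<bar>e \<psi>\<bar> \<le> (norm \<psi>)\<^sup>2" and e: "\<And>\<psi>. e \<psi> = Re (cinner \<psi> (A \<psi>)) / a"
    by auto
  have pfu: "poly_form A \<psi> u = ((norm \<psi>)\<^sup>2 + e \<psi>) / 2" for \<psi>
    by (simp add: e) (simp add: poly_form_def u_def cinner_add_right cinner_scaleR_right cinner_self
        blinfun.bilinear_simps field_simps)
  have u: "0 \<le> poly_form A \<psi> u" for \<psi>
    using bd[of \<psi>] by (simp add: pfu abs_le_iff)
  have v: "0 \<le> poly_form A \<psi> (1 - u)" for \<psi>
    using bd[of \<psi>] by (simp add: poly_form_simps pfu abs_le_iff)
  consider "k \<ge> 2" | "l \<ge> 2" | "k = 0" "l = 0" | "k = 1" "l = 0" | "k = 0" "l = 1" | "k = 1" "l = 1"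
    by linarith
  then show ?case
  proof cases
    case 1
    then obtain m where "k = Suc (Suc m)" by (metis Suc_le_D numeral_2_eq_2 Suc_le_mono)
    moreover have "u ^ Suc (Suc m) * (1 - u) ^ l = u * (u ^ m * (1 - u) ^ l) * u" by simp
    ultimately show ?thesis using less by (simp only: sq)
  next
    case 2
    then obtain m where "l = Suc (Suc m)" by (metis Suc_le_D numeral_2_eq_2 Suc_le_mono)
    moreover have "u ^ k * (1 - u) ^ Suc (Suc m) = (1 - u) * (u ^ k * (1 - u) ^ m) * (1 - u)"
      by (simp add: mult_ac)
    ultimately show ?thesis using less by (simp only: sq)
  next
    case 6
    have "u ^ k * (1 - u) ^ l = u * (1 - u) * u + (1 - u) * u * (1 - u)"
      using 6 by (simp add: algebra_simps)
    then show ?thesis by (simp only: poly_form_simps(2) sq) (intro add_nonneg_nonneg u v)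
  qed (use u v in \<open>auto simp: poly_form_simps\<close>)
qed

lemma pcompose_power: "pcompose (p ^ n) q = pcompose p q ^ n"
  by (induction n) (simp_all add: pcompose_mult pcompose_1)

text \<open>Polynomial moments and support instead of the characteristic function that fixes
  \<open>spectral_measure\<close>: this is the form in which the measure is constructed and used in
  estimates.\<close>

definition represents :: "real measure \<Rightarrow> real \<Rightarrow> ('a::chilbert_space \<Rightarrow>\<^sub>L 'a) \<Rightarrow> 'a \<Rightarrow> bool" where
  "represents \<mu> a A \<psi> \<longleftrightarrow> finite_measure \<mu> \<and> sets \<mu> = sets borel \<and> (AE x in \<mu>. x \<in> {-a..a}) \<and>
     (\<forall>p. (\<integral>x. poly p x \<partial>\<mu>) = poly_form A \<psi> p)"

text \<open>The moment problem was solved on {0..1} for total mass 1. Here \<open>u\<close> maps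
  {-a..a} onto {0..1}, \<open>f\<close> is its inverse, and \<open>c\<close> is the mass to be
  divided out, which is why the zero vector is treated apart.\<close>

lemma represents_exists:
  fixes A :: "'a::chilbert_space \<Rightarrow>\<^sub>L 'a"
  assumes A: "selfadjoint A" "norm A \<le> a" and a: "a > 0"
  shows "\<exists>\<mu>. represents \<mu> a A \<psi>"
proof (cases "\<psi> = 0")
  case True
  then show ?thesis
    by (intro exI[of _ "null_measure borel"])
      (auto simp: represents_def poly_form_def intro!: finite_measureI AE_I[of _ _ UNIV])
next
  case False
  define c where "c = (norm \<psi>)\<^sup>2"
  have c: "c > 0" using False by (simp add: c_def)
  define u where "u = [:1/2, 1/(2*a):]"
  define L where "L p = poly_form A \<psi> (p \<circ>\<^sub>p u) / c" for p
  have "0 \<le> L ([:0, 1:] ^ k * (1 - [:0, 1:]) ^ l)" for k l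
    using poly_form_bernstein_nonneg[OF A a, of \<psi> k l] c
    by (simp add: L_def pcompose_mult pcompose_power pcompose_diff pcompose_1 pcompose_pCons u_def)
  then obtain M where M: "real_distribution M" "AE x in M. x \<in> {0..1}" "\<And>p. (\<integral>x. poly p x \<partial>M) = L p"
    using hausdorff_moment[of L] c
    by (auto simp: L_def pcompose_add pcompose_smult poly_form_simps pcompose_1 add_divide_distrib c_def)
  interpret M: real_distribution M by (rule M(1))
  define f :: "real \<Rightarrow> real" where "f t = 2 * a * t - a" for t
  have f[measurable]: "f \<in> borel_measurable borel" unfolding f_def by measurable
  define N where "N = distr M borel f"
  define \<mu> where "\<mu> = density N (\<lambda>_. ennreal c)"
  have N: "prob_space N" unfolding N_def by (rule M.prob_space_distr) simp
  interpret N: prob_space N by (rule N)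
  have "represents \<mu> a A \<psi>"
    unfolding represents_def
  proof (intro conjI allI)
    show "sets \<mu> = sets borel" by (simp add: \<mu>_def N_def)
    have "emeasure \<mu> (space \<mu>) = ennreal c"
      using N.emeasure_space_1 by (simp add: \<mu>_def emeasure_density_const)
    then show "finite_measure \<mu>" by (intro finite_measureI) simp
    have "AE x in M. f x \<in> {-a..a}"
      using M(2)
    proof eventually_elim
      case (elim x)
      then have "a * x \<le> a * 1" "0 \<le> a * x" using a by (auto intro!: mult_left_mono simp del: mult_1_right)
      then show ?case by (simp add: f_def)
    qed
    then have "AE x in N. x \<in> {-a..a}"
      unfolding N_def by (subst AE_distr_iff) auto
    then show "AE x in \<mu>. x \<in> {-a..a}"
      unfolding \<mu>_def by (subst AE_density) auto
    fix p
    have comp: "[:- a, 2 * a:] \<circ>\<^sub>p u = [:0, 1:]"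
      using a by (simp add: u_def pcompose_pCons)
    have "(\<integral>x. poly p x \<partial>\<mu>) = c * (\<integral>x. poly p x \<partial>N)"
      unfolding \<mu>_def using c
      by (subst integral_density) (auto simp: N_def intro!: borel_measurable_continuous_onI continuous_intros)
    also have "(\<integral>x. poly p x \<partial>N) = (\<integral>t. poly (p \<circ>\<^sub>p [:- a, 2 * a:]) t \<partial>M)"
    proof -
      have "poly (p \<circ>\<^sub>p [:- a, 2 * a:]) = (\<lambda>t. poly p (f t))"
        by (auto simp: f_def poly_pcompose algebra_simps)
      then show ?thesis
        unfolding N_def by (simp add: integral_distr borel_measurable_continuous_onI continuous_intros)
    qed
    also have "\<dots> = poly_form A \<psi> p / c"
      unfolding M(3) L_def by (simp add: comp flip: pcompose_assoc)
    finally show "(\<integral>x. poly p x \<partial>\<mu>) = poly_form A \<psi> p" using c by simp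
  qed
  then show ?thesis by blast
qed

lemma represents_integrable:
  assumes "represents \<mu> a A \<psi>" "continuous_on UNIV f"
  shows "integrable \<mu> (f :: real \<Rightarrow> real)"
proof -
  interpret finite_measure \<mu> using assms(1) by (simp add: represents_def)
  have "compact (f ` {-a..a})"
    by (intro compact_continuous_image continuous_on_subset[OF assms(2)]) auto
  then obtain B where B: "\<And>x. x \<in> {-a..a} \<Longrightarrow> norm (f x) \<le> B"
    using compact_imp_bounded bounded_iff by (metis (no_types, lifting) imageI)
  show ?thesis
  proof (rule integrable_const_bound)
    show "AE x in \<mu>. norm (f x) \<le> B"
    proof -
      have "AE x in \<mu>. x \<in> {-a..a}" using assms(1) by (simp add: represents_def)
      then show ?thesis by eventually_elim (rule B)
    qed
    show "f \<in> borel_measurable \<mu>"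
      using assms borel_measurable_continuous_onI[OF assms(2)] measurable_cong_sets[of \<mu> borel borel borel]
      by (auto simp: represents_def)
  qed
qed

text \<open>The exponential series is integrated term by term; on the support its terms are
  dominated by (|s| a)^n / n!, and each moment is an inner product with a power of
  \<open>A\<close>.\<close>

lemma represents_char:
  fixes A :: "'a::chilbert_space \<Rightarrow>\<^sub>L 'a"
  assumes A: "selfadjoint A" "norm A \<le> a" and \<mu>: "represents \<mu> a A \<psi>"
  shows "cinner \<psi> (exp_op (\<i> * complex_of_real s) A \<psi>) = char \<mu> s"
proof -
  interpret finite_measure \<mu> using \<mu> by (simp add: represents_def)
  have sets[measurable_cong]: "sets \<mu> = sets borel" using \<mu> by (simp add: represents_def)
  have a0: "0 \<le> a" using A(2) norm_ge_zero order_trans by blast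
  define z where "z = \<i> * complex_of_real s"
  have z: "cmod z = \<bar>s\<bar>" by (simp add: z_def norm_mult)
  define g where "g n x = z ^ n / fact n * complex_of_real x ^ n" for n x
  have pow_int: "integrable \<mu> (\<lambda>x. x ^ n)" for n
    by (intro represents_integrable[OF \<mu>] continuous_intros)
  have moment: "(\<integral>x. complex_of_real x ^ n \<partial>\<mu>) = cinner \<psi> ((blinfun_apply A ^^ n) \<psi>)" for n
  proof -
    have "(\<integral>x. complex_of_real x ^ n \<partial>\<mu>) = complex_of_real (\<integral>x. poly (monom 1 n) x \<partial>\<mu>)"
      by (simp add: poly_monom flip: of_real_power)
    also have "\<dots> = cinner \<psi> (poly_op (monom 1 n) A \<psi>)"
      using \<mu> by (simp add: represents_def poly_form_eq_cinner[OF A(1)])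
    finally show ?thesis by (simp add: poly_op_monom)
  qed
  have g_int: "integrable \<mu> (g n)" for n
    unfolding g_def using integrable_of_real[OF pow_int[of n], where 'a=complex] by simp
  have g_le: "norm (g n x) \<le> (\<bar>s\<bar> * a) ^ n / fact n" if "x \<in> {-a..a}" for n x
  proof -
    have "\<bar>x\<bar> ^ n \<le> a ^ n" using that by (intro power_mono) auto
    then have "\<bar>s\<bar> ^ n * \<bar>x\<bar> ^ n / fact n \<le> \<bar>s\<bar> ^ n * a ^ n / fact n"
      by (intro divide_right_mono mult_left_mono) auto
    then show ?thesis by (simp add: g_def norm_mult norm_divide norm_power z power_mult_distrib)
  qed
  have summ: "summable (\<lambda>n. (\<bar>s\<bar> * a) ^ n / fact n)"
    using summable_exp[of "\<bar>s\<bar> * a"] by (simp add: field_simps)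
  have AEa: "AE x in \<mu>. x \<in> {-a..a}" using \<mu> by (simp add: represents_def)
  have "(\<lambda>n. \<integral>x. g n x \<partial>\<mu>) sums (\<integral>x. (\<Sum>n. g n x) \<partial>\<mu>)"
  proof (rule sums_integral[OF g_int])
    show "AE x in \<mu>. summable (\<lambda>n. norm (g n x))"
      using AEa
    proof eventually_elim
      case (elim x)
      show ?case by (rule summable_comparison_test[OF _ summ]) (use g_le[OF elim] in auto)
    qed
    have "(\<integral>x. norm (g n x) \<partial>\<mu>) \<le> (\<bar>s\<bar> * a) ^ n / fact n * measure \<mu> (space \<mu>)" for n
    proof -
      have "(\<integral>x. norm (g n x) \<partial>\<mu>) \<le> (\<integral>x. (\<bar>s\<bar> * a) ^ n / fact n \<partial>\<mu>)"
      proof (intro integral_mono_AE integrable_norm g_int)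
        show "AE x in \<mu>. norm (g n x) \<le> (\<bar>s\<bar> * a) ^ n / fact n"
          using AEa by eventually_elim (rule g_le)
      qed simp
      then show ?thesis by (simp add: mult.commute)
    qed
    then show "summable (\<lambda>n. \<integral>x. norm (g n x) \<partial>\<mu>)"
      by (intro summable_comparison_test[OF _ summable_mult2[OF summ, of "measure \<mu> (space \<mu>)"]]) auto
  qed
  moreover have "(\<Sum>n. g n x) = iexp (s * x)" for x
    by (simp add: g_def exp_def z_def power_mult_distrib scaleR_conv_of_real divide_inverse mult_ac)
  moreover have "(\<integral>x. g n x \<partial>\<mu>) = cinner \<psi> ((z ^ n / fact n) *\<^sub>C (blinfun_apply A ^^ n) \<psi>)" for n
    by (simp add: g_def moment cinner_scaleC_right)
  ultimately have 1: "(\<lambda>n. cinner \<psi> ((z ^ n / fact n) *\<^sub>C (blinfun_apply A ^^ n) \<psi>)) sums char \<mu> s"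
    by (simp add: char_def)
  \<comment> \<open>The infinite sum in \<open>exp_op\<close> can be moved out of the inner product
    only once the series is known to converge in norm.\<close>
  have "summable (\<lambda>n. (z ^ n / fact n) *\<^sub>C (blinfun_apply A ^^ n) \<psi>)"
  proof (rule summable_comparison_test[OF _ summable_mult2[OF summ, of "norm \<psi>"]], intro exI allI impI)
    fix n
    have "\<bar>s\<bar> ^ n / fact n * norm ((blinfun_apply A ^^ n) \<psi>) \<le> \<bar>s\<bar> ^ n / fact n * (a ^ n * norm \<psi>)"
      by (intro mult_left_mono norm_blinfun_funpow A(2)) auto
    then show "norm ((z ^ n / fact n) *\<^sub>C (blinfun_apply A ^^ n) \<psi>) \<le> (\<bar>s\<bar> * a) ^ n / fact n * norm \<psi>"
      by (simp add: norm_scaleC norm_divide norm_power z power_mult_distrib mult_ac)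
  qed
  then have "(\<lambda>n. cinner \<psi> ((z ^ n / fact n) *\<^sub>C (blinfun_apply A ^^ n) \<psi>)) sums cinner \<psi> (exp_op z A \<psi>)"
    unfolding exp_op_def by (intro bounded_linear.sums[OF cinner.bounded_linear_right] summable_sums)
  then show ?thesis using 1 sums_unique2 z_def by blast
qed

text \<open>Levy's uniqueness theorem concerns probability measures. The value of
  \<open>char\<close> at 0 shows that the total masses agree, so both measures can be normalised by
  the same \<open>c\<close>, unless they vanish.\<close>

lemma finite_measure_char_unique:
  assumes M: "finite_measure M" "sets M = sets borel" and N: "finite_measure N" "sets N = sets borel"
    and eq: "\<And>s. char M s = char N s"
  shows "M = (N :: real measure)"
proof -
  have space: "space M = UNIV" "space N = UNIV"
    using sets_eq_imp_space_eq[OF M(2)] sets_eq_imp_space_eq[OF N(2)] by auto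
  have mass: "measure M UNIV = measure N UNIV"
    using eq[of 0] by (simp add: char_def space)
  define c where "c = measure M UNIV"
  have emc: "emeasure M UNIV = ennreal c" "emeasure N UNIV = ennreal c"
    using finite_measure.emeasure_eq_measure[OF M(1)] finite_measure.emeasure_eq_measure[OF N(1)] mass
    by (auto simp: c_def)
  show ?thesis
  proof (cases "c = 0")
    case True
    then show ?thesis
      using emc space M(2) N(2) emeasure_mono[of _ UNIV M] emeasure_mono[of _ UNIV N]
      by (intro measure_eqI) (auto simp: sets_eq_imp_space_eq)
  next
    case False
    then have c: "c > 0" by (simp add: c_def zero_less_measure_iff order.strict_iff_order)
    define s where "s K = density K (\<lambda>_. ennreal (1 / c))" for K :: "real measure"
    have 1: "real_distribution (s K) \<and> char (s K) = (\<lambda>t. char K t / c)"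
      if K: "sets K = sets borel" "emeasure K UNIV = ennreal c" for K
    proof
      have sp: "space K = UNIV" using sets_eq_imp_space_eq[OF K(1)] by simp
      have "emeasure (s K) (space (s K)) = ennreal (1 / c) * ennreal c"
        using K sp by (simp add: s_def emeasure_density_const)
      also have "\<dots> = 1" using c by (simp flip: ennreal_mult)
      finally have "prob_space (s K)" by (rule prob_spaceI)
      then show "real_distribution (s K)"
        using K sp by (auto simp: real_distribution_def real_distribution_axioms_def s_def)
      show "char (s K) = (\<lambda>t. char K t / c)"
      proof
        fix t
        have "(\<lambda>x. iexp (t * x)) \<in> borel_measurable borel" by measurable
        then have "(\<lambda>x. iexp (t * x)) \<in> borel_measurable K"
          using measurable_cong_sets[OF K(1) refl] by blast
        then show "char (s K) t = char K t / c"
          unfolding char_def s_def using c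
          by (subst integral_density) (auto simp: scaleR_conv_of_real)
      qed
    qed
    have "s M = s N"
      using 1[of M] 1[of N] M N emc eq by (intro Levy_uniqueness) auto
    moreover have "emeasure (s K) A = ennreal (1 / c) * emeasure K A"
      if "sets K = sets borel" "A \<in> sets borel" for K A
      using that by (simp add: s_def emeasure_density_const)
    ultimately have "ennreal (1 / c) * emeasure M A = ennreal (1 / c) * emeasure N A" if "A \<in> sets borel" for A
      using that M(2) N(2) by metis
    then have "ennreal c * (ennreal (1 / c) * emeasure M A) = ennreal c * (ennreal (1 / c) * emeasure N A)"
      if "A \<in> sets borel" for A
      using that by simp
    moreover have "ennreal c * (ennreal (1 / c) * x) = x" for x
      using c by (simp flip: mult.assoc ennreal_mult)
    ultimately show ?thesis
      using M(2) N(2) by (intro measure_eqI) auto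
  qed
qed

text \<open>This justifies the definite description in \<open>spectral_measure\<close>: the moment
  problem gives existence, the characteristic function gives uniqueness.\<close>

theorem spectral_measure_represents:
  fixes A :: "'a::chilbert_space \<Rightarrow>\<^sub>L 'a"
  assumes "selfadjoint A" "norm A \<le> a" "a > 0"
  shows "represents (spectral_measure A \<psi>) a A \<psi>"
proof -
  obtain \<mu> where \<mu>: "represents \<mu> a A \<psi>"
    using represents_exists[OF assms] by blast
  have "spectral_measure A \<psi> = \<mu>"
    unfolding spectral_measure_def
  proof (rule the_equality)
    show "finite_measure \<mu> \<and> sets \<mu> = sets borel \<and>
      (\<forall>s. cinner \<psi> (exp_op (\<i> * complex_of_real s) A \<psi>) = char \<mu> s)"
      using \<mu> represents_char[OF assms(1,2) \<mu>] by (auto simp: represents_def)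
  next
    fix \<nu> assume "finite_measure \<nu> \<and> sets \<nu> = sets borel \<and>
      (\<forall>s. cinner \<psi> (exp_op (\<i> * complex_of_real s) A \<psi>) = char \<nu> s)"
    then show "\<nu> = \<mu>"
      using \<mu> represents_char[OF assms(1,2) \<mu>]
      by (intro finite_measure_char_unique) (auto simp: represents_def)
  qed
  then show ?thesis using \<mu> by simp
qed

text \<open>Positivity of the polynomial calculus, read off from a representing measure. The
  comparison is needed only on {-a..a} because the measure lives there.\<close>

lemma poly_form_mono:
  fixes A :: "'a::chilbert_space \<Rightarrow>\<^sub>L 'a"
  assumes A: "selfadjoint A" "norm A \<le> a" and a: "a > 0"
    and le: "\<And>x. x \<in> {-a..a} \<Longrightarrow> poly p x \<le> poly q x"
  shows "poly_form A \<psi> p \<le> poly_form A \<psi> q"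
proof -
  obtain \<mu> where \<mu>: "represents \<mu> a A \<psi>"
    using represents_exists[OF A a] by blast
  have "(\<integral>x. poly p x \<partial>\<mu>) \<le> (\<integral>x. poly q x \<partial>\<mu>)"
  proof (intro integral_mono_AE represents_integrable[OF \<mu>] continuous_intros)
    have "AE x in \<mu>. x \<in> {-a..a}" using \<mu> by (simp add: represents_def)
    then show "AE x in \<mu>. poly p x \<le> poly q x" by eventually_elim (rule le)
  qed
  then show ?thesis using \<mu> by (simp add: represents_def)
qed

section \<open>Conditions for purely singular continuous spectrum\<close>

text \<open>Stating these conditions through polynomials makes them strongly open in \<open>A\<close>.\<close>

definition diffuse :: "real \<Rightarrow> ('a::chilbert_space \<Rightarrow>\<^sub>L 'a) \<Rightarrow> 'a \<Rightarrow> real \<Rightarrow> bool" where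
  "diffuse a A \<psi> e \<longleftrightarrow> (\<exists>F. finite F \<and>
     (\<forall>p\<in>F. (\<forall>x\<in>{-a..a}. poly p x \<in> {0..1}) \<and> poly_form A \<psi> p < e) \<and>
     (\<forall>x\<in>{-a..a}. \<exists>p\<in>F. 1 / 2 \<le> poly p x))"

definition concentrated :: "real \<Rightarrow> ('a::chilbert_space \<Rightarrow>\<^sub>L 'a) \<Rightarrow> 'a \<Rightarrow> real \<Rightarrow> bool" where
  "concentrated a A \<psi> e \<longleftrightarrow> (\<exists>p. (\<forall>x\<in>{-a..a}. poly p x \<in> {0..1}) \<and> poly_form A \<psi> p < e \<and>
     emeasure lborel {x\<in>{-a..a}. poly p x < 1 / 2} < ennreal e)"

text \<open>In this homogeneous form the strict inequality excludes the zero vector, so that no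
  normalisation is required.\<close>

definition approx_eigenvalue :: "('a::chilbert_space \<Rightarrow>\<^sub>L 'a) \<Rightarrow> real \<Rightarrow> real \<Rightarrow> bool" where
  "approx_eigenvalue A E e \<longleftrightarrow> (\<exists>\<phi>. norm (A \<phi> - E *\<^sub>R \<phi>) < e * norm \<phi>)"

text \<open>The parallelogram identity for the form of \<open>p\<close>: the term at
  \<open>2 *\<^sub>R \<phi> - \<psi>\<close> is dropped by positivity and the term at
  \<open>\<psi> - \<phi>\<close> is bounded through p \<le> 1.\<close>

lemma poly_form_perturb:
  fixes A :: "'a::chilbert_space \<Rightarrow>\<^sub>L 'a"
  assumes A: "selfadjoint A" "norm A \<le> a" and a: "a > 0"
    and p: "\<And>x. x \<in> {-a..a} \<Longrightarrow> poly p x \<in> {0..1}"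
  shows "poly_form A \<psi> p \<le> 2 * poly_form A \<phi> p + 2 * (norm (\<psi> - \<phi>))\<^sup>2"
proof -
  have "poly_form A \<psi> p + poly_form A (2 *\<^sub>R \<phi> - \<psi>) p = 2 * poly_form A \<phi> p + 2 * poly_form A (\<psi> - \<phi>) p"
    by (simp add: poly_form_def poly_op_add_right poly_op_diff_right scaleR_2 cinner_add_left cinner_add_right
        cinner_diff_left cinner_diff_right)
  moreover have "0 \<le> poly_form A (2 *\<^sub>R \<phi> - \<psi>) p"
    using poly_form_mono[OF A a, of 0 p] p by (simp add: poly_form_simps)
  moreover have "poly_form A (\<psi> - \<phi>) p \<le> (norm (\<psi> - \<phi>))\<^sup>2"
    using poly_form_mono[OF A a, of p 1 "\<psi> - \<phi>"] p by (simp add: poly_form_simps)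
  ultimately show ?thesis by linarith
qed

text \<open>Markov's inequality at the level 1/2, which is the origin of the factor 2.\<close>

lemma represents_measure_le:
  assumes \<mu>: "represents \<mu> a A \<psi>" and S: "S \<in> sets borel"
    and p: "\<And>x. x \<in> {-a..a} \<Longrightarrow> 0 \<le> poly p x" "\<And>x. x \<in> {-a..a} \<Longrightarrow> x \<in> S \<Longrightarrow> 1 / 2 \<le> poly p x"
  shows "measure \<mu> S \<le> 2 * poly_form A \<psi> p"
proof -
  interpret finite_measure \<mu> using \<mu> by (simp add: represents_def)
  have S': "S \<in> sets \<mu>" using S \<mu> by (simp add: represents_def)
  have "(\<integral>x. indicator S x \<partial>\<mu>) \<le> (\<integral>x. 2 * poly p x \<partial>\<mu>)"
  proof (rule integral_mono_AE)
    show "integrable \<mu> (indicator S :: real \<Rightarrow> real)"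
      using S' by (intro integrable_real_indicator) (auto simp: emeasure_eq_measure)
    show "integrable \<mu> (\<lambda>x. 2 * poly p x)"
      by (intro represents_integrable[OF \<mu>] continuous_intros)
    have "AE x in \<mu>. x \<in> {-a..a}" using \<mu> by (simp add: represents_def)
    then show "AE x in \<mu>. indicator S x \<le> 2 * poly p x"
      by eventually_elim (use p in \<open>fastforce simp: indicator_def\<close>)
  qed
  then show ?thesis using S' \<mu> by (simp add: represents_def)
qed

text \<open>For a point, Markov's bound is applied to one of the polynomials that is large there.
  For singularity the tolerances (1/2)^n make the lengths of the exceptional sets summable: their
  limsup is Lebesgue null by Borel-Cantelli, while its complement is null for
  \<open>\<mu>\<close>.\<close>

lemma singular_continuous_measureI:
  fixes A :: "'a::chilbert_space \<Rightarrow>\<^sub>L 'a"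
  assumes A: "selfadjoint A" "norm A \<le> a" and a: "a > 0"
    and diff: "\<And>e. e > 0 \<Longrightarrow> diffuse a A \<psi> e" and conc: "\<And>e. e > 0 \<Longrightarrow> concentrated a A \<psi> e"
  shows "purely_singular_continuous_measure (spectral_measure A \<psi>)"
proof -
  define \<mu> where "\<mu> = spectral_measure A \<psi>"
  have \<mu>: "represents \<mu> a A \<psi>"
    unfolding \<mu>_def by (rule spectral_measure_represents[OF A a])
  interpret finite_measure \<mu> using \<mu> by (simp add: represents_def)
  have sets[measurable_cong]: "sets \<mu> = sets borel" using \<mu> by (simp add: represents_def)
  have "emeasure \<mu> {x} = 0" for x
  proof -
    have "measure \<mu> {x} \<le> 0 + e" if e: "e > 0" for e
    proof -
      obtain F where F: "\<forall>p\<in>F. (\<forall>y\<in>{-a..a}. poly p y \<in> {0..1}) \<and> poly_form A \<psi> p < e / 2"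
        "\<forall>y\<in>{-a..a}. \<exists>p\<in>F. 1 / 2 \<le> poly p y"
        using diff[of "e / 2"] e by (auto simp only: diffuse_def half_gt_zero_iff)
      show ?thesis
      proof (cases "x \<in> {-a..a}")
        case True
        then obtain p where p: "p \<in> F" "1 / 2 \<le> poly p x" using F(2) by blast
        then have "measure \<mu> {x} \<le> 2 * poly_form A \<psi> p"
          using F(1) by (intro represents_measure_le[OF \<mu>]) auto
        moreover have "poly_form A \<psi> p < e / 2" using F(1) p(1) by blast
        ultimately show ?thesis by linarith
      next
        case False
        \<comment> \<open>Off {-a..a} the zero polynomial already satisfies the hypotheses of
          Markov's bound.\<close>
        then have "measure \<mu> {x} \<le> 2 * poly_form A \<psi> 0"
          by (intro represents_measure_le[OF \<mu>]) auto
        then show ?thesis using e by (simp add: poly_form_simps)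
      qed
    qed
    then have "measure \<mu> {x} \<le> 0" by (rule field_le_epsilon)
    then show ?thesis by (simp add: emeasure_eq_measure measure_le_0_iff)
  qed
  moreover have "\<exists>N\<in>null_sets lborel. emeasure \<mu> (- N) = 0"
  proof -
    define Q where "Q n p \<longleftrightarrow> (\<forall>x\<in>{-a..a}. poly p x \<in> {0..1}) \<and> poly_form A \<psi> p < (1/2) ^ n \<and>
        emeasure lborel {x\<in>{-a..a}. poly p x < 1 / 2} < ennreal ((1/2) ^ n)" for n p
    have "\<exists>p. Q n p" for n
      unfolding Q_def concentrated_def[symmetric] by (intro conc) simp
    then obtain p where "\<And>n. Q n (p n)" by metis
    then have p: "\<And>n x. x \<in> {-a..a} \<Longrightarrow> poly (p n) x \<in> {0..1}"
      "\<And>n. poly_form A \<psi> (p n) < (1/2) ^ n"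
      "\<And>n. emeasure lborel {x\<in>{-a..a}. poly (p n) x < 1 / 2} < ennreal ((1/2) ^ n)"
      unfolding Q_def by blast+
    define N where "N n = {x\<in>{-a..a}. poly (p n) x < 1 / 2}" for n
    have [measurable]: "poly q \<in> borel_measurable borel" for q :: "real poly"
      by (intro borel_measurable_continuous_onI continuous_intros)
    have N[measurable]: "N n \<in> sets borel" for n
      unfolding N_def by measurable
    have fin: "emeasure lborel (N n) < \<infinity>" for n
      using p(3)[of n] unfolding N_def by (rule order.strict_trans) simp
    have "measure lborel (N n) \<le> (1/2) ^ n" for n
      using p(3)[of n] unfolding N_def[symmetric] measure_def
      by (intro enn2real_leI) auto
    then have "summable (\<lambda>n. measure lborel (N n))"
      by (intro summable_comparison_test[OF _ summable_geometric[of "1/2 :: real"]]) auto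
    then have "limsup N \<in> null_sets lborel"
      using fin by (intro borel_cantelli_limsup1) auto
    moreover have "emeasure \<mu> (- limsup N) = 0"
    proof -
      have le: "measure \<mu> (- N n) \<le> 2 * (1/2) ^ n" for n
      proof -
        have "measure \<mu> (- N n) \<le> 2 * poly_form A \<psi> (p n)"
          using p(1) by (intro represents_measure_le[OF \<mu>]) (auto simp: N_def)
        then show ?thesis using p(2)[of n] by simp
      qed
      have "(\<Inter>n\<in>{m..}. - N n) \<in> null_sets \<mu>" for m
      proof -
        have "measure \<mu> (\<Inter>n\<in>{m..}. - N n) \<le> 2 * (1/2) ^ n" if "n \<ge> m" for n
          using that by (intro order_trans[OF finite_measure_mono le]) auto
        moreover have "(\<lambda>n. 2 * (1/2) ^ n :: real) \<longlonglongrightarrow> 0"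
          by (intro tendsto_mult_right_zero LIMSEQ_power_zero) simp
        ultimately have "measure \<mu> (\<Inter>n\<in>{m..}. - N n) \<le> 0"
          by (metis LIMSEQ_le_const)
        then show ?thesis
          by (simp add: null_sets_def emeasure_eq_measure measure_le_0_iff)
      qed
      then have "(\<Union>m. \<Inter>n\<in>{m..}. - N n) \<in> null_sets \<mu>" by blast
      moreover have "- limsup N = (\<Union>m. \<Inter>n\<in>{m..}. - N n)"
        by (simp add: limsup_INF_SUP)
      ultimately show ?thesis by auto
    qed
    ultimately show ?thesis by blast
  qed
  ultimately show ?thesis
    unfolding purely_singular_continuous_measure_iff \<mu>_def[symmetric] using sets by blast
qed

text \<open>A Baire argument can impose conditions for countably many vectors only; the perturbation
  bound carries them from a dense set to every vector.\<close>

lemma purely_singular_continuousI: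
  fixes A :: "'a::chilbert_space \<Rightarrow>\<^sub>L 'a"
  assumes A: "selfadjoint A" "norm A \<le> a" and a: "a > 0" and D: "closure D = UNIV"
    and diff: "\<And>\<phi> n. \<phi> \<in> D \<Longrightarrow> diffuse a A \<phi> (1 / Suc n)"
    and conc: "\<And>\<phi> n. \<phi> \<in> D \<Longrightarrow> concentrated a A \<phi> (1 / Suc n)"
  shows "purely_singular_continuous_spectrum A"
  unfolding purely_singular_continuous_spectrum_def
proof
  fix \<psi>
  have appr: "\<exists>\<phi>\<in>D. \<exists>n. 1 / Suc n < e \<and>
      (\<forall>p. (\<forall>x\<in>{-a..a}. poly p x \<in> {0..1}) \<longrightarrow> poly_form A \<phi> p < 1 / Suc n \<longrightarrow> poly_form A \<psi> p < e)"
    if e: "e > 0" for e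
  proof -
    \<comment> \<open>The perturbation bound doubles both the form at \<open>\<phi>\<close> and the
      squared distance, so each is kept below e/4.\<close>
    obtain n where n: "1 / Suc n < e / 4"
      using reals_Archimedean[of "e / 4"] e by (auto simp: inverse_eq_divide)
    have "\<psi> \<in> closure D" using D by simp
    then obtain \<phi> where \<phi>: "\<phi> \<in> D" "dist \<phi> \<psi> < sqrt (e / 4)"
      using closure_approachable e by (metis divide_pos_pos real_sqrt_gt_zero zero_less_numeral)
    have "(norm (\<psi> - \<phi>))\<^sup>2 < (sqrt (e / 4))\<^sup>2"
      using \<phi>(2) by (intro power_strict_mono) (auto simp: dist_norm norm_minus_commute)
    then have "(norm (\<psi> - \<phi>))\<^sup>2 < e / 4" using e by simp
    then have "poly_form A \<psi> p < e"
      if "\<forall>x\<in>{-a..a}. poly p x \<in> {0..1}" "poly_form A \<phi> p < 1 / Suc n" for p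
      using poly_form_perturb[OF A a, of p \<psi> \<phi>] that n by fastforce
    moreover have "1 / Suc n < e" using n e by linarith
    ultimately show ?thesis using \<phi>(1) by blast
  qed
  have "diffuse a A \<psi> e" if e: "e > 0" for e
  proof -
    obtain \<phi> n where 1: "\<phi> \<in> D" "\<And>p. (\<forall>x\<in>{-a..a}. poly p x \<in> {0..1}) \<Longrightarrow>
        poly_form A \<phi> p < 1 / Suc n \<Longrightarrow> poly_form A \<psi> p < e"
      using appr[OF e] by blast
    obtain F where "finite F" "\<And>p. p \<in> F \<Longrightarrow> (\<forall>x\<in>{-a..a}. poly p x \<in> {0..1}) \<and> poly_form A \<phi> p < 1 / Suc n"
      "\<forall>x\<in>{-a..a}. \<exists>p\<in>F. 1 / 2 \<le> poly p x"
      using diff[OF 1(1), of n] unfolding diffuse_def by blast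
    then show ?thesis
      unfolding diffuse_def using 1(2) by (intro exI[of _ F]) blast
  qed
  moreover have "concentrated a A \<psi> e" if e: "e > 0" for e
  proof -
    obtain \<phi> n where 1: "\<phi> \<in> D" "1 / Suc n < e" "\<And>p. (\<forall>x\<in>{-a..a}. poly p x \<in> {0..1}) \<Longrightarrow>
        poly_form A \<phi> p < 1 / Suc n \<Longrightarrow> poly_form A \<psi> p < e"
      using appr[OF e] by blast
    obtain p where p: "\<forall>x\<in>{-a..a}. poly p x \<in> {0..1}" "poly_form A \<phi> p < 1 / Suc n"
      "emeasure lborel {x\<in>{-a..a}. poly p x < 1 / 2} < ennreal (1 / Suc n)"
      using conc[OF 1(1), of n] unfolding concentrated_def by blast
    have "ennreal (1 / Suc n) \<le> ennreal e" using 1(2) by (intro ennreal_leI) simp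
    then show ?thesis
      unfolding concentrated_def using p 1(3)[OF p(1,2)] by (intro exI[of _ p]) (auto intro: order.strict_trans2)
  qed
  ultimately show "purely_singular_continuous_measure (spectral_measure A \<psi>)"
    by (intro singular_continuous_measureI[OF A a])
qed

section \<open>The spectrum\<close>

text \<open>Solving (A - z) u = f amounts to finding a fixed point of u - c ((A - z) u - f), a
  contraction by assumption. Banach's theorem gives a unique solution, and the contraction estimate
  bounds the inverse.\<close>

lemma not_in_spectrumI:
  fixes A :: "'a::chilbert_space \<Rightarrow>\<^sub>L 'a"
  assumes lin: "complex_linear A" and c: "c \<noteq> 0" and k: "0 \<le> k" "k < 1"
    and contr: "\<And>u. norm (u - c *\<^sub>C (A u - z *\<^sub>C u)) \<le> k * norm u"
  shows "z \<notin> spectrum A"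
proof -
  define T where "T u = A u - z *\<^sub>C u" for u
  have Tdiff: "T (u - v) = T u - T v" for u v
    by (simp add: T_def blinfun.diff_right complex_vector.scale_right_diff_distrib)
  have Tadd: "T (u + v) = T u + T v" for u v
    by (simp add: T_def blinfun.add_right scaleC_add_right)
  have Tscale: "T (d *\<^sub>C u) = d *\<^sub>C T u" for d u
    using lin by (simp add: T_def complex_linear_def complex_vector.scale_right_diff_distrib scaleC_scaleC mult.commute)
  have ex: "\<exists>!u. T u = f" for f
  proof -
    define g where "g u = u - c *\<^sub>C (T u - f)" for u
    have "dist (g u) (g v) \<le> k * dist u v" for u v
    proof -
      have "g u - g v = (u - v) - c *\<^sub>C T (u - v)"
        by (simp add: g_def Tdiff complex_vector.scale_right_diff_distrib)
      then show ?thesis using contr[of "u - v"] by (simp add: dist_norm T_def)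
    qed
    then have "\<exists>!u. g u = u"
      using k by (intro banach_fix_type[of k]) auto
    moreover have "g u = u \<longleftrightarrow> T u = f" for u
      using c by (simp add: g_def)
    ultimately show ?thesis by simp
  qed
  define B where "B f = (THE u. T u = f)" for f
  have TB: "T (B f) = f" for f
    unfolding B_def by (rule theI'[OF ex])
  have BT: "B (T u) = u" for u
    using ex[of "T u"] TB by blast
  have Badd: "B (f + g) = B f + B g" for f g
    using BT[of "B f + B g"] by (simp add: Tadd TB)
  have Bscale: "B (d *\<^sub>C f) = d *\<^sub>C B f" for d f
    using BT[of "d *\<^sub>C B f"] by (simp add: Tscale TB)
  have bd: "norm (B f) \<le> norm f * (cmod c / (1 - k))" for f
  proof -
    have "norm (B f) \<le> norm (B f - c *\<^sub>C T (B f)) + norm (c *\<^sub>C f)"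
      using norm_triangle_ineq[of "B f - c *\<^sub>C T (B f)" "c *\<^sub>C f"] by (simp add: TB)
    also have "\<dots> \<le> k * norm (B f) + cmod c * norm f"
      using contr[of "B f"] by (simp add: T_def norm_scaleC)
    finally show ?thesis using k by (simp add: field_simps)
  qed
  have "bounded_linear B"
    by (rule bounded_linear_intro[OF Badd _ bd]) (simp add: scaleR_scaleC Bscale)
  then have "blinfun_apply (Blinfun B) = B" by (rule bounded_linear_Blinfun_apply)
  then have "complex_linear (Blinfun B) \<and> (\<forall>x. Blinfun B (A x - z *\<^sub>C x) = x) \<and>
      (\<forall>x. A (Blinfun B x) - z *\<^sub>C Blinfun B x = x)"
    using TB BT by (simp add: complex_linear_def Bscale T_def)
  then show ?thesis unfolding spectrum_def by blast
qed

text \<open>The contraction criterion is used with an imaginary constant \<open>c\<close> when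
  \<open>z\<close> is not real, and with \<open>- (1 / z)\<close>, as in the Neumann series, when
  \<open>z\<close> is real and |z| > a.\<close>

lemma spectrum_subset:
  fixes A :: "'a::chilbert_space \<Rightarrow>\<^sub>L 'a"
  assumes A: "selfadjoint A" "norm A \<le> a"
  shows "spectrum A \<subseteq> complex_of_real ` {-a..a}"
proof
  fix z assume z: "z \<in> spectrum A"
  have a0: "0 \<le> a" using A(2) norm_ge_zero order_trans by blast
  have lin: "complex_linear A" using A(1) by (simp add: selfadjoint_def)
  have "Im z = 0"
  proof (rule ccontr)
    assume y: "Im z \<noteq> 0"
    define x y where "x = Re z" and "y = Im z"
    define M where "M = a + \<bar>x\<bar>"
    \<comment> \<open>\<open>M\<close> bounds the norm of A - x. This \<open>\<tau>\<close>
      minimises (1 - \<tau> y)^2 + \<tau>^2 M^2, and the minimum is the square of \<open>k\<close>,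
      which is below 1 because \<open>y\<close> is nonzero.\<close>
    define \<tau> where "\<tau> = y / (y\<^sup>2 + M\<^sup>2)"
    define k where "k = sqrt (M\<^sup>2 / (y\<^sup>2 + M\<^sup>2))"
    have pos: "y\<^sup>2 + M\<^sup>2 > 0" using y by (simp add: y_def add_pos_nonneg)
    have y0: "y \<noteq> 0" using y by (simp add: y_def)
    have k2: "k\<^sup>2 = M\<^sup>2 / (y\<^sup>2 + M\<^sup>2)" using pos by (simp add: k_def)
    have "(1 - \<tau> * y)\<^sup>2 + \<tau>\<^sup>2 * M\<^sup>2 = 1 - 2 * (\<tau> * y) + \<tau> * (\<tau> * (y\<^sup>2 + M\<^sup>2))"
      by (simp add: power2_eq_square algebra_simps)
    also have "\<tau> * (y\<^sup>2 + M\<^sup>2) = y" using pos by (simp add: \<tau>_def)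
    also have "1 - 2 * (\<tau> * y) + \<tau> * y = 1 - \<tau> * y" by simp
    also have "1 - \<tau> * y = k\<^sup>2"
    proof -
      have "\<tau> * y = (y\<^sup>2 + M\<^sup>2 - M\<^sup>2) / (y\<^sup>2 + M\<^sup>2)"
        by (simp add: \<tau>_def power2_eq_square)
      moreover have "y\<^sup>2 + M\<^sup>2 \<noteq> 0" using pos by linarith
      ultimately have "\<tau> * y = 1 - k\<^sup>2"
        by (simp only: diff_divide_distrib divide_self k2 not_False_eq_True)
      then show ?thesis by simp
    qed
    finally have tau: "(1 - \<tau> * y)\<^sup>2 + \<tau>\<^sup>2 * M\<^sup>2 = k\<^sup>2" .
    have "norm (u - (complex_of_real \<tau> * \<i>) *\<^sub>C (A u - z *\<^sub>C u)) \<le> k * norm u" for u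
    proof -
      define v where "v = A u - x *\<^sub>R u"
      have v: "norm v \<le> M * norm u"
        using norm_triangle_ineq4[of "A u" "x *\<^sub>R u"] norm_blinfun_le[OF A(2), of u]
        by (simp add: v_def M_def algebra_simps)
      have zeq: "z = complex_of_real x + \<i> * complex_of_real y"
        by (simp add: x_def y_def complex_eq_iff)
      have "A u - z *\<^sub>C u = v - (\<i> * complex_of_real y) *\<^sub>C u"
        unfolding zeq by (simp add: v_def scaleC_add_left scaleR_scaleC)
      then have "u - (complex_of_real \<tau> * \<i>) *\<^sub>C (A u - z *\<^sub>C u) = u - (complex_of_real \<tau> * \<i>) *\<^sub>C v + (complex_of_real \<tau> * \<i> * (\<i> * complex_of_real y)) *\<^sub>C u"
        by (simp add: complex_vector.scale_right_diff_distrib scaleC_scaleC)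
      also have "complex_of_real \<tau> * \<i> * (\<i> * complex_of_real y) = complex_of_real (- (\<tau> * y))"
        by (simp add: complex_eq_iff)
      also have "u - (complex_of_real \<tau> * \<i>) *\<^sub>C v + complex_of_real (- (\<tau> * y)) *\<^sub>C u = (1 - \<tau> * y) *\<^sub>R u + (- (complex_of_real \<tau> * \<i>)) *\<^sub>C v"
        unfolding scaleR_scaleC[symmetric] by (simp add: scaleR_left_diff_distrib)
      finally have "(norm (u - (complex_of_real \<tau> * \<i>) *\<^sub>C (A u - z *\<^sub>C u)))\<^sup>2 =
          (1 - \<tau> * y)\<^sup>2 * (norm u)\<^sup>2 + 2 * ((1 - \<tau> * y) * \<tau> * Im (cinner u v)) + \<tau>\<^sup>2 * (norm v)\<^sup>2"
        by (simp add: norm_add_square cinner_scaleR_left cinner_scaleC_right norm_scaleC norm_mult power_mult_distrib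
            del: complex_vector.scale_minus_left)
      \<comment> \<open>The factor i next to \<open>\<tau>\<close> turns the cross term into an
        imaginary part, which vanishes since A - x is symmetric.\<close>
      moreover have "Im (cinner u v) = 0"
        using poly_form_eq_cinner[OF A(1), of u "[:- x, 1:]"]
        by (simp add: v_def blinfun.bilinear_simps algebra_simps)
      ultimately have "(norm (u - (complex_of_real \<tau> * \<i>) *\<^sub>C (A u - z *\<^sub>C u)))\<^sup>2 = (1 - \<tau> * y)\<^sup>2 * (norm u)\<^sup>2 + \<tau>\<^sup>2 * (norm v)\<^sup>2"
        by simp
      also have "\<dots> \<le> (1 - \<tau> * y)\<^sup>2 * (norm u)\<^sup>2 + \<tau>\<^sup>2 * (M * norm u)\<^sup>2"
        using v by (intro add_left_mono mult_left_mono power_mono) auto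
      also have "\<dots> = (k * norm u)\<^sup>2"
        unfolding power_mult_distrib tau[symmetric] by (simp add: algebra_simps)
      finally show ?thesis
        by (rule power2_le_imp_le) (simp add: k_def)
    qed
    moreover have "\<tau> \<noteq> 0" using y0 pos by (metis \<tau>_def divide_eq_0_iff less_irrefl)
    moreover have "0 \<le> k" "k < 1" using y0 pos by (simp_all add: k_def pos_divide_less_eq)
    ultimately have "z \<notin> spectrum A"
      by (intro not_in_spectrumI[OF lin, of "complex_of_real \<tau> * \<i>" k]) auto
    then show False using z by simp
  qed
  then have zr: "z = complex_of_real (Re z)" by (simp add: complex_eq_iff)
  have "\<bar>Re z\<bar> \<le> a"
  proof (rule ccontr)
    assume "\<not> \<bar>Re z\<bar> \<le> a"
    then have gt: "cmod z > a" by (subst zr) simp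
    then have z0: "z \<noteq> 0" using a0 by auto
    have "norm (u - (- (1 / z)) *\<^sub>C (A u - z *\<^sub>C u)) \<le> a / cmod z * norm u" for u
    proof -
      have "u - (- (1 / z)) *\<^sub>C (A u - z *\<^sub>C u) = (1 / z) *\<^sub>C A u"
        using z0 by (simp add: complex_vector.scale_right_diff_distrib scaleC_scaleC scaleC_one)
      then show ?thesis
        using norm_blinfun_le[OF A(2), of u] z0 by (simp add: norm_scaleC norm_divide divide_right_mono)
    qed
    then have "z \<notin> spectrum A"
      using z0 gt a0 by (intro not_in_spectrumI[OF lin, of "- (1 / z)" "a / cmod z"]) auto
    then show False using z by simp
  qed
  then show "z \<in> complex_of_real ` {-a..a}"
    using zr by (intro image_eqI[of _ _ "Re z"]) auto
qed

text \<open>A bounded left inverse of A - E would keep the norm of (A - E) \<phi> above a fixed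
  multiple of the norm of \<phi>.\<close>

lemma approx_eigenvalue_in_spectrum:
  fixes A :: "'a::chilbert_space \<Rightarrow>\<^sub>L 'a"
  assumes "\<And>e. e > 0 \<Longrightarrow> approx_eigenvalue A E e"
  shows "complex_of_real E \<in> spectrum A"
proof (rule ccontr)
  assume "complex_of_real E \<notin> spectrum A"
  then obtain B :: "'a \<Rightarrow>\<^sub>L 'a" where B: "\<And>x. B (A x - E *\<^sub>R x) = x"
    unfolding spectrum_def scaleR_scaleC by blast
  define e where "e = 1 / (norm B + 1)"
  have "e > 0" by (simp add: e_def add_nonneg_pos)
  then obtain \<phi> where \<phi>: "norm (A \<phi> - E *\<^sub>R \<phi>) < e * norm \<phi>"
    using assms unfolding approx_eigenvalue_def by blast
  have "norm \<phi> \<le> norm B * norm (A \<phi> - E *\<^sub>R \<phi>)"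
    using norm_blinfun[of B "A \<phi> - E *\<^sub>R \<phi>"] B by simp
  also have "\<dots> \<le> (norm B + 1) * norm (A \<phi> - E *\<^sub>R \<phi>)" by (simp add: mult_right_mono)
  also have "\<dots> < (norm B + 1) * (e * norm \<phi>)"
    using \<phi> by (intro mult_strict_left_mono) (auto simp: add_nonneg_pos)
  also have "\<dots> = norm \<phi>"
    using norm_ge_zero[of B] by (simp add: e_def add_nonneg_eq_0_iff)
  finally show False by simp
qed

lemma spectrum_eqI:
  fixes A :: "'a::chilbert_space \<Rightarrow>\<^sub>L 'a"
  assumes A: "selfadjoint A" "norm A \<le> a" and a: "a > 0"
    and approx: "\<And>E n. E \<in> \<rat> \<inter> {-a..a} \<Longrightarrow> approx_eigenvalue A E (1 / Suc n)"
  shows "spectrum A = complex_of_real ` {-a..a}"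
proof (intro equalityI spectrum_subset[OF A] image_subsetI approx_eigenvalue_in_spectrum)
  fix E e :: real assume E: "E \<in> {-a..a}" and e: "e > 0"
  obtain n where n: "1 / Suc n < e / 2"
    using reals_Archimedean[of "e / 2"] e by (auto simp: inverse_eq_divide)
  \<comment> \<open>The rational \<open>q\<close> must itself lie in {-a..a}, also when
    \<open>E\<close> is an endpoint; a > 0 keeps the interval nonempty.\<close>
  have "max (-a) (E - e / 2) < min a (E + e / 2)" using E e a by auto
  then obtain q where q: "q \<in> \<rat>" "max (-a) (E - e / 2) < q" "q < min a (E + e / 2)"
    using Rats_dense_in_real by blast
  then obtain \<phi> where \<phi>: "norm (A \<phi> - q *\<^sub>R \<phi>) < 1 / real (Suc n) * norm \<phi>"
    using approx[of q n] by (auto simp: approx_eigenvalue_def)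
  have "norm (A \<phi> - E *\<^sub>R \<phi>) \<le> norm (A \<phi> - q *\<^sub>R \<phi>) + norm ((q - E) *\<^sub>R \<phi>)"
    using norm_triangle_ineq[of "A \<phi> - q *\<^sub>R \<phi>" "(q - E) *\<^sub>R \<phi>"] by (simp add: algebra_simps)
  also have "\<dots> < 1 / Suc n * norm \<phi> + \<bar>q - E\<bar> * norm \<phi>" using \<phi> by simp
  also have "\<dots> \<le> e / 2 * norm \<phi> + e / 2 * norm \<phi>"
  proof -
    have "E - e / 2 < q" "q < E + e / 2" using q by auto
    then have "\<bar>q - E\<bar> \<le> e / 2" by linarith
    then show ?thesis using n by (intro add_mono mult_right_mono) auto
  qed
  finally show "approx_eigenvalue A E e"
    unfolding approx_eigenvalue_def by (intro exI[of _ \<phi>]) (simp flip: distrib_right)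
qed

section \<open>Finite orthonormal systems\<close>

definition finite_orthonormal :: "'a::complex_inner set \<Rightarrow> bool" where
  "finite_orthonormal B \<longleftrightarrow> finite B \<and> (\<forall>x\<in>B. \<forall>y\<in>B. cinner x y = (if x = y then 1 else 0))"

text \<open>Only finite systems occur, so a finite sum serves as the projection. Membership of
  \<open>x\<close> in the span of \<open>B\<close> is expressed as
  \<open>ortho_proj B x = x\<close>, and \<open>A (ortho_proj B x) = A x\<close> says that
  \<open>A\<close> vanishes on the orthogonal complement.\<close>

definition ortho_proj :: "'a::complex_inner set \<Rightarrow> 'a \<Rightarrow>\<^sub>L 'a" where
  "ortho_proj B = Blinfun (\<lambda>x. \<Sum>b\<in>B. cinner b x *\<^sub>C b)"

lemma bounded_linear_cinner_scaleC: "bounded_linear (\<lambda>x. cinner b x *\<^sub>C (c::'a::complex_inner))"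
  by (intro bounded_linear_compose[OF bounded_bilinear.bounded_linear_left[OF bounded_bilinear_scaleC]]
      cinner.bounded_linear_right)

lemma ortho_proj_apply: "ortho_proj B x = (\<Sum>b\<in>B. cinner b x *\<^sub>C b)"
  unfolding ortho_proj_def
  by (subst bounded_linear_Blinfun_apply) (intro bounded_linear_sum bounded_linear_cinner_scaleC refl)+

lemma cinner_sum_ortho:
  assumes "finite_orthonormal B" "b \<in> B"
  shows "cinner b (\<Sum>b'\<in>B. g b' *\<^sub>C b') = g b"
proof -
  have "cinner b (\<Sum>b'\<in>B. g b' *\<^sub>C b') = (\<Sum>b'\<in>B. if b = b' then g b' else 0)"
    unfolding cinner.sum_right
    using assms by (intro sum.cong) (auto simp: cinner_scaleC_right finite_orthonormal_def)
  then show ?thesis using assms by (simp add: finite_orthonormal_def)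
qed

lemma cinner_ortho_proj: "cinner x (ortho_proj B y) = cinner (ortho_proj B x) y"
  unfolding ortho_proj_apply cinner.sum_right cinner.sum_left cinner_scaleC_right cinner_scaleC_left
  by (intro sum.cong refl) (metis cinner_commute mult.commute)

lemma selfadjoint_ortho_proj: "selfadjoint (ortho_proj B)"
  by (rule selfadjointI) (rule cinner_ortho_proj)

lemma cinner_basis_ortho_proj:
  assumes "finite_orthonormal B" "b \<in> B"
  shows "cinner b (ortho_proj B x) = cinner b x"
  unfolding ortho_proj_apply by (rule cinner_sum_ortho[OF assms])

text \<open>The tower law for nested projections; the case \<open>B = B'\<close> serves as
  idempotence.\<close>

lemma ortho_proj_mono:
  assumes "finite_orthonormal B'" "B \<subseteq> B'"
  shows "ortho_proj B (ortho_proj B' x) = ortho_proj B x"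
  unfolding ortho_proj_apply[of B]
  using assms by (intro sum.cong refl) (auto simp: cinner_basis_ortho_proj)

lemma ortho_proj_mono':
  assumes "finite_orthonormal B'" "B \<subseteq> B'"
  shows "ortho_proj B' (ortho_proj B x) = ortho_proj B x"
  by (rule cinner_eqI) (simp add: cinner_ortho_proj ortho_proj_mono[OF assms])

lemma ortho_proj_fix_mono:
  assumes "finite_orthonormal B'" "B \<subseteq> B'" "ortho_proj B x = x"
  shows "ortho_proj B' x = x"
  using ortho_proj_mono'[OF assms(1,2), of x] assms(3) by simp

lemma norm_ortho_proj_square:
  assumes "finite_orthonormal B"
  shows "(norm (ortho_proj B x))\<^sup>2 = Re (cinner x (ortho_proj B x))"
proof -
  have "cinner (ortho_proj B x) (ortho_proj B x) = cinner x (ortho_proj B x)"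
    using ortho_proj_mono[OF assms subset_refl, of x] cinner_ortho_proj by metis
  then show ?thesis using cinner_self[of "ortho_proj B x"] by (metis Re_complex_of_real)
qed

text \<open>Cauchy-Schwarz followed by cancelling \<open>norm y\<close>. It yields Bessel-type
  bounds for a vector \<open>y\<close> that is the component of \<open>x\<close> in some
  subspace.\<close>

lemma norm_le_if_square_le_cinner:
  assumes "(norm y)\<^sup>2 \<le> Re (cinner x y)"
  shows "norm y \<le> norm x"
proof (cases "y = 0")
  case False
  have "norm y * norm y \<le> norm x * norm y"
    using assms Re_cinner_le[of x y] by (simp add: power2_eq_square)
  then show ?thesis using False by simp
qed simp

lemma norm_ortho_proj_le:
  assumes "finite_orthonormal B"
  shows "norm (ortho_proj B x) \<le> norm x"
  by (rule norm_le_if_square_le_cinner) (simp add: norm_ortho_proj_square[OF assms])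

lemma finite_orthonormal_insert:
  assumes B: "finite_orthonormal B" and u: "norm u = 1" "\<And>b. b \<in> B \<Longrightarrow> cinner b u = 0"
  shows "finite_orthonormal (insert u B)" "u \<notin> B" "ortho_proj (insert u B) x = ortho_proj B x + cinner u x *\<^sub>C u"
proof -
  have uu: "cinner u u = 1" using u(1) by (simp add: cinner_self)
  have "cinner u b = 0" if "b \<in> B" for b
    using u(2)[OF that] by (metis cinner_commute complex_cnj_zero)
  then show "finite_orthonormal (insert u B)"
    using B u(2) uu unfolding finite_orthonormal_def by auto
  show "u \<notin> B" using u(2)[of u] uu by auto
  then show "ortho_proj (insert u B) x = ortho_proj B x + cinner u x *\<^sub>C u"
    using B by (simp add: ortho_proj_apply finite_orthonormal_def add.commute)
qed

text \<open>Gram-Schmidt: the normalised remainder \<open>e\<close> of \<open>x\<close> joins the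
  system unless \<open>x\<close> is already in the span, and enlarging the system keeps earlier
  vectors fixed.\<close>

lemma finite_orthonormal_extend:
  assumes "finite S" "finite_orthonormal B"
  shows "\<exists>B'. finite_orthonormal B' \<and> B \<subseteq> B' \<and> (\<forall>x\<in>S. ortho_proj B' x = x)"
  using assms(1)
proof (induction S)
  case empty
  then show ?case using assms(2) by blast
next
  case (insert x S)
  then obtain B' where B': "finite_orthonormal B'" "B \<subseteq> B'" "\<forall>x\<in>S. ortho_proj B' x = x" by blast
  define u where "u = x - ortho_proj B' x"
  show ?case
  proof (cases "u = 0")
    case True
    then show ?thesis using B' by (intro exI[of _ B']) (auto simp: u_def)
  next
    case False
    define e where "e = (1 / norm u) *\<^sub>R u"
    have bu: "cinner b u = 0" if "b \<in> B'" for b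
      using cinner_basis_ortho_proj[OF B'(1) that] by (simp add: u_def cinner_diff_right)
    have e: "norm e = 1" "\<And>b. b \<in> B' \<Longrightarrow> cinner b e = 0"
      using False by (auto simp: e_def bu cinner_scaleR_right)
    note ins = finite_orthonormal_insert[OF B'(1) e]
    have "cinner u (ortho_proj B' x) = 0"
      unfolding cinner_ortho_proj by (simp add: u_def blinfun.diff_right ortho_proj_mono[OF B'(1)])
    then have "cinner u x = complex_of_real ((norm u)\<^sup>2)"
      by (metis u_def cinner_self cinner_diff_right diff_zero)
    then have "cinner e x = complex_of_real (norm u)"
      using False by (simp add: e_def cinner_scaleR_left scaleR_conv_of_real power2_eq_square)
    then have "cinner e x *\<^sub>C e = norm u *\<^sub>R e" by (simp add: scaleR_scaleC)
    then have "cinner e x *\<^sub>C e = u" using False by (simp add: e_def)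
    then have "ortho_proj (insert e B') x = x"
      by (simp add: ins(3) u_def)
    then show ?thesis
      using ins(1) B' ortho_proj_fix_mono[OF ins(1), of B'] by (intro exI[of _ "insert e B'"]) auto
  qed
qed

lemma infinite_dimensional_ortho_unit:
  assumes "infinite_dimensional TYPE('a::complex_inner)" and B: "finite_orthonormal (B :: 'a set)"
  shows "\<exists>u. norm u = 1 \<and> (\<forall>b\<in>B. cinner b u = 0)"
proof -
  have "ortho_proj B x \<in> complex_vector.span B" for x
    unfolding ortho_proj_apply
    by (intro complex_vector.span_sum complex_vector.span_scale complex_vector.span_base)
  moreover have "complex_vector.span B \<noteq> UNIV"
    using assms by (auto simp: infinite_dimensional_def finite_orthonormal_def)
  ultimately obtain x where x: "ortho_proj B x \<noteq> x" by (metis UNIV_eq_I)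
  define u where "u = x - ortho_proj B x"
  have "cinner b u = 0" if "b \<in> B" for b
    using cinner_basis_ortho_proj[OF B that] by (simp add: u_def cinner_diff_right)
  moreover have "u \<noteq> 0" using x by (auto simp: u_def)
  ultimately show ?thesis
    by (intro exI[of _ "(1 / norm u) *\<^sub>R u"]) (auto simp: cinner_scaleR_right)
qed

text \<open>Each vector of \<open>C\<close> receives a fresh unit vector. The subset
  \<open>C\<close> is separate from \<open>B\<close> so that the induction runs over
  \<open>C\<close> while orthogonality to all of \<open>B\<close> is maintained.\<close>

lemma orthonormal_copy:
  assumes inf: "infinite_dimensional TYPE('a::complex_inner)" and B: "finite_orthonormal (B :: 'a set)"
    and "C \<subseteq> B"
  shows "\<exists>f. inj_on f C \<and> f ` C \<inter> B = {} \<and> finite_orthonormal (B \<union> f ` C)"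
proof -
  have "finite C" using B \<open>C \<subseteq> B\<close> finite_subset by (auto simp: finite_orthonormal_def)
  then show ?thesis using \<open>C \<subseteq> B\<close>
  proof (induction C)
    case empty
    then show ?case using B by auto
  next
    case (insert c C)
    then obtain f where f: "inj_on f C" "f ` C \<inter> B = {}" "finite_orthonormal (B \<union> f ` C)" by auto
    obtain u where u: "norm u = 1" "\<And>b. b \<in> B \<union> f ` C \<Longrightarrow> cinner b u = 0"
      using infinite_dimensional_ortho_unit[OF inf f(3)] by blast
    note ins = finite_orthonormal_insert[OF f(3) u]
    have img: "(f(c := u)) ` insert c C = insert u (f ` C)" using insert.hyps by auto
    have "inj_on (f(c := u)) (insert c C)"
      using ins(2) insert.hyps by (intro inj_onI) (auto split: if_splits dest: inj_onD[OF f(1)])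
    moreover have "(f(c := u)) ` insert c C \<inter> B = {}"
      unfolding img using f(2) ins(2) by auto
    moreover have "finite_orthonormal (B \<union> (f(c := u)) ` insert c C)"
      unfolding img using ins(1) by simp
    ultimately show ?case by blast
  qed
qed

section \<open>Spreading the spectral measures of finite rank operators\<close>

text \<open>\<open>J\<close> carries each vector of \<open>B\<close> to its orthonormal copy and
  kills the complement; \<open>J'\<close> is its adjoint, written out explicitly. \<open>B'\<close>
  is the union of \<open>B\<close> and the copy.\<close>

lemma partial_isometry_exists:
  assumes inf: "infinite_dimensional TYPE('a::chilbert_space)" and B: "finite_orthonormal (B :: 'a set)"
  shows "\<exists>B' (J :: 'a \<Rightarrow>\<^sub>L 'a) (J' :: 'a \<Rightarrow>\<^sub>L 'a). finite_orthonormal B' \<and> B \<subseteq> B' \<and>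
    (\<forall>x y. cinner x (J y) = cinner (J' x) y) \<and> (\<forall>x. J' (J x) = ortho_proj B x) \<and>
    (\<forall>x. ortho_proj B (J x) = 0) \<and> (\<forall>x. J (ortho_proj B x) = J x) \<and> (\<forall>x. ortho_proj B' (J x) = J x)"
proof -
  obtain f where f: "inj_on f B" "f ` B \<inter> B = {}" "finite_orthonormal (B \<union> f ` B)"
    using orthonormal_copy[OF inf B subset_refl] by blast
  define J where "J = Blinfun (\<lambda>x. \<Sum>b\<in>B. cinner b x *\<^sub>C f b)"
  define J' where "J' = Blinfun (\<lambda>x. \<Sum>b\<in>B. cinner (f b) x *\<^sub>C b)"
  have J: "J x = (\<Sum>b\<in>B. cinner b x *\<^sub>C f b)" for x
    unfolding J_def by (subst bounded_linear_Blinfun_apply) (intro bounded_linear_sum bounded_linear_cinner_scaleC refl)+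
  have J': "J' x = (\<Sum>b\<in>B. cinner (f b) x *\<^sub>C b)" for x
    unfolding J'_def by (subst bounded_linear_Blinfun_apply) (intro bounded_linear_sum bounded_linear_cinner_scaleC refl)+
  have fin: "finite B" using B by (simp add: finite_orthonormal_def)
  have on: "cinner (f b) (f b') = (if b = b' then 1 else 0)" "cinner b (f b') = 0" if "b \<in> B" "b' \<in> B" for b b'
    using f that unfolding finite_orthonormal_def inj_on_def by auto
  have "cinner x (J y) = cinner (J' x) y" for x y
    unfolding J J' cinner.sum_right cinner.sum_left cinner_scaleC_right cinner_scaleC_left
    by (intro sum.cong refl) (metis cinner_commute mult.commute)
  moreover have "cinner (f b) (J x) = cinner b x" if "b \<in> B" for b x
  proof -
    have "cinner (f b) (J x) = (\<Sum>b'\<in>B. if b = b' then cinner b' x else 0)"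
      unfolding J cinner.sum_right using that by (intro sum.cong) (auto simp: cinner_scaleC_right on)
    then show ?thesis using fin that by simp
  qed
  then have "J' (J x) = ortho_proj B x" for x
    unfolding J' ortho_proj_apply by (intro sum.cong) auto
  moreover have "ortho_proj B (J x) = 0" for x
    unfolding ortho_proj_apply J cinner.sum_right by (simp add: cinner_scaleC_right on)
  moreover have "J (ortho_proj B x) = J x" for x
    unfolding J by (intro sum.cong) (auto simp: cinner_basis_ortho_proj[OF B])
  moreover have "ortho_proj (B \<union> f ` B) (J x) = J x" for x
  proof -
    have "ortho_proj (B \<union> f ` B) (f b) = f b" if "b \<in> B" for b
      using cinner_eqI[of "ortho_proj (B \<union> f ` B) (f b)" "f b"] cinner_basis_ortho_proj[OF f(3)]
        ortho_proj_fix_mono[OF f(3), of "{f b}"] that on(1)[OF that that]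
      by (simp add: ortho_proj_apply scaleC_one)
    then show ?thesis
      unfolding J by (simp add: blinfun.sum_right selfadjointD(1)[OF selfadjoint_ortho_proj])
  qed
  ultimately show ?thesis using f(3) by blast
qed

text \<open>On \<open>K \<oplus> J K\<close> the new operator is the block matrix with diagonal entries \<open>A\<close> and
  off-diagonal entries \<open>t\<close>; the vectors \<open>x \<plusminus> J x\<close> reduce it to \<open>A \<plusminus> t\<close>.\<close>

lemma double_operator:
  fixes A :: "'a::chilbert_space \<Rightarrow>\<^sub>L 'a"
  assumes inf: "infinite_dimensional TYPE('a)" and B: "finite_orthonormal B"
    and A: "selfadjoint A" "\<And>x. A (ortho_proj B x) = A x"
  shows "\<exists>B' A'. finite_orthonormal B' \<and> B \<subseteq> B' \<and> selfadjoint A' \<and> (\<forall>x. A' (ortho_proj B' x) = A' x) \<and>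
    norm A' \<le> norm A + \<bar>t\<bar> \<and>
    (\<forall>x. ortho_proj B x = x \<longrightarrow> norm (A' x - A x) \<le> \<bar>t\<bar> * norm x) \<and>
    (\<forall>x p. ortho_proj B x = x \<longrightarrow> poly_form A' x p =
      (poly_form A x (p \<circ>\<^sub>p [:t, 1:]) + poly_form A x (p \<circ>\<^sub>p [:- t, 1:])) / 2)"
proof -
  obtain B' J J' where B': "finite_orthonormal B'" "B \<subseteq> B'"
    and adj: "\<And>x y. cinner x (blinfun_apply J y) = cinner (blinfun_apply J' x) y"
    and J'J: "\<And>x. J' (J x) = ortho_proj B x" and PJ: "\<And>x. ortho_proj B (J x) = 0"
    and JP: "\<And>x. J (ortho_proj B x) = J x" and P'J: "\<And>x. ortho_proj B' (J x) = J x"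
    using partial_isometry_exists[OF inf B] by blast
  have adj': "cinner x (J' y) = cinner (J x) y" for x y
    by (metis adj cinner_commute)
  have PA: "ortho_proj B (A x) = A x" for x
    by (rule cinner_eqI) (simp add: cinner_ortho_proj selfadjointD(2)[OF A(1)] A(2))
  have PJ': "ortho_proj B (J' x) = J' x" for x
    by (rule cinner_eqI) (simp add: cinner_ortho_proj adj' JP)
  have J'P: "J' x = 0" if "ortho_proj B x = x" for x
    by (rule cinner_eqI) (metis adj' that cinner_ortho_proj PJ cinner_zero)
  have J'P': "J' (ortho_proj B' x) = J' x" for x
    by (rule cinner_eqI) (metis adj' cinner_ortho_proj P'J)
  have orth: "cinner x (J y) = 0" if "ortho_proj B x = x" for x y
    by (metis that cinner_ortho_proj PJ cinner_zero(1))
  define A' where "A' = A + (J o\<^sub>L A o\<^sub>L J') + t *\<^sub>R (J + J')"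
  have A': "A' x = A x + J (A (J' x)) + t *\<^sub>R (J x + J' x)" for x
    by (simp add: A'_def blinfun.bilinear_simps)
  have sa: "selfadjoint A'"
    by (rule selfadjointI)
      (simp add: A' cinner_add_left cinner_add_right cinner_scaleR_left cinner_scaleR_right adj adj'
        selfadjointD(2)[OF A(1)])
  have supp: "A' (ortho_proj B' x) = A' x" for x
  proof -
    have "A (ortho_proj B' x) = A x" "J (ortho_proj B' x) = J x"
      by (metis A(2) ortho_proj_mono[OF B']) (metis JP ortho_proj_mono[OF B'])
    then show ?thesis by (simp add: A' J'P')
  qed
  have pyth: "(norm (x + J y))\<^sup>2 = (norm x)\<^sup>2 + (norm (J y))\<^sup>2" if "ortho_proj B x = x" for x y
    using orth[OF that, of y] by (simp add: norm_add_square)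
  have nJ: "norm (J x) = norm (ortho_proj B x)" for x
  proof -
    have "complex_of_real ((norm (J x))\<^sup>2) = cinner x (ortho_proj B x)"
      unfolding cinner_self[symmetric] adj by (metis J'J adj' adj)
    then have "(norm (J x))\<^sup>2 = (norm (ortho_proj B x))\<^sup>2"
      unfolding norm_ortho_proj_square[OF B] by (metis Re_complex_of_real)
    then show ?thesis by (simp add: power2_eq_iff_nonneg)
  qed
  have PP: "ortho_proj B (ortho_proj B x) = ortho_proj B x" for x
    by (rule ortho_proj_mono[OF B subset_refl])
  \<comment> \<open>Bessel's inequality for the component \<open>y\<close> of \<open>x\<close> in K
    \<oplus> J K, since \<open>J'\<close> reads off the part in J K.\<close>
  have sum_le: "(norm (ortho_proj B x))\<^sup>2 + (norm (J' x))\<^sup>2 \<le> (norm x)\<^sup>2" for x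
  proof -
    define y where "y = ortho_proj B x + J (J' x)"
    have y2: "(norm y)\<^sup>2 = (norm (ortho_proj B x))\<^sup>2 + (norm (J' x))\<^sup>2"
      unfolding y_def pyth[OF PP] nJ PJ' ..
    also have "\<dots> = Re (cinner x y)"
      unfolding norm_ortho_proj_square[OF B] y_def cinner_add_right adj cinner_self by simp
    finally have "norm y \<le> norm x" by (intro norm_le_if_square_le_cinner) simp
    then have "(norm y)\<^sup>2 \<le> (norm x)\<^sup>2" by (intro power_mono) auto
    then show ?thesis by (simp add: y2)
  qed
  \<comment> \<open>The diagonal blocks act on orthogonal subspaces and are bounded together by
    \<open>norm A\<close>; the exchange J + J' has norm at most 1 and accounts for |t|.\<close>
  have "norm A' \<le> norm A + \<bar>t\<bar>"
  proof (rule norm_blinfun_bound)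
    fix x
    have "(norm (A x + J (A (J' x))))\<^sup>2 = (norm (A x))\<^sup>2 + (norm (A (J' x)))\<^sup>2"
      by (simp add: pyth PA nJ)
    also have "\<dots> \<le> (norm A * norm (ortho_proj B x))\<^sup>2 + (norm A * norm (J' x))\<^sup>2"
      using norm_blinfun[of A "ortho_proj B x"] norm_blinfun[of A "J' x"]
      by (intro add_mono power_mono) (auto simp: A(2))
    also have "\<dots> = (norm A)\<^sup>2 * ((norm (ortho_proj B x))\<^sup>2 + (norm (J' x))\<^sup>2)"
      by (simp add: power_mult_distrib distrib_left)
    also have "\<dots> \<le> (norm A * norm x)\<^sup>2"
      unfolding power_mult_distrib by (intro mult_left_mono sum_le) simp
    finally have 1: "norm (A x + J (A (J' x))) \<le> norm A * norm x"
      by (rule power2_le_imp_le) simp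
    have "(norm (J x + J' x))\<^sup>2 = (norm (J' x))\<^sup>2 + (norm (ortho_proj B x))\<^sup>2"
      using pyth[OF PJ', of x x] by (simp add: add.commute nJ)
    also have "\<dots> \<le> (norm x)\<^sup>2" using sum_le[of x] by simp
    finally have "norm (J x + J' x) \<le> norm x" by (rule power2_le_imp_le) simp
    then have 2: "norm (t *\<^sub>R (J x + J' x)) \<le> \<bar>t\<bar> * norm x" by (simp add: mult_left_mono)
    show "norm (A' x) \<le> (norm A + \<bar>t\<bar>) * norm x"
      unfolding A' distrib_right by (rule order_trans[OF norm_triangle_ineq add_mono[OF 1 2]])
  qed simp
  moreover have "norm (A' x - A x) \<le> \<bar>t\<bar> * norm x" if "ortho_proj B x = x" for x
    using that by (simp add: A' J'P blinfun.zero_right nJ)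
  moreover have "poly_form A' x p =
      (poly_form A x (p \<circ>\<^sub>p [:t, 1:]) + poly_form A x (p \<circ>\<^sub>p [:- t, 1:])) / 2"
    if x: "ortho_proj B x = x" for x p
  proof -
    have inv: "ortho_proj B (poly_op q A x) = poly_op q A x" for q
      by (induction q) (simp_all add: blinfun.bilinear_simps x PA)
    have JJ: "J (J y) = 0" for y
      by (metis JP PJ blinfun.zero_right)
    have AJ: "A (J y) = 0" for y
      by (metis A(2) PJ blinfun.zero_right)
    \<comment> \<open>The condition s * s = 1 treats both signs at once.\<close>
    have step: "A' (y + s *\<^sub>R J y) = (A y + (s * t) *\<^sub>R y) + s *\<^sub>R J (A y + (s * t) *\<^sub>R y)"
      if y: "ortho_proj B y = y" and s: "s * s = 1" for y s
      using s by (simp add: A' blinfun.bilinear_simps JJ AJ J'J J'P[OF y] y algebra_simps flip: mult.assoc)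
    have eig: "poly_op q A' (x + s *\<^sub>R J x) =
        poly_op (q \<circ>\<^sub>p [:s * t, 1:]) A x + s *\<^sub>R J (poly_op (q \<circ>\<^sub>p [:s * t, 1:]) A x)"
      if s: "s * s = 1" for q s
    proof (induction q)
      case (pCons c q)
      show ?case
        unfolding poly_op_pCons pCons(2) step[OF inv s]
        by (simp add: pcompose_pCons poly_op_add poly_op_mult poly_op_smult blinfun.bilinear_simps algebra_simps)
    qed (simp add: blinfun.zero_right)
    have form: "cinner x (poly_op p A' (x + s *\<^sub>R J x)) = cinner x (poly_op (p \<circ>\<^sub>p [:s * t, 1:]) A x)"
      if "s * s = 1" for s
      unfolding eig[OF that] by (simp add: cinner_add_right cinner_scaleR_right orth[OF x])
    \<comment> \<open>\<open>x\<close> is the mean of x + J x and x - J x. Pairing with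
      \<open>x\<close> has removed the components in J K, so only the two shifted forms of
      \<open>A\<close> remain.\<close>
    have "poly_op p A' (x + 1 *\<^sub>R J x) + poly_op p A' (x + (- 1) *\<^sub>R J x) = 2 *\<^sub>R poly_op p A' x"
      by (simp add: scaleR_2 flip: poly_op_add_right)
    then have "2 *\<^sub>R cinner x (poly_op p A' x) =
        cinner x (poly_op p A' (x + 1 *\<^sub>R J x)) + cinner x (poly_op p A' (x + (- 1) *\<^sub>R J x))"
      by (simp only: flip: cinner_scaleR_right cinner_add_right)
    also have "\<dots> = cinner x (poly_op (p \<circ>\<^sub>p [:t, 1:]) A x) + cinner x (poly_op (p \<circ>\<^sub>p [:- t, 1:]) A x)"
      by (simp add: form del: scaleR_one scaleR_minus_left scaleR_minus1_left)
    finally have "Re (2 *\<^sub>R cinner x (poly_op p A' x)) =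
        Re (cinner x (poly_op (p \<circ>\<^sub>p [:t, 1:]) A x) + cinner x (poly_op (p \<circ>\<^sub>p [:- t, 1:]) A x))"
      by simp
    then show ?thesis by (simp add: poly_form_def)
  qed
  ultimately show ?thesis using B' sa supp by blast
qed

text \<open>Doubling is iterated with displacements \<tau>, 2 \<tau>, 4 \<tau> and so on. By binary
  expansion their signed sums run through 2^m points with constant gap 2 \<tau>, symmetric about 0,
  and the total displacement stays below 2^m \<tau>.\<close>

lemma spread_operator:
  fixes A :: "'a::chilbert_space \<Rightarrow>\<^sub>L 'a"
  assumes inf: "infinite_dimensional TYPE('a)" and B: "finite_orthonormal B"
    and A: "selfadjoint A" "\<And>x. A (ortho_proj B x) = A x" and \<tau>: "\<tau> \<ge> 0"
  shows "\<exists>B' A'. finite_orthonormal B' \<and> B \<subseteq> B' \<and> selfadjoint A' \<and> (\<forall>x. A' (ortho_proj B' x) = A' x) \<and>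
    norm A' \<le> norm A + 2 ^ m * \<tau> \<and>
    (\<forall>x. ortho_proj B x = x \<longrightarrow> norm (A' x - A x) \<le> 2 ^ m * \<tau> * norm x) \<and>
    (\<forall>x p. ortho_proj B x = x \<longrightarrow> poly_form A' x p =
      (\<Sum>k<2 ^ m. poly_form A x (p \<circ>\<^sub>p [:\<tau> * (2 * real k + 1 - 2 ^ m), 1:])) / 2 ^ m)"
proof (induction m)
  case 0
  show ?case
    using B A \<tau> by (intro exI[of _ B] exI[of _ A]) (auto simp: pcompose_idR)
next
  case (Suc m)
  then obtain B1 A1 where B1: "finite_orthonormal B1" "B \<subseteq> B1" and A1: "selfadjoint A1"
      "\<And>x. A1 (ortho_proj B1 x) = A1 x" "norm A1 \<le> norm A + 2 ^ m * \<tau>"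
    and near1: "\<And>x. ortho_proj B x = x \<Longrightarrow> norm (A1 x - A x) \<le> 2 ^ m * \<tau> * norm x"
    and form1: "\<And>x p. ortho_proj B x = x \<Longrightarrow> poly_form A1 x p =
      (\<Sum>k<2 ^ m. poly_form A x (p \<circ>\<^sub>p [:\<tau> * (2 * real k + 1 - 2 ^ m), 1:])) / 2 ^ m"
    by blast
  define t where "t = 2 ^ m * \<tau>"
  have t0: "\<bar>t\<bar> = t" using \<tau> by (simp add: t_def)
  obtain B2 A2 where B2: "finite_orthonormal B2" "B1 \<subseteq> B2" and A2: "selfadjoint A2"
      "\<And>x. A2 (ortho_proj B2 x) = A2 x" "norm A2 \<le> norm A1 + t"
    and near2: "\<And>x. ortho_proj B1 x = x \<Longrightarrow> norm (A2 x - A1 x) \<le> t * norm x"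
    and form2: "\<And>x p. ortho_proj B1 x = x \<Longrightarrow> poly_form A2 x p =
      (poly_form A1 x (p \<circ>\<^sub>p [:t, 1:]) + poly_form A1 x (p \<circ>\<^sub>p [:- t, 1:])) / 2"
    using double_operator[OF inf B1(1) A1(1,2), of t] unfolding t0 by blast
  have fix1: "ortho_proj B1 x = x" if "ortho_proj B x = x" for x
    using ortho_proj_fix_mono[OF B1 that] .
  have "norm A2 \<le> norm A + 2 ^ Suc m * \<tau>"
    using A2(3) A1(3) by (simp add: t_def)
  moreover have "norm (A2 x - A x) \<le> 2 ^ Suc m * \<tau> * norm x" if "ortho_proj B x = x" for x
    using near1[OF that] near2[OF fix1[OF that]] norm_triangle_ineq[of "A2 x - A1 x" "A1 x - A x"]
    by (simp add: t_def algebra_simps)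
  moreover have "poly_form A2 x p =
      (\<Sum>k<2 ^ Suc m. poly_form A x (p \<circ>\<^sub>p [:\<tau> * (2 * real k + 1 - 2 ^ Suc m), 1:])) / 2 ^ Suc m"
    if x: "ortho_proj B x = x" for x p
  proof -
    define g where "g s = poly_form A x (p \<circ>\<^sub>p [:s, 1:])" for s
    have comp: "(p \<circ>\<^sub>p [:s, 1:]) \<circ>\<^sub>p [:r, 1:] = p \<circ>\<^sub>p [:r + s, 1:]" for r s :: real
      by (simp add: pcompose_pCons add.commute flip: pcompose_assoc)
    have "poly_form A2 x p = ((\<Sum>k<2 ^ m. g (\<tau> * (2 * real k + 1 - 2 ^ m) + t)) +
        (\<Sum>k<2 ^ m. g (\<tau> * (2 * real k + 1 - 2 ^ m) - t))) / 2 ^ Suc m"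
      unfolding form2[OF fix1[OF x]] form1[OF x] comp g_def by (simp add: add_divide_distrib)
    \<comment> \<open>With t = 2^m \<tau>, subtracting \<open>t\<close> gives the lower half of the
      finer grid with the same index, and adding \<open>t\<close> gives the upper half with index k
      + 2^m.\<close>
    also have "(\<Sum>k<2 ^ m. g (\<tau> * (2 * real k + 1 - 2 ^ m) - t)) =
        (\<Sum>k<2 ^ m. g (\<tau> * (2 * real k + 1 - 2 ^ Suc m)))"
      by (simp add: t_def algebra_simps)
    also have "(\<Sum>k<2 ^ m. g (\<tau> * (2 * real k + 1 - 2 ^ m) + t)) =
        (\<Sum>k\<in>{2 ^ m..<2 ^ Suc m}. g (\<tau> * (2 * real k + 1 - 2 ^ Suc m)))"
      by (rule sum.reindex_bij_witness[of _ "\<lambda>k. k - 2 ^ m" "\<lambda>k. k + 2 ^ m"])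
        (auto simp: t_def algebra_simps)
    also have "(\<Sum>k\<in>{2 ^ m..<2 ^ Suc m}. g (\<tau> * (2 * real k + 1 - 2 ^ Suc m))) +
        (\<Sum>k<2 ^ m. g (\<tau> * (2 * real k + 1 - 2 ^ Suc m))) =
        (\<Sum>k<2 ^ Suc m. g (\<tau> * (2 * real k + 1 - 2 ^ Suc m)))"
      unfolding lessThan_atLeast0 by (subst add.commute, rule sum.atLeastLessThan_concat) auto
    finally show ?thesis by (simp add: g_def)
  qed
  moreover have "B \<subseteq> B2" using B1(2) B2(2) by blast
  ultimately show ?case using B2(1) A2(1,2) by (intro exI[of _ B2] exI[of _ A2]) auto
qed

section \<open>Finite rank approximations\<close>

text \<open>A bridge from the function class of Stone-Weierstrass to \<open>poly\<close>, which can
  be evaluated at an operator.\<close>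

lemma real_polynomial_function_poly:
  assumes "real_polynomial_function (h :: real \<Rightarrow> real)"
  shows "\<exists>p. \<forall>x. h x = poly p x"
  using assms
proof (induction h rule: real_polynomial_function.induct)
  case (linear h)
  have "h x = poly [:0, h 1:] x" for x
    using linear_cmul[OF bounded_linear.linear[OF linear], of x 1] by simp
  then show ?case by metis
next
  case (const c)
  have "c = poly [:c:] x" for x by simp
  then show ?case by metis
next
  case (add f g)
  then show ?case by (metis poly_add)
next
  case (mult f g)
  then show ?case by (metis poly_mult)
qed

text \<open>Affine shrinking of \<open>f\<close> by \<open>\<delta>\<close> leaves room for the approximation error inside \<open>{0..1}\<close>.\<close>

lemma unit_interval_poly_approx:
  fixes f :: "real \<Rightarrow> real"
  assumes f: "continuous_on {-a..a} f" "\<And>x. f x \<in> {0..1}" and \<delta>: "0 < \<delta>" "\<delta> \<le> 1 / 8"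
  shows "\<exists>p. \<forall>x\<in>{-a..a}. poly p x \<in> {0..1} \<and> poly p x \<le> f x + 2 * \<delta> \<and> (2 / 3 \<le> f x \<longrightarrow> 1 / 2 \<le> poly p x)"
proof -
  have "continuous_on {-a..a} (\<lambda>x. (1 - 2 * \<delta>) * f x + \<delta>)"
    by (intro continuous_intros f(1))
  then obtain h where "real_polynomial_function h" and h: "\<And>x. x \<in> {-a..a} \<Longrightarrow> \<bar>(1 - 2 * \<delta>) * f x + \<delta> - h x\<bar> < \<delta>"
    using Stone_Weierstrass_real_polynomial_function[of "{-a..a}" _ \<delta>] \<delta>(1) by (metis compact_Icc)
  then obtain p where p: "\<And>x. h x = poly p x" using real_polynomial_function_poly by blast
  have "poly p x \<in> {0..1} \<and> poly p x \<le> f x + 2 * \<delta> \<and> (2 / 3 \<le> f x \<longrightarrow> 1 / 2 \<le> poly p x)"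
    if x: "x \<in> {-a..a}" for x
  proof -
    have fx: "0 \<le> f x" "f x \<le> 1" using f(2)[of x] by auto
    have near: "(1 - 2 * \<delta>) * f x \<le> poly p x" "poly p x \<le> (1 - 2 * \<delta>) * f x + 2 * \<delta>"
      using h[OF x] unfolding p by linarith+
    have 1: "0 \<le> (1 - 2 * \<delta>) * f x" using fx \<delta> by simp
    have 2: "(1 - 2 * \<delta>) * f x \<le> (1 - 2 * \<delta>) * 1" using fx \<delta> by (intro mult_left_mono) auto
    have 3: "(1 - 2 * \<delta>) * f x \<le> 1 * f x" using fx \<delta> by (intro mult_right_mono) auto
    \<comment> \<open>Here \<open>\<delta> \<le> 1 / 8\<close> is used: 1 - 2 \<delta> \<ge> 3/4,
      and 3/4 times 2/3 is 1/2.\<close>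
    have 4: "1 / 2 \<le> (1 - 2 * \<delta>) * f x" if "2 / 3 \<le> f x"
      using mult_mono[of "3/4" "1 - 2 * \<delta>" "2/3" "f x"] that \<delta> by simp
    show ?thesis using near 1 2 3 4 by auto
  qed
  then show ?thesis by blast
qed

text \<open>The projection fixes both \<open>S\<close> and its image under \<open>A\<close>, so the
  compression agrees with \<open>A\<close> on \<open>S\<close> exactly, not merely up to an
  error.\<close>

lemma compression_exists:
  fixes A :: "'a::chilbert_space \<Rightarrow>\<^sub>L 'a"
  assumes A: "selfadjoint A" and S: "finite S"
  shows "\<exists>B A'. finite_orthonormal B \<and> selfadjoint A' \<and> norm A' \<le> norm A \<and>
    (\<forall>x. A' (ortho_proj B x) = A' x) \<and> (\<forall>x\<in>S. ortho_proj B x = x \<and> A' x = A x)"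
proof -
  obtain B where B: "finite_orthonormal B" "\<forall>x\<in>S \<union> A ` S. ortho_proj B x = x"
    using finite_orthonormal_extend[of "S \<union> A ` S" "{}"] S by (auto simp: finite_orthonormal_def)
  define A' where "A' = ortho_proj B o\<^sub>L A o\<^sub>L ortho_proj B"
  have A': "A' x = ortho_proj B (A (ortho_proj B x))" for x by (simp add: A'_def)
  have "selfadjoint A'"
    by (rule selfadjointI) (simp add: A' cinner_ortho_proj selfadjointD(2)[OF A])
  moreover have "norm A' \<le> norm A"
  proof (rule norm_blinfun_bound)
    show "norm (A' x) \<le> norm A * norm x" for x
    proof -
      have "norm (A' x) \<le> norm (A (ortho_proj B x))"
        unfolding A' by (rule norm_ortho_proj_le[OF B(1)])
      also have "\<dots> \<le> norm A * norm (ortho_proj B x)" by (rule norm_blinfun)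
      also have "\<dots> \<le> norm A * norm x" by (intro mult_left_mono norm_ortho_proj_le[OF B(1)]) simp
      finally show ?thesis .
    qed
  qed simp
  moreover have "A' (ortho_proj B x) = A' x" for x
    by (simp add: A' ortho_proj_mono[OF B(1) subset_refl])
  moreover have "ortho_proj B x = x \<and> A' x = A x" if "x \<in> S" for x
    using B(2) that by (simp add: A')
  ultimately show ?thesis using B(1) by blast
qed

text \<open>Density in the ball, spelled out on basic neighbourhoods so that the operator
  constructions stay free of topology.\<close>

definition strongly_approximable :: "real \<Rightarrow> (('a::chilbert_space \<Rightarrow>\<^sub>L 'a) \<Rightarrow> bool) \<Rightarrow> bool" where
  "strongly_approximable a C \<longleftrightarrow> (\<forall>A\<in>selfadjoint_ball a. \<forall>S e. finite S \<longrightarrow> e > 0 \<longrightarrow>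
     (\<exists>A'\<in>selfadjoint_ball a. C A' \<and> (\<forall>x\<in>S. norm (A' x - A x) < e)))"

text \<open>The compression vanishes at a unit vector \<open>u\<close> orthogonal to
  \<open>B\<close>, so E times the projection onto \<open>u\<close> can be added. The two ranges are
  orthogonal, hence the norm does not exceed the larger of \<open>norm A'\<close> and |E|, and
  \<open>u\<close> becomes an exact eigenvector.\<close>

lemma approx_eigenvalue_approximable:
  assumes inf: "infinite_dimensional TYPE('a::chilbert_space)" and E: "E \<in> {-a..a}" and e: "e > 0"
  shows "strongly_approximable a (\<lambda>A :: 'a \<Rightarrow>\<^sub>L 'a. approx_eigenvalue A E e)"
  unfolding strongly_approximable_def
proof (intro ballI allI impI)
  fix A :: "'a \<Rightarrow>\<^sub>L 'a" and S :: "'a set" and \<eta> :: real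
  assume "A \<in> selfadjoint_ball a" "finite S" "\<eta> > 0"
  then have A: "selfadjoint A" "norm A \<le> a" by (auto simp: selfadjoint_ball_def)
  obtain B A' where B: "finite_orthonormal B" and A': "selfadjoint A'" "norm A' \<le> norm A"
    and supp: "\<And>x. A' (ortho_proj B x) = A' x" and S: "\<And>x. x \<in> S \<Longrightarrow> ortho_proj B x = x" "\<And>x. x \<in> S \<Longrightarrow> A' x = A x"
    using compression_exists[OF A(1) \<open>finite S\<close>] by blast
  obtain u where u: "norm u = 1" "\<And>b. b \<in> B \<Longrightarrow> cinner b u = 0"
    using infinite_dimensional_ortho_unit[OF inf B] by blast
  note ins = finite_orthonormal_insert[OF B u]
  have Pu: "ortho_proj B u = 0" using u(2) by (simp add: ortho_proj_apply)
  have u_on: "finite_orthonormal {u}" using u(1) by (simp add: finite_orthonormal_def cinner_self)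
  define Q where "Q = ortho_proj {u}"
  have Q: "Q x = cinner u x *\<^sub>C u" for x by (simp add: Q_def ortho_proj_apply)
  have Quu: "Q u = u" using u(1) by (simp add: Q cinner_self scaleC_one)
  have PA': "ortho_proj B (A' x) = A' x" for x
    by (rule cinner_eqI) (simp add: cinner_ortho_proj selfadjointD(2)[OF A'(1)] supp)
  have QP: "Q x = 0" if "ortho_proj B x = x" for x
    using that Pu by (simp add: Q) (metis cinner_ortho_proj cinner_zero(2))
  have orth: "cinner x (Q y) = 0" if "ortho_proj B x = x" for x y
    using QP[OF that] unfolding Q_def by (simp add: cinner_ortho_proj)
  define A'' where "A'' = A' + E *\<^sub>R Q"
  have A'': "A'' x = A' x + E *\<^sub>R Q x" for x by (simp add: A''_def blinfun.bilinear_simps)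
  have "selfadjoint A''"
    by (rule selfadjointI) (simp add: A'' cinner_add_left cinner_add_right cinner_scaleR_left
        cinner_scaleR_right selfadjointD(2)[OF A'(1)] Q_def cinner_ortho_proj)
  moreover have "norm A'' \<le> a"
  proof (rule norm_blinfun_bound)
    show a0: "0 \<le> a" using E by auto
    fix x
    have pyth: "(norm (y + r *\<^sub>R Q z))\<^sup>2 = (norm y)\<^sup>2 + r\<^sup>2 * (norm (Q z))\<^sup>2" if "ortho_proj B y = y" for y z r
      by (simp add: norm_add_square cinner_scaleR_right orth[OF that] power_mult_distrib)
    have "(norm (A'' x))\<^sup>2 = (norm (A' (ortho_proj B x)))\<^sup>2 + E\<^sup>2 * (norm (Q x))\<^sup>2"
      unfolding A'' pyth[OF PA'] supp ..
    also have "\<dots> \<le> (a * norm (ortho_proj B x))\<^sup>2 + a\<^sup>2 * (norm (Q x))\<^sup>2"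
    proof -
      have "E\<^sup>2 \<le> a\<^sup>2" using E a0 by (intro abs_le_square_iff[THEN iffD1]) auto
      then show ?thesis
        using norm_blinfun_le[OF order_trans[OF A'(2) A(2)], of "ortho_proj B x"]
        by (intro add_mono[OF power_mono mult_right_mono]) auto
    qed
    also have "\<dots> = a\<^sup>2 * (norm (ortho_proj B x + 1 *\<^sub>R Q x))\<^sup>2"
      unfolding pyth[OF ortho_proj_mono[OF B subset_refl]] by (simp add: power_mult_distrib distrib_left)
    also have "ortho_proj B x + 1 *\<^sub>R Q x = ortho_proj (insert u B) x"
      by (simp add: ins(3) Q)
    also have "a\<^sup>2 * (norm (ortho_proj (insert u B) x))\<^sup>2 \<le> a\<^sup>2 * (norm x)\<^sup>2"
      by (intro mult_left_mono power_mono norm_ortho_proj_le[OF ins(1)]) auto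
    finally have "(norm (A'' x))\<^sup>2 \<le> (a * norm x)\<^sup>2" by (simp add: power_mult_distrib)
    then show "norm (A'' x) \<le> a * norm x"
      by (rule power2_le_imp_le) (simp add: a0)
  qed
  moreover have "A'' u = E *\<^sub>R u"
    using supp[of u] by (simp add: A'' Quu Pu blinfun.zero_right)
  then have "approx_eigenvalue A'' E e"
    unfolding approx_eigenvalue_def using u(1) e by (intro exI[of _ u]) simp
  moreover have "norm (A'' x - A x) < \<eta>" if "x \<in> S" for x
    using S[OF that] QP[of x] \<open>\<eta> > 0\<close> by (simp add: A'')
  ultimately show "\<exists>A'\<in>selfadjoint_ball a. approx_eigenvalue A' E e \<and> (\<forall>x\<in>S. norm (A' x - A x) < \<eta>)"
    by (intro bexI[of _ A'']) (auto simp: selfadjoint_ball_def)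
qed

text \<open>Linear dependence of a set forgets repetitions; a repeated value in the sequence is
  therefore handled by a difference of two equal terms.\<close>

lemma finite_span_dependence:
  fixes v :: "nat \<Rightarrow> 'a::real_vector"
  assumes T: "finite T" and v: "\<And>j. v j \<in> span T"
  shows "\<exists>n c. (\<exists>j\<le>n. c j \<noteq> 0) \<and> (\<Sum>j\<le>n. c j *\<^sub>R v j) = 0"
proof -
  define n where "n = card T"
  show ?thesis
  proof (cases "inj_on v {..n}")
    case True
    have "card (v ` {..n}) = Suc n" using True by (simp add: card_image)
    then have "dependent (v ` {..n})"
      using independent_span_bound[OF T, of "v ` {..n}"] v by (auto simp: n_def)
    then obtain c where c: "\<exists>x\<in>v ` {..n}. c x \<noteq> 0" "(\<Sum>x\<in>v ` {..n}. c x *\<^sub>R x) = 0"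
      by (auto simp: dependent_finite)
    have "(\<Sum>j\<le>n. c (v j) *\<^sub>R v j) = 0"
      using c(2) by (simp add: sum.reindex[OF True])
    then show ?thesis using c(1) by (intro exI[of _ n] exI[of _ "\<lambda>j. c (v j)"]) auto
  next
    case False
    then obtain i j where ij: "i \<le> n" "j \<le> n" "i \<noteq> j" "v i = v j" by (auto simp: inj_on_def)
    define c :: "nat \<Rightarrow> real" where "c k = (if k = i then 1 else if k = j then - 1 else 0)" for k
    have "(\<Sum>k\<le>n. c k *\<^sub>R v k) = (\<Sum>k\<in>{i, j}. c k *\<^sub>R v k)"
      using ij by (intro sum.mono_neutral_right) (auto simp: c_def)
    also have "\<dots> = 0" using ij by (simp add: c_def)
    finally show ?thesis using ij by (intro exI[of _ n] exI[of _ c]) (auto simp: c_def)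
  qed
qed

text \<open>All powers of \<open>A\<close> applied to \<open>\<psi>\<close> stay in one
  finite-dimensional space, so they are dependent. Real coefficients require dimension over the
  reals, hence \<open>T\<close> contains i b along with each b.\<close>

lemma annihilating_poly_exists:
  fixes A :: "'a::chilbert_space \<Rightarrow>\<^sub>L 'a"
  assumes B: "finite_orthonormal B" and A: "\<And>x. ortho_proj B (A x) = A x" and \<psi>: "ortho_proj B \<psi> = \<psi>"
  shows "\<exists>m. m \<noteq> 0 \<and> poly_op m A \<psi> = 0"
proof -
  define T where "T = B \<union> (\<lambda>b. \<i> *\<^sub>C b) ` B"
  have T: "finite T" using B by (simp add: T_def finite_orthonormal_def)
  have "ortho_proj B x \<in> span T" for x
    unfolding ortho_proj_apply
  proof (rule span_sum)
    fix b assume "b \<in> B"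
    have "cinner b x *\<^sub>C b = Re (cinner b x) *\<^sub>R b + Im (cinner b x) *\<^sub>R (\<i> *\<^sub>C b)"
      by (simp add: scaleR_scaleC scaleC_scaleC flip: scaleC_add_left)
        (metis complex_eq mult.commute)
    also have "\<dots> \<in> span T"
      using \<open>b \<in> B\<close> by (intro span_add span_scale span_base) (auto simp: T_def)
    finally show "cinner b x *\<^sub>C b \<in> span T" .
  qed
  moreover have "ortho_proj B ((blinfun_apply A ^^ j) \<psi>) = (blinfun_apply A ^^ j) \<psi>" for j
    using A \<psi> by (cases j) auto
  ultimately have "(blinfun_apply A ^^ j) \<psi> \<in> span T" for j by metis
  then obtain n c where c: "\<exists>j\<le>n. c j \<noteq> 0" "(\<Sum>j\<le>n. c j *\<^sub>R (blinfun_apply A ^^ j) \<psi>) = 0"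
    using finite_span_dependence[OF T, of "\<lambda>j. (blinfun_apply A ^^ j) \<psi>"] by blast
  define m where "m = (\<Sum>j\<le>n. monom (c j) j)"
  have "coeff m j = c j" if "j \<le> n" for j
    using that by (simp add: m_def coeff_sum)
  then have "m \<noteq> 0" using c(1) by (metis coeff_0)
  moreover have "poly_op m A \<psi> = 0" using c(2) by (simp add: m_def poly_op_sum poly_op_monom)
  ultimately show ?thesis by blast
qed

text \<open>The spectral measure of \<open>\<psi>\<close> for the compression lives on the zeros of
  an annihilating polynomial \<open>m\<close>. The truncated multiple \<open>f\<close> of its square
  is large off a small neighbourhood of these finitely many zeros, while k m^2 has form 0 at
  \<open>\<psi>\<close>.\<close>

lemma concentrated_approximable:
  assumes a: "a > 0" and e: "e > 0"
  shows "strongly_approximable a (\<lambda>A :: 'a::chilbert_space \<Rightarrow>\<^sub>L 'a. concentrated a A \<psi> e)"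
  unfolding strongly_approximable_def
proof (intro ballI allI impI)
  fix A :: "'a \<Rightarrow>\<^sub>L 'a" and S :: "'a set" and \<eta> :: real
  assume "A \<in> selfadjoint_ball a" "finite S" "\<eta> > 0"
  then have A: "selfadjoint A" "norm A \<le> a" by (auto simp: selfadjoint_ball_def)
  obtain B A' where B: "finite_orthonormal B" and A': "selfadjoint A'" "norm A' \<le> norm A"
    and supp: "\<And>x. A' (ortho_proj B x) = A' x"
    and S: "\<And>x. x \<in> insert \<psi> S \<Longrightarrow> ortho_proj B x = x" "\<And>x. x \<in> insert \<psi> S \<Longrightarrow> A' x = A x"
    using compression_exists[OF A(1), of "insert \<psi> S"] \<open>finite S\<close> by blast
  have A'a: "norm A' \<le> a" using A A' by linarith
  have PA': "ortho_proj B (A' x) = A' x" for x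
    by (rule cinner_eqI) (simp add: cinner_ortho_proj selfadjointD(2)[OF A'(1)] supp)
  obtain m where m: "m \<noteq> 0" "poly_op m A' \<psi> = 0"
    using annihilating_poly_exists[OF B PA'] S(1) by blast
  \<comment> \<open>2/3 is the level above which \<open>unit_interval_poly_approx\<close> guarantees
    the value 1/2.\<close>
  define Z where "Z k = {x\<in>{-a..a}. real k * (poly m x)\<^sup>2 < 2 / 3}" for k
  have [measurable]: "poly m \<in> borel_measurable borel"
    by (intro borel_measurable_continuous_onI continuous_intros)
  have Z[measurable]: "Z k \<in> sets borel" for k unfolding Z_def by measurable
  have Zfin: "emeasure lborel (Z k) \<noteq> \<infinity>" for k
  proof -
    have "emeasure lborel (Z k) \<le> emeasure lborel {-a..a}" by (intro emeasure_mono) (auto simp: Z_def)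
    also have "\<dots> < \<infinity>" using a by simp
    finally show ?thesis by simp
  qed
  have "(\<lambda>k. emeasure lborel (Z k)) \<longlonglongrightarrow> emeasure lborel (\<Inter>k. Z k)"
  proof (rule Lim_emeasure_decseq)
    show "decseq Z"
    proof (rule decseq_SucI, rule subsetI)
      fix k x assume "x \<in> Z (Suc k)"
      moreover have "real k * (poly m x)\<^sup>2 \<le> real (Suc k) * (poly m x)\<^sup>2" by (intro mult_right_mono) auto
      ultimately show "x \<in> Z k" by (auto simp: Z_def simp del: of_nat_Suc)
    qed
  qed (use Zfin in auto)
  moreover have "(\<Inter>k. Z k) \<subseteq> {x. poly m x = 0}"
  proof (safe, rule ccontr)
    fix x assume x: "x \<in> (\<Inter>k. Z k)" "poly m x \<noteq> 0"
    then obtain k where "1 < real k * (poly m x)\<^sup>2"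
      using ex_less_of_nat_mult[of "(poly m x)\<^sup>2" 1] by auto
    moreover have "x \<in> Z k" using x by blast
    ultimately show False by (simp add: Z_def)
  qed
  then have "emeasure lborel (\<Inter>k. Z k) = 0"
    using poly_roots_finite[OF m(1)] by (intro emeasure_lborel_countable countable_finite) (rule finite_subset)
  ultimately have "\<forall>\<^sub>F k in sequentially. emeasure lborel (Z k) < ennreal e"
    using e by (intro order_tendstoD(2)[of _ 0]) auto
  then obtain k where k: "emeasure lborel (Z k) < ennreal e"
    by (auto simp: eventually_sequentially)
  define f where "f x = min 1 (real k * (poly m x)\<^sup>2)" for x
  define \<delta> where "\<delta> = min (1 / 8) (e / (4 * ((norm \<psi>)\<^sup>2 + 1)))"
  have N: "(norm \<psi>)\<^sup>2 + 1 > 0" by (simp add: add_nonneg_pos)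
  then have "0 < \<delta>" using e by (simp only: \<delta>_def min_less_iff_conj) simp
  moreover have "\<delta> \<le> 1 / 8" unfolding \<delta>_def by (rule min.cobounded1)
  ultimately have \<delta>: "0 < \<delta>" "\<delta> \<le> 1 / 8" .
  have "2 * \<delta> * (norm \<psi>)\<^sup>2 < e"
  proof -
    have "\<delta> \<le> e / (4 * ((norm \<psi>)\<^sup>2 + 1))" by (simp add: \<delta>_def)
    then have "\<delta> * (4 * ((norm \<psi>)\<^sup>2 + 1)) \<le> e" using N by (simp add: pos_le_divide_eq)
    moreover have "2 * (norm \<psi>)\<^sup>2 < 4 * ((norm \<psi>)\<^sup>2 + 1)" using N by simp
    then have "\<delta> * (2 * (norm \<psi>)\<^sup>2) < \<delta> * (4 * ((norm \<psi>)\<^sup>2 + 1))"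
      using \<delta>(1) by (rule mult_strict_left_mono)
    ultimately show ?thesis by (simp only: mult.assoc mult.left_commute)
  qed
  obtain q where q: "\<And>x. x \<in> {-a..a} \<Longrightarrow> poly q x \<in> {0..1}" "\<And>x. x \<in> {-a..a} \<Longrightarrow> poly q x \<le> f x + 2 * \<delta>"
    "\<And>x. x \<in> {-a..a} \<Longrightarrow> 2 / 3 \<le> f x \<Longrightarrow> 1 / 2 \<le> poly q x"
  proof -
    have "continuous_on {-a..a} f" unfolding f_def by (intro continuous_intros)
    moreover have "f x \<in> {0..1}" for x by (simp add: f_def)
    ultimately show ?thesis using unit_interval_poly_approx[of a f \<delta>] \<delta> that by blast
  qed
  \<comment> \<open>Truncation is undone by f \<le> k m^2, a genuine polynomial that annihilates
    \<open>\<psi>\<close>; only the approximation error survives.\<close>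
  have "poly_form A' \<psi> q \<le> poly_form A' \<psi> (smult (real k) (m * 1 * m) + smult (2 * \<delta>) 1)"
  proof (rule poly_form_mono[OF A'(1) A'a a])
    fix x assume x: "x \<in> {-a..a}"
    have "f x \<le> real k * (poly m x)\<^sup>2" by (simp add: f_def)
    then show "poly q x \<le> poly (smult (real k) (m * 1 * m) + smult (2 * \<delta>) 1) x"
      using q(2)[OF x] by (simp add: power2_eq_square)
  qed
  also have "\<dots> = 2 * \<delta> * (norm \<psi>)\<^sup>2"
    unfolding poly_form_simps poly_form_square[OF A'(1)] m(2) by simp
  finally have "poly_form A' \<psi> q < e" using \<open>2 * \<delta> * (norm \<psi>)\<^sup>2 < e\<close> by simp
  moreover have "emeasure lborel {x\<in>{-a..a}. poly q x < 1 / 2} < ennreal e"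
  proof (rule le_less_trans[OF emeasure_mono k])
    show "{x\<in>{-a..a}. poly q x < 1 / 2} \<subseteq> Z k"
      using q(3) by (fastforce simp: Z_def f_def not_le)
  qed simp
  ultimately have "concentrated a A' \<psi> e"
    unfolding concentrated_def using q(1) by blast
  moreover have "norm (A' x - A x) < \<eta>" if "x \<in> S" for x
    using S(2)[of x] that \<open>\<eta> > 0\<close> by simp
  ultimately show "\<exists>A'\<in>selfadjoint_ball a. concentrated a A' \<psi> e \<and> (\<forall>x\<in>S. norm (A' x - A x) < \<eta>)"
    using A'(1) A'a by (intro bexI[of _ A']) (auto simp: selfadjoint_ball_def)
qed

lemma sum_disjoint_support_le:
  fixes f :: "'i \<Rightarrow> real"
  assumes "finite I" "\<And>i. i \<in> I \<Longrightarrow> f i \<in> {0..1}" "\<And>i j. i \<in> I \<Longrightarrow> j \<in> I \<Longrightarrow> f i \<noteq> 0 \<Longrightarrow> f j \<noteq> 0 \<Longrightarrow> i = j"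
  shows "sum f I \<le> 1"
proof (cases "\<exists>i\<in>I. f i \<noteq> 0")
  case True
  then obtain i where i: "i \<in> I" "f i \<noteq> 0" by blast
  then have "sum f I = sum f {i}"
    using assms by (intro sum.mono_neutral_right) auto
  then show ?thesis using assms(2)[OF i(1)] by simp
qed (auto intro: order_trans[OF eq_refl[OF sum.neutral]])

text \<open>A tent function of half-width \<open>\<tau>\<close> meets at most one of the 2^m
  translates with gap 2 \<tau>, so after spreading its integral is at most the squared norm of
  \<open>\<psi>\<close> divided by 2^m, wherever the tent is centred.\<close>

lemma diffuse_approximable:
  assumes inf: "infinite_dimensional TYPE('a::chilbert_space)" and a: "a > 0" and e: "e > 0"
  shows "strongly_approximable a (\<lambda>A :: 'a \<Rightarrow>\<^sub>L 'a. diffuse a A \<psi> e)"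
  unfolding strongly_approximable_def
proof (intro ballI allI impI)
  fix A :: "'a \<Rightarrow>\<^sub>L 'a" and S :: "'a set" and \<eta> :: real
  assume "A \<in> selfadjoint_ball a" "finite S" and \<eta>: "\<eta> > 0"
  then have A: "selfadjoint A" "norm A \<le> a" by (auto simp: selfadjoint_ball_def)
  obtain B A' where B: "finite_orthonormal B" and A': "selfadjoint A'" "norm A' \<le> norm A"
    and supp: "\<And>x. A' (ortho_proj B x) = A' x"
    and S: "\<And>x. x \<in> insert \<psi> S \<Longrightarrow> ortho_proj B x = x" "\<And>x. x \<in> insert \<psi> S \<Longrightarrow> A' x = A x"
    using compression_exists[OF A(1), of "insert \<psi> S"] \<open>finite S\<close> by blast
  have A'a: "norm A' \<le> a" using A A' by linarith
  define M where "M = (\<Sum>x\<in>S. norm x)"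
  have M: "norm x \<le> M" if "x \<in> S" for x
    unfolding M_def using that \<open>finite S\<close> by (intro member_le_sum) auto
  have M0: "0 \<le> M" by (simp add: M_def sum_nonneg)
  \<comment> \<open>Contracting and spreading each move \<open>x\<close> by at most
    \<open>T * norm x\<close>, so 2 T M must stay below \<open>\<eta>\<close>; the added 1 makes
    this strict and covers M = 0. The bound a/2 keeps the contraction factor positive.\<close>
  define T where "T = min (a / 2) (\<eta> / (2 * M + 1))"
  have T: "0 < T" "T < a" using a \<eta> M0 by (auto simp: T_def)
  have TM: "2 * T * norm x < \<eta>" if "x \<in> S" for x
  proof -
    have "T \<le> \<eta> / (2 * M + 1)" by (simp add: T_def)
    then have le: "T * (2 * M + 1) \<le> \<eta>" using M0 by (simp add: pos_le_divide_eq)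
    have "2 * T * norm x \<le> 2 * T * M" using M[OF that] T by (intro mult_left_mono) auto
    also have "\<dots> < T * (2 * M + 1)" using T by (simp add: algebra_simps)
    finally show ?thesis using le by simp
  qed
  obtain m' where m': "(1 / 2) ^ m' < e / ((norm \<psi>)\<^sup>2 + 1)"
    using real_arch_pow_inv[of "e / ((norm \<psi>)\<^sup>2 + 1)" "1 / 2"] e by (auto simp: add_nonneg_pos)
  \<comment> \<open>Two additional doublings bring \<open>\<delta>\<close> below down to 1/8 and
    absorb the factor 2 of the final estimate.\<close>
  define m where "m = Suc (Suc m')"
  have m: "2 * (norm \<psi>)\<^sup>2 / 2 ^ m < e"
  proof -
    have "2 * (norm \<psi>)\<^sup>2 / 2 ^ m \<le> (norm \<psi>)\<^sup>2 * (1 / 2) ^ m'"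
      by (simp add: m_def power_one_over field_simps)
    also have "\<dots> \<le> ((norm \<psi>)\<^sup>2 + 1) * (1 / 2) ^ m'" by (intro mult_right_mono) auto
    also have "\<dots> < e"
      using m' by (simp add: pos_less_divide_eq add_nonneg_pos mult.commute)
    finally show ?thesis .
  qed
  define \<tau> where "\<tau> = T / 2 ^ m"
  have \<tau>: "0 < \<tau>" "2 ^ m * \<tau> = T" using T by (auto simp: \<tau>_def)
  define A1 where "A1 = (1 - T / a) *\<^sub>R A'"
  have A1: "A1 x = (1 - T / a) *\<^sub>R A' x" for x by (simp add: A1_def blinfun.scaleR_left)
  have sa1: "selfadjoint A1"
    by (rule selfadjointI) (simp add: A1 cinner_scaleR_left cinner_scaleR_right selfadjointD(2)[OF A'(1)])
  have "norm A1 = (1 - T / a) * norm A'" using T by (simp add: A1_def)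
  also have "\<dots> \<le> (1 - T / a) * a" using T by (intro mult_left_mono A'a) auto
  also have "\<dots> = a - T" using a by (simp add: field_simps)
  finally have n1: "norm A1 \<le> a - T" .
  define s where "s k = \<tau> * (2 * real k + 1 - 2 ^ m)" for k
  obtain A2 where A2: "selfadjoint A2" "norm A2 \<le> norm A1 + T"
    and near: "\<And>x. ortho_proj B x = x \<Longrightarrow> norm (A2 x - A1 x) \<le> T * norm x"
    and form: "\<And>x p. ortho_proj B x = x \<Longrightarrow> poly_form A2 x p =
      (\<Sum>k<2 ^ m. poly_form A1 x (p \<circ>\<^sub>p [:s k, 1:])) / 2 ^ m"
  proof -
    have "A1 (ortho_proj B x) = A1 x" for x by (simp add: A1 supp)
    then show ?thesis
      using spread_operator[OF inf B sa1 _ less_imp_le[OF \<tau>(1)], of m] that unfolding \<tau>(2) s_def by blast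
  qed
  have A2a: "norm A2 \<le> a" using A2(2) n1 by simp
  have "norm (A2 x - A x) < \<eta>" if x: "x \<in> S" for x
  proof -
    have Ax: "A x = A' x" "ortho_proj B x = x" using S x by auto
    have "norm (A1 x - A' x) = T / a * norm (A' x)"
      using T a by (simp add: A1 scaleR_left_diff_distrib)
    also have "\<dots> \<le> T / a * (a * norm x)"
      using T a norm_blinfun_le[OF A'a, of x] by (intro mult_left_mono) auto
    also have "\<dots> = T * norm x" using a by simp
    finally have "norm (A2 x - A' x) \<le> T * norm x + T * norm x"
      using near[OF Ax(2)] norm_triangle_ineq[of "A2 x - A1 x" "A1 x - A' x"] by simp
    then show ?thesis using TM[OF x] Ax(1) by simp
  qed
  moreover have "diffuse a A2 \<psi> e"
  proof -
    define f where "f c x = max 0 (1 - \<bar>x - c\<bar> / \<tau>)" for c x :: real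
    have f01: "f c x \<in> {0..1}" for c x using \<tau>(1) by (simp add: f_def)
    \<comment> \<open>The errors 2 \<delta> of the 2^m translates add up to exactly 1, as much as
      the tents themselves contribute at most.\<close>
    define \<delta> :: real where "\<delta> = 1 / 2 ^ Suc m"
    have \<delta>: "0 < \<delta>" "\<delta> \<le> 1 / 8" by (auto simp: \<delta>_def m_def field_simps)
    have "\<exists>p. \<forall>x\<in>{-a..a}. poly p x \<in> {0..1} \<and> poly p x \<le> f c x + 2 * \<delta> \<and> (2 / 3 \<le> f c x \<longrightarrow> 1 / 2 \<le> poly p x)" for c
    proof -
      have "continuous_on {-a..a} (f c)"
        unfolding f_def using \<tau>(1) by (intro continuous_intros) auto
      then show ?thesis using unit_interval_poly_approx[of a "f c" \<delta>] f01 \<delta> by blast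
    qed
    then obtain p where p: "\<forall>c. \<forall>x\<in>{-a..a}. poly (p c) x \<in> {0..1} \<and> poly (p c) x \<le> f c x + 2 * \<delta> \<and>
        (2 / 3 \<le> f c x \<longrightarrow> 1 / 2 \<le> poly (p c) x)"
      by metis
    have small: "poly_form A2 \<psi> (p c) < e" for c
    proof -
      have "poly_form A2 \<psi> (p c) = poly_form A1 \<psi> (\<Sum>k<2 ^ m. p c \<circ>\<^sub>p [:s k, 1:]) / 2 ^ m"
        using form[of \<psi> "p c"] S(1) by (simp add: poly_form_simps)
      also have "poly_form A1 \<psi> (\<Sum>k<2 ^ m. p c \<circ>\<^sub>p [:s k, 1:]) \<le> poly_form A1 \<psi> (smult 2 1)"
      proof (rule poly_form_mono[OF sa1 n1])
        show "0 < a - T" using T by simp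
        fix y assume y: "y \<in> {- (a - T)..a - T}"
        \<comment> \<open>\<open>p c\<close> is controlled on {-a..a} only. The contraction to norm
          at most a - T was made so that the translates stay there.\<close>
        have in_a: "y + s k \<in> {-a..a}" if "k < 2 ^ m" for k
        proof -
          have k: "real k + 1 \<le> 2 ^ m" using that by (metis Suc_leI of_nat_Suc of_nat_le_iff of_nat_numeral of_nat_power add.commute)
          have "\<bar>s k\<bar> = \<tau> * \<bar>2 * real k + 1 - 2 ^ m\<bar>"
            using \<tau>(1) by (simp add: s_def abs_mult)
          also have "\<dots> \<le> \<tau> * 2 ^ m"
            using \<tau>(1) k by (intro mult_left_mono abs_leI) auto
          also have "\<dots> = T" using \<tau>(2) by (simp add: mult.commute)
          finally show ?thesis using y by (auto simp: abs_le_iff)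
        qed
        have "(\<Sum>k<2 ^ m. poly (p c) (y + s k)) \<le> (\<Sum>k<2 ^ m. f c (y + s k) + 2 * \<delta>)"
          using p in_a by (intro sum_mono) blast
        also have "\<dots> = (\<Sum>k<2 ^ m. f c (y + s k)) + 1"
          by (simp add: sum.distrib \<delta>_def)
        also have "(\<Sum>k<2 ^ m. f c (y + s k)) \<le> 1"
        proof (rule sum_disjoint_support_le[OF _ f01])
          fix k l assume "f c (y + s k) \<noteq> 0" "f c (y + s l) \<noteq> 0"
          then have "\<bar>y + s k - c\<bar> < \<tau>" "\<bar>y + s l - c\<bar> < \<tau>"
            using \<tau>(1) by (auto simp: f_def max_def split: if_splits)
          then have "\<bar>s k - s l\<bar> < 2 * \<tau>" by linarith
          moreover have "s k - s l = 2 * \<tau> * (real k - real l)" by (simp add: s_def algebra_simps)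
          ultimately have "\<bar>real k - real l\<bar> < 1" using \<tau>(1) by (simp add: abs_mult)
          then show "k = l" by linarith
        qed simp
        finally show "poly (\<Sum>k<2 ^ m. p c \<circ>\<^sub>p [:s k, 1:]) y \<le> poly (smult 2 1) y"
          by (simp add: poly_sum poly_pcompose add.commute)
      qed
      also have "poly_form A1 \<psi> (smult 2 1) = 2 * (norm \<psi>)\<^sup>2" by (simp only: poly_form_simps)
      finally show ?thesis using m by (simp add: divide_right_mono)
    qed
    \<comment> \<open>At distance below \<tau>/3 from its centre a tent exceeds 2/3, the level
      required by the approximation; compactness makes finitely many tents suffice.\<close>
    obtain C where C: "finite C" "{-a..a} \<subseteq> (\<Union>c\<in>C. ball c (\<tau> / 3))"
      using compact_Icc[of "-a" a] \<tau>(1) unfolding compact_eq_totally_bounded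
      by (metis divide_pos_pos zero_less_numeral)
    have "\<exists>q\<in>p ` C. 1 / 2 \<le> poly q x" if x: "x \<in> {-a..a}" for x
    proof -
      obtain c where c: "c \<in> C" "\<bar>x - c\<bar> < \<tau> / 3" using C(2) x by (auto simp: dist_real_def abs_minus_commute)
      then have "2 / 3 \<le> f c x" using \<tau>(1) by (simp add: f_def field_simps)
      then show ?thesis using p x c(1) by blast
    qed
    then show ?thesis
      unfolding diffuse_def using C(1) p small by (intro exI[of _ "p ` C"]) blast
  qed
  ultimately show "\<exists>A'\<in>selfadjoint_ball a. diffuse a A' \<psi> e \<and> (\<forall>x\<in>S. norm (A' x - A x) < \<eta>)"
    using A2(1) A2a by (intro bexI[of _ A2]) (auto simp: selfadjoint_ball_def)
qed

section \<open>The strong topology on a ball of selfadjoint operators\<close>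

abbreviation sot_ball :: "real \<Rightarrow> ('a::chilbert_space \<Rightarrow>\<^sub>L 'a) topology" where
  "sot_ball a \<equiv> subtopology strong_operator_topology (selfadjoint_ball a)"

lemma topspace_sot_ball: "topspace (sot_ball a) = selfadjoint_ball a"
  by (simp add: strong_operator_topology_topspace)

lemma continuous_map_sot_apply: "continuous_map (sot_ball a) euclidean (\<lambda>A. blinfun_apply A x)"
  by (intro continuous_map_from_subtopology strong_operator_topology_continuous_evaluation)

text \<open>The strong topology is pulled back from the product topology, whose basic open sets
  restrict finitely many coordinates; one radius then serves for all of them.\<close>

lemma sot_ball_neighbourhood:
  fixes A :: "'a::chilbert_space \<Rightarrow>\<^sub>L 'a"
  assumes "openin (sot_ball a) U" "A \<in> U"
  shows "\<exists>S e. finite S \<and> e > 0 \<and> (\<forall>B\<in>selfadjoint_ball a. (\<forall>x\<in>S. norm (blinfun_apply B x - A x) < e) \<longrightarrow> B \<in> U)"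
proof -
  obtain V where "openin strong_operator_topology V" and UV: "U = V \<inter> selfadjoint_ball a"
    using assms(1) by (auto simp: openin_subtopology)
  then obtain W :: "('a \<Rightarrow> 'a) set" where "open W" and VW: "V = blinfun_apply -` W"
    by (auto simp: strong_operator_topology_def openin_pullback_topology)
  then have "openin (product_topology (\<lambda>_. euclidean) UNIV) W" by (simp add: open_fun_def)
  moreover have "blinfun_apply A \<in> W" using assms(2) UV VW by simp
  ultimately have "\<exists>X. blinfun_apply A \<in> Pi\<^sub>E UNIV X \<and> (\<forall>i. openin euclidean (X i)) \<and>
      finite {i. X i \<noteq> topspace euclidean} \<and> Pi\<^sub>E UNIV X \<subseteq> W"
    by (rule product_topology_open_contains_basis)
  then obtain X where X: "\<And>x. A x \<in> X x" "\<And>x. open (X x)" "finite {x. X x \<noteq> UNIV}" "Pi\<^sub>E UNIV X \<subseteq> W"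
    by (auto simp: PiE_iff)
  have "\<exists>r>0. ball (A x) r \<subseteq> X x" for x
    using X(1,2) open_contains_ball by metis
  then obtain r where r: "\<And>x. r x > 0" "\<And>x. ball (A x) (r x) \<subseteq> X x" by metis
  define S where "S = {x. X x \<noteq> UNIV}"
  \<comment> \<open>The element 1 provides a radius when no vector is restricted.\<close>
  define e where "e = Min (insert 1 (r ` S))"
  have e: "e > 0" "\<And>x. x \<in> S \<Longrightarrow> e \<le> r x"
    using X(3) r(1) by (auto simp: e_def S_def)
  have "B \<in> U" if B: "B \<in> selfadjoint_ball a" "\<forall>x\<in>S. norm (blinfun_apply B x - A x) < e" for B
  proof -
    have "B x \<in> X x" for x
    proof (cases "x \<in> S")
      case True
      then have "B x \<in> ball (A x) (r x)"
        using B(2) e(2) by (fastforce simp: dist_norm norm_minus_commute)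
      then show ?thesis using r(2) by blast
    qed (simp add: S_def)
    then have "blinfun_apply B \<in> W" using X(4) by (auto simp: PiE_iff)
    then show ?thesis using UV VW B(1) by simp
  qed
  then show ?thesis using X(3) e(1) unfolding S_def[symmetric] by blast
qed

lemma strongly_approximable_dense:
  assumes "strongly_approximable a C"
  shows "sot_ball a closure_of {A \<in> selfadjoint_ball a. C A} = topspace (sot_ball a)"
  unfolding dense_intersects_open
proof (intro allI impI, elim conjE)
  fix U :: "('a \<Rightarrow>\<^sub>L 'a) set" assume U: "openin (sot_ball a) U" "U \<noteq> {}"
  then obtain A where A: "A \<in> U" "A \<in> selfadjoint_ball a"
    using openin_subset[OF U(1)] by (auto simp: topspace_sot_ball)
  obtain S e where "finite S" "e > 0" "\<forall>B\<in>selfadjoint_ball a. (\<forall>x\<in>S. norm (blinfun_apply B x - A x) < e) \<longrightarrow> B \<in> U"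
    using sot_ball_neighbourhood[OF U(1) A(1)] by blast
  then show "{A \<in> selfadjoint_ball a. C A} \<inter> U \<noteq> {}"
    using assms A(2) unfolding strongly_approximable_def by blast
qed

text \<open>Along Horner's scheme the inner vector \<open>v A\<close> varies with \<open>A\<close>.
  The uniform norm bound splits the change into a |v A - v A0| plus |(A - A0) (v A0)|, both tending
  to 0.\<close>

lemma continuous_map_poly_op:
  "continuous_map (sot_ball a) euclidean (\<lambda>A. poly_op p A \<psi>)"
proof (induction p)
  case 0
  then show ?case by simp
next
  case (pCons c p)
  have "continuous_map (sot_ball a) euclidean (\<lambda>A. blinfun_apply A (poly_op p A \<psi>))"
    unfolding continuous_map_atin
  proof (intro ballI, unfold limitin_canonical_iff)
    fix A0 :: "'a \<Rightarrow>\<^sub>L 'a" assume A0: "A0 \<in> topspace (sot_ball a)"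
    let ?F = "atin (sot_ball a) A0"
    define v where "v A = poly_op p A \<psi>" for A
    define g where "g A = a * norm (v A - v A0) + norm (blinfun_apply A (v A0) - A0 (v A0))" for A
    have "(v \<longlongrightarrow> v A0) ?F"
      using limitin_continuous_map[OF pCons(2) A0 refl] unfolding limitin_canonical_iff v_def .
    moreover have "((\<lambda>A. blinfun_apply A (v A0)) \<longlongrightarrow> A0 (v A0)) ?F"
      using limitin_continuous_map[OF continuous_map_sot_apply A0 refl] unfolding limitin_canonical_iff .
    ultimately have "(g \<longlongrightarrow> a * 0 + 0) ?F"
      unfolding g_def by (intro tendsto_add tendsto_mult_left tendsto_norm_zero LIM_zero)
    then have g: "(g \<longlongrightarrow> 0) ?F" by simp
    have le: "norm (blinfun_apply A (v A) - A0 (v A0)) \<le> g A" if "A \<in> topspace (sot_ball a)" for A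
    proof -
      have "norm (A (v A - v A0)) \<le> a * norm (v A - v A0)"
        using that by (intro norm_blinfun_le) (simp add: selfadjoint_ball_def)
      then show ?thesis
        using norm_triangle_ineq[of "A (v A - v A0)" "A (v A0) - A0 (v A0)"]
        by (simp add: blinfun.diff_right g_def)
    qed
    have "\<forall>\<^sub>F A in ?F. norm (blinfun_apply A (v A) - A0 (v A0)) \<le> g A"
      unfolding eventually_atin
      by (intro disjI2 exI[of _ "topspace (sot_ball a)"] conjI openin_topspace A0 ballI) (rule le, erule DiffD1)
    then have "((\<lambda>A. blinfun_apply A (v A) - A0 (v A0)) \<longlongrightarrow> 0) ?F"
      by (rule Lim_null_comparison[OF _ g])
    then show "((\<lambda>A. blinfun_apply A (poly_op p A \<psi>)) \<longlongrightarrow> A0 (poly_op p A0 \<psi>)) ?F"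
      unfolding v_def by (rule LIM_zero_cancel)
  qed
  then show ?case
    unfolding poly_op_pCons by (intro continuous_map_add) simp_all
qed

lemma continuous_map_bounded_linear:
  assumes "bounded_linear f" "continuous_map X euclidean g"
  shows "continuous_map X euclidean (\<lambda>x. f (g x))"
proof -
  have "continuous_map euclidean euclidean f"
    using linear_continuous_on[OF assms(1)] by simp
  from continuous_map_compose[OF assms(2) this] show ?thesis by (simp add: comp_def)
qed

lemma continuous_map_poly_form: "continuous_map (sot_ball a) euclideanreal (\<lambda>A. poly_form A \<psi> p)"
  unfolding poly_form_def
  by (intro continuous_map_bounded_linear[OF bounded_linear_compose[OF bounded_linear_Re cinner.bounded_linear_right]]
      continuous_map_poly_op)

section \<open>Openness of the three conditions\<close>

lemma openin_poly_form_less: "openin (sot_ball a) {A \<in> selfadjoint_ball a. poly_form A \<psi> p < e}"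
  using openin_continuous_map_preimage[OF continuous_map_poly_form, of "{..<e}" a \<psi> p]
  by (simp add: strong_operator_topology_topspace)

lemma openin_concentrated: "openin (sot_ball a) {A \<in> selfadjoint_ball a. concentrated a A \<psi> e}"
proof -
  have "{A \<in> selfadjoint_ball a. concentrated a A \<psi> e} =
      (\<Union>p\<in>{p. (\<forall>x\<in>{-a..a}. poly p x \<in> {0..1}) \<and> emeasure lborel {x\<in>{-a..a}. poly p x < 1 / 2} < ennreal e}.
        {A \<in> selfadjoint_ball a. poly_form A \<psi> p < e})"
    unfolding concentrated_def by blast
  then show ?thesis by (auto intro!: openin_poly_form_less)
qed

text \<open>Only the forms of the polynomials depend on \<open>A\<close>. Because \<open>F\<close>
  is finite, these strict inequalities cut out an open set, and the choice of \<open>F\<close> is a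
  union.\<close>

lemma openin_diffuse: "openin (sot_ball a) {A \<in> selfadjoint_ball a. diffuse a A \<psi> e}"
proof -
  have *: "openin (sot_ball a) {A \<in> selfadjoint_ball a. \<forall>p\<in>F. poly_form A \<psi> p < e}" if "finite F" for F
    using that
  proof (induction F)
    case empty
    then show ?case using openin_topspace[of "sot_ball a"] by (simp add: strong_operator_topology_topspace)
  next
    case (insert p F)
    have "{A \<in> selfadjoint_ball a. \<forall>p\<in>insert p F. poly_form A \<psi> p < e} =
      {A \<in> selfadjoint_ball a. poly_form A \<psi> p < e} \<inter> {A \<in> selfadjoint_ball a. \<forall>p\<in>F. poly_form A \<psi> p < e}"
      by blast
    then show ?case
      by (simp only:) (intro openin_Int openin_poly_form_less insert.IH)
  qed
  have "{A \<in> selfadjoint_ball a. diffuse a A \<psi> e} =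
      (\<Union>F\<in>{F. finite F \<and> (\<forall>p\<in>F. \<forall>x\<in>{-a..a}. poly p x \<in> {0..1}) \<and> (\<forall>x\<in>{-a..a}. \<exists>p\<in>F. 1 / 2 \<le> poly p x)}.
        {A \<in> selfadjoint_ball a. \<forall>p\<in>F. poly_form A \<psi> p < e})"
    unfolding diffuse_def by blast
  then show ?thesis by (auto intro!: *)
qed

lemma openin_approx_eigenvalue: "openin (sot_ball a) {A \<in> selfadjoint_ball a. approx_eigenvalue A E e}"
proof -
  have "openin (sot_ball a) {A \<in> selfadjoint_ball a. norm (blinfun_apply A \<phi> - E *\<^sub>R \<phi>) < e * norm \<phi>}" for \<phi> :: 'a
  proof -
    have "continuous_map (sot_ball a) euclideanreal (\<lambda>A. norm (A \<phi> - E *\<^sub>R \<phi>))"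
      by (intro continuous_map_norm continuous_map_diff continuous_map_sot_apply) simp
    from openin_continuous_map_preimage[OF this, of "{..<e * norm \<phi>}"] show ?thesis
      by (simp add: strong_operator_topology_topspace)
  qed
  then have "openin (sot_ball a) (\<Union>\<phi>::'a. {A \<in> selfadjoint_ball a. norm (blinfun_apply A \<phi> - E *\<^sub>R \<phi>) < e * norm \<phi>})"
    by (intro openin_Union) auto
  moreover have "{A \<in> selfadjoint_ball a. approx_eigenvalue A E e} =
      (\<Union>\<phi>::'a. {A \<in> selfadjoint_ball a. norm (blinfun_apply A \<phi> - E *\<^sub>R \<phi>) < e * norm \<phi>})"
    unfolding approx_eigenvalue_def by blast
  ultimately show ?thesis by (simp only:)
qed

text \<open>The Lipschitz bound extends \<open>z\<close> continuously, and symmetry survives the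
  limit along sequences in \<open>D\<close>. Linearity is then tested against arbitrary vectors,
  where symmetry moves the extension to the other side.\<close>

lemma selfadjoint_extension:
  fixes z :: "'a::chilbert_space \<Rightarrow> 'a"
  assumes D: "closure D = UNIV" and a: "0 \<le> a"
    and lip: "\<And>d e. d \<in> D \<Longrightarrow> e \<in> D \<Longrightarrow> norm (z d - z e) \<le> a * norm (d - e)"
    and sym: "\<And>d e. d \<in> D \<Longrightarrow> e \<in> D \<Longrightarrow> cinner d (z e) = cinner (z d) e"
  shows "\<exists>A\<in>selfadjoint_ball a. \<forall>d\<in>D. blinfun_apply A d = z d"
proof -
  have "uniformly_continuous_on D z"
  proof (rule lipschitz_on_uniformly_continuous)
    show "a-lipschitz_on D z" using lip a by (intro lipschitz_onI) (auto simp: dist_norm)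
  qed
  then obtain h where "uniformly_continuous_on (closure D) h" and hz: "\<And>x. x \<in> D \<Longrightarrow> z x = h x"
    by (rule uniformly_continuous_on_extension_on_closure) (rule that)
  then have h: "continuous_on UNIV h"
    using D uniformly_continuous_imp_continuous by metis
  have "\<exists>\<sigma>. (\<forall>n. \<sigma> n \<in> D) \<and> \<sigma> \<longlonglongrightarrow> x" for x
    using D closure_sequential[of x D] by auto
  then obtain \<sigma> where \<sigma>: "\<And>x n. \<sigma> x n \<in> D" "\<And>x. \<sigma> x \<longlonglongrightarrow> x" by metis
  have h\<sigma>: "(\<lambda>n. h (\<sigma> x n)) \<longlonglongrightarrow> h x" for x
    by (rule continuous_on_tendsto_compose[OF h \<sigma>(2)]) auto
  have sym': "cinner x (h y) = cinner (h x) y" for x y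
  proof (rule LIMSEQ_unique)
    show "(\<lambda>n. cinner (\<sigma> x n) (h (\<sigma> y n))) \<longlonglongrightarrow> cinner x (h y)"
      by (intro cinner.tendsto \<sigma>(2) h\<sigma>)
    have "cinner (\<sigma> x n) (h (\<sigma> y n)) = cinner (h (\<sigma> x n)) (\<sigma> y n)" for n
      using sym[OF \<sigma>(1) \<sigma>(1)] hz[OF \<sigma>(1)] by simp
    then show "(\<lambda>n. cinner (\<sigma> x n) (h (\<sigma> y n))) \<longlonglongrightarrow> cinner (h x) y"
      by (simp only:) (intro cinner.tendsto \<sigma>(2) h\<sigma>)
  qed
  have "h (x + y) = h x + h y" for x y
    by (rule cinner_eqI) (simp add: sym' cinner_add_right)
  moreover have "h (r *\<^sub>R x) = r *\<^sub>R h x" for r x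
    by (rule cinner_eqI) (simp add: sym' cinner_scaleR_right)
  moreover have bd: "norm (h x) \<le> norm x * a" for x
  proof -
    have "norm (h x - h y) \<le> a * norm (x - y)" for y
    proof (rule LIMSEQ_le)
      show "(\<lambda>n. norm (h (\<sigma> x n) - h (\<sigma> y n))) \<longlonglongrightarrow> norm (h x - h y)"
        by (intro tendsto_intros h\<sigma>)
      show "(\<lambda>n. a * norm (\<sigma> x n - \<sigma> y n)) \<longlonglongrightarrow> a * norm (x - y)"
        by (intro tendsto_intros \<sigma>(2))
      show "\<exists>N. \<forall>n\<ge>N. norm (h (\<sigma> x n) - h (\<sigma> y n)) \<le> a * norm (\<sigma> x n - \<sigma> y n)"
        using lip[OF \<sigma>(1) \<sigma>(1)] hz[OF \<sigma>(1)] by simp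
    qed
    moreover have "h 0 = 0" by (rule cinner_eqI) (simp add: sym')
    ultimately show ?thesis by (metis diff_zero mult.commute)
  qed
  ultimately have "bounded_linear h" by (intro bounded_linear_intro) auto
  then have hB: "blinfun_apply (Blinfun h) = h" by (rule bounded_linear_Blinfun_apply)
  have "selfadjoint (Blinfun h)" by (rule selfadjointI) (simp add: hB sym')
  moreover have "norm (Blinfun h) \<le> a"
    using a bd by (intro norm_blinfun_bound) (auto simp: hB mult.commute)
  ultimately show ?thesis
    using hz by (intro bexI[of _ "Blinfun h"]) (auto simp: hB selfadjoint_ball_def)
qed

text \<open>Restriction to a countable dense set \<open>D\<close> identifies the ball with a closed subset of the
  product space: the Lipschitz condition and symmetry on \<open>D\<close> already force the continuous extension
  to be linear.\<close>

lemma completely_metrizable_sot_ball: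
  assumes sep: "separable_space (euclidean :: 'h::chilbert_space topology)" and a: "0 \<le> a"
  shows "completely_metrizable_space (sot_ball a :: ('h \<Rightarrow>\<^sub>L 'h) topology)"
proof -
  let ?X = "selfadjoint_ball a :: ('h \<Rightarrow>\<^sub>L 'h) set"
  obtain D :: "'h set" where D: "countable D" "closure D = UNIV"
    using sep by (auto simp: separable_space_def)
  define P where "P = product_topology (\<lambda>_. euclidean :: 'h topology) D"
  have P: "completely_metrizable_space P"
    unfolding P_def completely_metrizable_space_product_topology
    by (intro disjI2 conjI ballI completely_metrizable_space_euclidean countable_subset[OF _ D(1)]) blast
  define Z where "Z = (\<Inter>(d, e)\<in>D \<times> D. {z \<in> topspace P. norm (z d - z e) \<in> {..a * norm (d - e)}} \<inter>
    {z \<in> topspace P. cinner d (z e) - cinner (z d) e \<in> {0}})"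
  have proj: "continuous_map P euclidean (\<lambda>z. z d)" if "d \<in> D" for d
    unfolding P_def using that by (rule continuous_map_product_projection)
  have "closedin P Z"
    unfolding Z_def
  proof (rule closedin_INT)
    show "D \<times> D \<noteq> {}" using D(2) by auto
    fix x assume "x \<in> D \<times> D"
    then obtain d e where x: "x = (d, e)" and d: "d \<in> D" and e: "e \<in> D" by auto
    have "continuous_map P euclideanreal (\<lambda>z. norm (z d - z e))"
      by (intro continuous_map_norm continuous_map_diff proj d e)
    moreover have "continuous_map P euclidean (\<lambda>z. cinner d (z e) - cinner (z d) e)"
      by (intro continuous_map_diff continuous_map_bounded_linear[OF cinner.bounded_linear_right]
          continuous_map_bounded_linear[OF cinner.bounded_linear_left] proj d e)
    ultimately have "closedin P ({z \<in> topspace P. norm (z d - z e) \<in> {..a * norm (d - e)}} \<inter>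
      {z \<in> topspace P. cinner d (z e) - cinner (z d) e \<in> {0}})"
      by (intro closedin_Int closedin_continuous_map_preimage) auto
    then show "closedin P (case x of (d, e) \<Rightarrow> {z \<in> topspace P. norm (z d - z e) \<in> {..a * norm (d - e)}} \<inter>
      {z \<in> topspace P. cinner d (z e) - cinner (z d) e \<in> {0}})"
      by (simp only: x prod.case)
  qed
  have Z: "z \<in> topspace P" "d \<in> D \<Longrightarrow> e \<in> D \<Longrightarrow> norm (z d - z e) \<le> a * norm (d - e)"
    "d \<in> D \<Longrightarrow> e \<in> D \<Longrightarrow> cinner d (z e) = cinner (z d) e" if "z \<in> Z" for z d e
  proof -
    have "D \<noteq> {}" using D(2) by auto
    then show "z \<in> topspace P" using that by (auto simp: Z_def)
  qed (use that in \<open>auto simp: Z_def\<close>)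
  have "\<exists>A\<in>?X. \<forall>d\<in>D. blinfun_apply A d = z d" if "z \<in> Z" for z
    by (rule selfadjoint_extension[OF D(2) a]) (use Z[OF that] in auto)
  then obtain g where g: "\<And>z. z \<in> Z \<Longrightarrow> g z \<in> ?X" "\<And>z d. z \<in> Z \<Longrightarrow> d \<in> D \<Longrightarrow> blinfun_apply (g z) d = z d"
    by metis
  define r where "r A = restrict (blinfun_apply A) D" for A :: "'h \<Rightarrow>\<^sub>L 'h"
  have rZ: "r A \<in> Z" if A: "A \<in> ?X" for A
  proof -
    have "norm (A d - A e) \<le> a * norm (d - e)" for d e
      using A norm_blinfun_le[of A a "d - e"] by (simp add: selfadjoint_ball_def blinfun.diff_right)
    moreover have "cinner d (A e) = cinner (A d) e" for d e
      using A by (simp add: selfadjoint_ball_def selfadjoint_def)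
    ultimately show ?thesis by (auto simp: Z_def r_def P_def)
  qed
  have gr: "g (r A) = A" if A: "A \<in> ?X" for A
  proof (rule blinfun_eqI)
    fix x
    have "D \<subseteq> {x. g (r A) x = A x}" using g(2)[OF rZ[OF A]] by (auto simp: r_def)
    moreover have "closed {x. g (r A) x = A x}"
      by (intro closed_Collect_eq linear_continuous_on blinfun.bounded_linear_right)
    ultimately have "closure D \<subseteq> {x. g (r A) x = A x}" by (rule closure_minimal)
    then show "g (r A) x = A x" using D(2) by auto
  qed
  have rg: "r (g z) = z" if "z \<in> Z" for z
    using Z(1)[OF that] g(2)[OF that] by (auto simp: r_def P_def PiE_def extensional_def fun_eq_iff)
  have c1: "continuous_map (sot_ball a) (subtopology P Z) r"
    unfolding P_def continuous_map_in_subtopology continuous_map_componentwise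
    using rZ continuous_map_sot_apply by (auto simp: strong_operator_topology_topspace r_def)
  have "continuous_map (subtopology P Z) euclidean (\<lambda>z. blinfun_apply (g z) x)" for x
    unfolding continuous_map_atin
  proof (intro ballI, unfold limitin_canonical_iff, rule tendstoI)
    fix z0 and e :: real assume z0: "z0 \<in> topspace (subtopology P Z)" and e: "e > 0"
    then have z0Z: "z0 \<in> Z" by simp
    \<comment> \<open>All \<open>g z\<close> share the Lipschitz constant \<open>a\<close>, so
      control at one \<open>d\<close> near \<open>x\<close> gives control at \<open>x\<close>. The
      constant a + 1 avoids division by zero for a = 0.\<close>
    have near: "norm (g z x - g z d) \<le> (a + 1) * norm (x - d)" if "z \<in> Z" for z d
    proof -
      have "norm (g z x - g z d) \<le> a * norm (x - d)"
        using g(1)[OF that] norm_blinfun_le[of "g z" a "x - d"]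
        by (simp add: selfadjoint_ball_def blinfun.diff_right)
      also have "\<dots> \<le> (a + 1) * norm (x - d)" by (intro mult_right_mono) auto
      finally show ?thesis .
    qed
    have "e / (3 * (a + 1)) > 0" using a e by simp
    moreover have "x \<in> closure D" using D(2) by simp
    ultimately obtain d where d: "d \<in> D" "dist d x < e / (3 * (a + 1))"
      using closure_approachable by metis
    then have nd: "(a + 1) * norm (x - d) < e / 3"
      using a by (simp add: dist_norm norm_minus_commute field_simps)
    have "((\<lambda>z. z d) \<longlongrightarrow> z0 d) (atin (subtopology P Z) z0)"
      using continuous_map_from_subtopology[OF proj[OF d(1)], of Z] z0
      unfolding continuous_map_atin by simp
    then have "\<forall>\<^sub>F z in atin (subtopology P Z) z0. dist (z d) (z0 d) < e / 3"
      by (rule tendstoD) (use e in simp)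
    moreover have "\<forall>\<^sub>F z in atin (subtopology P Z) z0. z \<in> Z"
      unfolding eventually_atin using z0 openin_topspace[of "subtopology P Z"] by auto
    ultimately show "\<forall>\<^sub>F z in atin (subtopology P Z) z0. dist (g z x) (g z0 x) < e"
    proof eventually_elim
      case (elim z)
      have "dist (g z d) (g z0 d) < e / 3" using elim g(2) z0Z d(1) by simp
      moreover have "dist (g z x) (g z d) < e / 3" "dist (g z0 x) (g z0 d) < e / 3"
        using near[OF elim(2), of d] near[OF z0Z, of d] nd by (auto simp: dist_norm)
      ultimately show ?case
        using dist_triangle[of "g z x" "g z0 x" "g z d"] dist_triangle[of "g z d" "g z0 x" "g z0 d"]
        by (simp add: dist_commute)
    qed
  qed
  then have c2: "continuous_map (subtopology P Z) (sot_ball a) g"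
    unfolding continuous_map_in_subtopology continuous_on_strong_operator_topo_iff_coordinatewise
    using g(1) by auto
  have "homeomorphic_maps (sot_ball a) (subtopology P Z) r g"
    unfolding homeomorphic_maps_def using c1 c2 gr rg by (auto simp: topspace_sot_ball)
  then have "(sot_ball a :: ('h \<Rightarrow>\<^sub>L 'h) topology) homeomorphic_space subtopology P Z"
    unfolding homeomorphic_space_def by blast
  then show ?thesis
    using completely_metrizable_space_closedin[OF P \<open>closedin P Z\<close>] homeomorphic_completely_metrizable_space
    by blast
qed

section \<open>Intersection of the dense open conditions\<close>

theorem theorem3:
  fixes a :: real
  assumes "separable_space (euclidean :: 'h::chilbert_space topology)"
    and "infinite_dimensional TYPE('h)"
    and "a > 0"
  shows "\<exists>G :: ('h \<Rightarrow>\<^sub>L 'h) set. G \<subseteq> selfadjoint_ball a \<and>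
    gdelta_in (subtopology strong_operator_topology (selfadjoint_ball a)) G \<and>
    subtopology strong_operator_topology (selfadjoint_ball a) closure_of G = selfadjoint_ball a \<and>
    (\<forall>A\<in>G. spectrum A = complex_of_real ` {-a..a} \<and> purely_singular_continuous_spectrum A)"
proof -
  obtain D :: "'h set" where D: "countable D" "closure D = UNIV"
    using assms(1) by (auto simp: separable_space_def)
  define U where "U \<psi> n = {A \<in> selfadjoint_ball a. diffuse a A \<psi> (1 / Suc n)}" for \<psi> :: 'h and n
  define V where "V \<psi> n = {A \<in> selfadjoint_ball a. concentrated a A \<psi> (1 / Suc n)}" for \<psi> :: 'h and n
  define W :: "real \<Rightarrow> nat \<Rightarrow> ('h \<Rightarrow>\<^sub>L 'h) set" where
    "W E n = {A \<in> selfadjoint_ball a. approx_eigenvalue A E (1 / Suc n)}" for E n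
  define Q where "Q = \<rat> \<inter> {-a..a}"
  define \<G> where "\<G> = (\<Union>\<psi>\<in>D. range (U \<psi>)) \<union> (\<Union>\<psi>\<in>D. range (V \<psi>)) \<union> (\<Union>E\<in>Q. range (W E))"
  define G where "G = \<Inter>\<G>"
  have pos: "0 < 1 / real (Suc n)" for n by simp
  have U: "openin (sot_ball a) (U \<psi> n)" "sot_ball a closure_of U \<psi> n = topspace (sot_ball a)" for \<psi> n
    unfolding U_def
    by (rule openin_diffuse strongly_approximable_dense diffuse_approximable[OF assms(2,3) pos])+
  have V: "openin (sot_ball a) (V \<psi> n)" "sot_ball a closure_of V \<psi> n = topspace (sot_ball a)" for \<psi> n
    unfolding V_def
    by (rule openin_concentrated strongly_approximable_dense concentrated_approximable[OF assms(3) pos])+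
  have W: "openin (sot_ball a) (W E n)" "E \<in> Q \<Longrightarrow> sot_ball a closure_of W E n = topspace (sot_ball a)" for E n
    unfolding W_def Q_def
    by (rule openin_approx_eigenvalue)
      (rule strongly_approximable_dense, rule approx_eigenvalue_approximable[OF assms(2) _ pos], simp)
  have \<G>: "openin (sot_ball a) T \<and> sot_ball a closure_of T = topspace (sot_ball a)" if "T \<in> \<G>" for T
    using that unfolding \<G>_def
  proof (elim UnE UN_E rangeE)
  qed (use U V W in simp_all)
  have cnt: "countable \<G>"
    unfolding \<G>_def Q_def by (intro countable_Un countable_UN D(1) countable_Int1 countable_rat) auto
  have mem: "\<psi> \<in> D \<Longrightarrow> U \<psi> n \<in> \<G>" "\<psi> \<in> D \<Longrightarrow> V \<psi> n \<in> \<G>" "E \<in> Q \<Longrightarrow> W E n \<in> \<G>" for \<psi> E n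
    unfolding \<G>_def by (rule UnI1, rule UnI1, erule UN_I, rule rangeI)
      (rule UnI1, rule UnI2, erule UN_I, rule rangeI, rule UnI2, erule UN_I, rule rangeI)
  \<comment> \<open>The intersection of an empty family would be the set of all operators instead of
    a subset of the ball.\<close>
  have "D \<noteq> {}" using D(2) by auto
  then obtain \<psi>0 where "\<psi>0 \<in> D" by blast
  then have ne: "\<G> \<noteq> {}" using mem(1) by blast
  have "sot_ball a closure_of G = topspace (sot_ball a)"
    unfolding G_def
  proof (rule Baire_category[OF _ cnt \<G>])
    show "completely_metrizable_space (sot_ball a :: ('h \<Rightarrow>\<^sub>L 'h) topology) \<or>
        locally_compact_space (sot_ball a :: ('h \<Rightarrow>\<^sub>L 'h) topology) \<and> regular_space (sot_ball a :: ('h \<Rightarrow>\<^sub>L 'h) topology)"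
      using completely_metrizable_sot_ball[OF assms(1) less_imp_le[OF assms(3)]] by blast
  qed
  moreover have "gdelta_in (sot_ball a) G"
    unfolding G_def using \<G> by (intro gdelta_in_Inter[OF cnt ne] open_imp_gdelta_in) blast
  moreover have sub: "G \<subseteq> selfadjoint_ball a"
  proof -
    have "G \<subseteq> U \<psi>0 0"
      unfolding G_def using mem(1)[OF \<open>\<psi>0 \<in> D\<close>, of 0] by (rule Inter_lower)
    moreover have "U \<psi>0 0 \<subseteq> selfadjoint_ball a" unfolding U_def by (rule Collect_restrict)
    ultimately show ?thesis by (rule subset_trans)
  qed
  moreover have "spectrum A = complex_of_real ` {-a..a} \<and> purely_singular_continuous_spectrum A" if "A \<in> G" for A
  proof -
    have A: "selfadjoint A" "norm A \<le> a"
      using sub that by (auto simp: selfadjoint_ball_def)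
    have "A \<in> U \<psi> n" "A \<in> V \<psi> n" if "\<psi> \<in> D" for \<psi> n
      using \<open>A \<in> G\<close> mem that unfolding G_def by (simp_all add: Inter_iff)
    then have "diffuse a A \<psi> (1 / Suc n)" "concentrated a A \<psi> (1 / Suc n)" if "\<psi> \<in> D" for \<psi> n
      using that by (simp_all add: U_def V_def)
    then have "purely_singular_continuous_spectrum A"
      by (rule purely_singular_continuousI[OF A assms(3) D(2)])
    moreover have "A \<in> W E n" if "E \<in> Q" for E n
      using \<open>A \<in> G\<close> mem(3)[OF that] unfolding G_def by (rule InterD)
    then have "approx_eigenvalue A E (1 / Suc n)" if "E \<in> \<rat> \<inter> {-a..a}" for E n
      using that by (simp add: Q_def W_def)
    then have "spectrum A = complex_of_real ` {-a..a}"
      by (rule spectrum_eqI[OF A assms(3)])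
    ultimately show ?thesis by blast
  qed
  ultimately show ?thesis unfolding topspace_sot_ball by blast
qed

end
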